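(* \textsc{Self-Deleting $s$-$t$-path} admits (a) a kernel of size $O(\mathrm{fen})$, where $\mathrm{fen}$ is the feedback edge number of $G$; (b) a kernel of size $O(\mathrm{vc})$ on outerplanar graphs, where $\mathrm{vc}$ is the vertex cover number of $G$; (c) a Turing kernel with $O(\mu)$ vertices on cliques.
   Context: All graphs are finite, simple and undirected. A self-deleting graph is a pair $(G,f)$ where $G=(V,E)$ is a graph and $f\colon V\to 2^{E}$ (the edges in $f(v)$ need not be incident to $v$). A path $(v_1,e_1,v_2,\dots,e_{k-1},v_k)$ in $G$ (with $e_i=\{v_i,v_{i+1}\}$) is $f$-conforming if $e_i\notin f(v_j)$ for all $j\le i$. Let $\mu=\max_{v\in V}|f(v)|$. In \textsc{Self-Deleting $s$-$t$-path}, the input is $(G,f)$ and $s,t\in V(G)$, and the question is whether $G$ contains an $f$-conforming $s$-$t$ path. The feedback edge number is the minimum size of $F\subseteq E$ with $G-F$ a forest; the vertex cover number is the minimum size of $S\subseteq V$ with $G-S$ edgeless. A kernel is a polynomial-time algorithm producing an equivalent instance whose size is bounded by a function of the parameter. A Turing kernel of size $g(p)$ is a polynomial-time algorithm deciding the instance with access to an oracle that answers, in one step, membership of instances of size at most $g(p)$. *)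

theory Defs
  imports "HOL-Analysis.Analysis" "HOL-Library.Landau_Symbols"
    "HOL-Computational_Algebra.Polynomial"
begin

definition simple_graph :: "'a set \<Rightarrow> 'a set set \<Rightarrow> bool" where
  "simple_graph V E \<longleftrightarrow> finite V \<and> (\<forall>e\<in>E. e \<subseteq> V \<and> card e = 2)"

definition complete_graph :: "'a set \<Rightarrow> 'a set set \<Rightarrow> bool" where
  "complete_graph V E \<longleftrightarrow> finite V \<and> E = {e. e \<subseteq> V \<and> card e = 2}"

definition graph_path :: "'a set \<Rightarrow> 'a set set \<Rightarrow> 'a list \<Rightarrow> bool" where
  "graph_path V E vs \<longleftrightarrow> vs \<noteq> [] \<and> distinct vs \<and> set vs \<subseteq> V \<and>
     (\<forall>i. Suc i < length vs \<longrightarrow> {vs ! i, vs ! Suc i} \<in> E)"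

definition graph_cycle :: "'a set \<Rightarrow> 'a set set \<Rightarrow> 'a list \<Rightarrow> bool" where
  "graph_cycle V E vs \<longleftrightarrow> graph_path V E vs \<and> length vs \<ge> 3 \<and> {last vs, hd vs} \<in> E"

definition forest :: "'a set \<Rightarrow> 'a set set \<Rightarrow> bool" where
  "forest V E \<longleftrightarrow> (\<nexists>vs. graph_cycle V E vs)"

definition feedback_edge_number :: "'a set \<Rightarrow> 'a set set \<Rightarrow> nat" where
  "feedback_edge_number V E = (LEAST k. \<exists>F \<subseteq> E. card F = k \<and> forest V (E - F))"

definition vertex_cover_number :: "'a set \<Rightarrow> 'a set set \<Rightarrow> nat" where
  "vertex_cover_number V E = (LEAST k. \<exists>S \<subseteq> V. card S = k \<and> {e \<in> E. e \<subseteq> V - S} = {})"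

text \<open>
  A plane drawing puts vertices at distinct points and represents edges by arcs that meet
  vertices, and each other, only at common ends.  The drawing \<open>D\<close> is bounded, so
  \<open>outside D\<close> (the union of the unbounded components of the complement) is its outer face.
\<close>

definition plane_drawing ::
  "'a set \<Rightarrow> 'a set set \<Rightarrow> ('a \<Rightarrow> complex) \<Rightarrow> ('a set \<Rightarrow> real \<Rightarrow> complex) \<Rightarrow> bool" where
  "plane_drawing V E p \<gamma> \<longleftrightarrow>
     inj_on p V \<and>
     (\<forall>e\<in>E. arc (\<gamma> e) \<and> {pathstart (\<gamma> e), pathfinish (\<gamma> e)} = p ` e \<and>
             path_image (\<gamma> e) \<inter> p ` V = p ` e) \<and>
     (\<forall>e\<in>E. \<forall>e'\<in>E. e \<noteq> e' \<longrightarrow>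
        path_image (\<gamma> e) \<inter> path_image (\<gamma> e') = p ` (e \<inter> e'))"

definition outerplanar :: "'a set \<Rightarrow> 'a set set \<Rightarrow> bool" where
  "outerplanar V E \<longleftrightarrow>
     (\<exists>p \<gamma>. plane_drawing V E p \<gamma> \<and>
        (let D = p ` V \<union> (\<Union>e\<in>E. path_image (\<gamma> e))
         in \<forall>v\<in>V. p v \<in> frontier (outside D)))"

definition self_deleting_graph ::
  "'a set \<Rightarrow> 'a set set \<Rightarrow> ('a \<Rightarrow> 'a set set) \<Rightarrow> bool" where
  "self_deleting_graph V E f \<longleftrightarrow> simple_graph V E \<and> (\<forall>v\<in>V. f v \<subseteq> E)"

definition conforming :: "('a \<Rightarrow> 'a set set) \<Rightarrow> 'a list \<Rightarrow> bool" where
  "conforming f vs \<longleftrightarrow>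
     (\<forall>i j. Suc i < length vs \<longrightarrow> j \<le> i \<longrightarrow> {vs ! i, vs ! Suc i} \<notin> f (vs ! j))"

definition max_deletion :: "'a set \<Rightarrow> ('a \<Rightarrow> 'a set set) \<Rightarrow> nat" where
  "max_deletion V f = Max ((\<lambda>v. card (f v)) ` V)"

text \<open>
  An instance has vertex set \<open>{0..<num_verts X}\<close>; otherwise vertex names could carry information
  not accounted for by the number of vertices and edges.
\<close>

record sd_instance =
  num_verts :: nat
  edges :: "nat set set"
  dels :: "nat \<Rightarrow> nat set set"
  src :: nat
  tgt :: nat

definition verts :: "sd_instance \<Rightarrow> nat set" where
  "verts X = {0..<num_verts X}"

definition sd_instances :: "sd_instance set" where
  "sd_instances = {X. self_deleting_graph (verts X) (edges X) (dels X) \<and>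
     src X \<in> verts X \<and> tgt X \<in> verts X}"

definition outerplanar_instances :: "sd_instance set" where
  "outerplanar_instances = {X \<in> sd_instances. outerplanar (verts X) (edges X)}"

definition clique_instances :: "sd_instance set" where
  "clique_instances = {X \<in> sd_instances. complete_graph (verts X) (edges X)}"

definition self_deleting_st_path :: "sd_instance \<Rightarrow> bool" where
  "self_deleting_st_path X \<longleftrightarrow>
     (\<exists>vs. graph_path (verts X) (edges X) vs \<and> conforming (dels X) vs \<and>
           hd vs = src X \<and> last vs = tgt X)"

definition fen :: "sd_instance \<Rightarrow> nat" where
  "fen X = feedback_edge_number (verts X) (edges X)"

definition vc :: "sd_instance \<Rightarrow> nat" where
  "vc X = vertex_cover_number (verts X) (edges X)"

definition mu :: "sd_instance \<Rightarrow> nat" where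
  "mu X = max_deletion (verts X) (dels X)"

text \<open>
  The size in which kernels are linear is that of the graph.  The deletion sets, whose total size
  can be quadratic, are not counted, but they are bounded in terms of the number of vertices.
\<close>

definition graph_size :: "sd_instance \<Rightarrow> nat" where
  "graph_size X = card (verts X) + card (edges X)"

text \<open>
  Programs are WHILE programs over binary trees, with non-recursive subroutines and an oracle
  instruction.  A variable access is charged the size of the value copied, so the size of
  every value ever built is bounded by the input size plus the time used; hence running times
  are polynomially related to those of (oracle) Turing machines.
\<close>

datatype tree = Leaf | Node tree tree

datatype expr =
    Var nat
  | LeafE
  | NodeE expr expr
  | Left expr
  | Right expr
  | EqE expr expr

datatype com =
    Assign nat expr
  | Seq com com
  | Cond expr com com
  | While expr com
  | Call nat com expr
  | Ask nat expr

type_synonym store = "nat \<Rightarrow> tree"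

fun enc_bool :: "bool \<Rightarrow> tree" where
  "enc_bool False = Leaf"
| "enc_bool True = Node Leaf Leaf"

fun left :: "tree \<Rightarrow> tree" where
  "left Leaf = Leaf"
| "left (Node a b) = a"

fun right :: "tree \<Rightarrow> tree" where
  "right Leaf = Leaf"
| "right (Node a b) = b"

fun eval_expr :: "expr \<Rightarrow> store \<Rightarrow> tree" where
  "eval_expr (Var x) s = s x"
| "eval_expr LeafE s = Leaf"
| "eval_expr (NodeE a b) s = Node (eval_expr a s) (eval_expr b s)"
| "eval_expr (Left a) s = left (eval_expr a s)"
| "eval_expr (Right a) s = right (eval_expr a s)"
| "eval_expr (EqE a b) s = enc_bool (eval_expr a s = eval_expr b s)"

fun expr_time :: "expr \<Rightarrow> store \<Rightarrow> nat" where
  "expr_time (Var x) s = 1 + size (s x)"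
| "expr_time LeafE s = 1"
| "expr_time (NodeE a b) s = 1 + expr_time a s + expr_time b s"
| "expr_time (Left a) s = 1 + expr_time a s"
| "expr_time (Right a) s = 1 + expr_time a s"
| "expr_time (EqE a b) s = 1 + expr_time a s + expr_time b s"

text \<open>Variable \<open>0\<close> holds the input of a program on entry and its output on exit.\<close>

definition init_store :: "tree \<Rightarrow> store" where
  "init_store a = (\<lambda>_. Leaf)(0 := a)"

text \<open>
  \<open>exec \<Omega> c s t s'\<close>: with oracle \<open>\<Omega>\<close>, program \<open>c\<close> started in store \<open>s\<close> halts after time \<open>t\<close>
  in store \<open>s'\<close>.  Every value other than \<open>Leaf\<close> counts as true.  \<open>Call x c e\<close> runs \<open>c\<close> in a
  store of its own on the value of \<open>e\<close> and assigns its output to \<open>x\<close>.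
\<close>

inductive exec :: "(tree \<Rightarrow> bool) \<Rightarrow> com \<Rightarrow> store \<Rightarrow> nat \<Rightarrow> store \<Rightarrow> bool" for \<Omega> where
  Assign: "exec \<Omega> (Assign x e) s (1 + expr_time e s) (s(x := eval_expr e s))"
| Seq: "exec \<Omega> c s t s' \<Longrightarrow> exec \<Omega> d s' t' s'' \<Longrightarrow>
     exec \<Omega> (Seq c d) s (1 + t + t') s''"
| CondTrue: "eval_expr e s \<noteq> Leaf \<Longrightarrow> exec \<Omega> c s t s' \<Longrightarrow>
     exec \<Omega> (Cond e c d) s (1 + expr_time e s + t) s'"
| CondFalse: "eval_expr e s = Leaf \<Longrightarrow> exec \<Omega> d s t s' \<Longrightarrow>
     exec \<Omega> (Cond e c d) s (1 + expr_time e s + t) s'"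
| WhileFalse: "eval_expr e s = Leaf \<Longrightarrow> exec \<Omega> (While e c) s (1 + expr_time e s) s"
| WhileTrue: "eval_expr e s \<noteq> Leaf \<Longrightarrow> exec \<Omega> c s t s' \<Longrightarrow> exec \<Omega> (While e c) s' t' s'' \<Longrightarrow>
     exec \<Omega> (While e c) s (1 + expr_time e s + t + t') s''"
| Call: "exec \<Omega> c (init_store (eval_expr e s)) t s' \<Longrightarrow>
     exec \<Omega> (Call x c e) s (1 + expr_time e s + t + size (s' 0)) (s(x := s' 0))"
| Ask: "exec \<Omega> (Ask x e) s (1 + expr_time e s) (s(x := enc_bool (\<Omega> (eval_expr e s))))"

definition computes_within :: "(tree \<Rightarrow> bool) \<Rightarrow> com \<Rightarrow> tree \<Rightarrow> nat \<Rightarrow> tree \<Rightarrow> bool" where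
  "computes_within \<Omega> c a T b \<longleftrightarrow> (\<exists>t s. exec \<Omega> c (init_store a) t s \<and> t \<le> T \<and> s 0 = b)"

text \<open>
  The graph and each set \<open>f(v)\<close> are encoded by 0/1 matrices, vertices by unary numbers.
\<close>

fun enc_nat :: "nat \<Rightarrow> tree" where
  "enc_nat 0 = Leaf"
| "enc_nat (Suc n) = Node Leaf (enc_nat n)"

fun enc_list :: "tree list \<Rightarrow> tree" where
  "enc_list [] = Leaf"
| "enc_list (a # as) = Node a (enc_list as)"

definition enc_edges :: "nat \<Rightarrow> nat set set \<Rightarrow> tree" where
  "enc_edges n F =
     enc_list (map (\<lambda>u. enc_list (map (\<lambda>v. enc_bool ({u, v} \<in> F)) [0..<n])) [0..<n])"

definition enc_instance :: "sd_instance \<Rightarrow> tree" where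
  "enc_instance X = (let n = num_verts X in
     enc_list [enc_nat n, enc_edges n (edges X),
       enc_list (map (\<lambda>v. enc_edges n (dels X v)) [0..<n]),
       enc_nat (src X), enc_nat (tgt X)])"

text \<open>
  A problem consists of a set \<open>Inst\<close> of instances with encoding \<open>enc\<close>, the predicate \<open>yes\<close>, a
  parameter \<open>\<kappa>\<close> and a size measure \<open>sz\<close>.  A kernel must again be an instance in \<open>Inst\<close>.
  The oracle used for kernels is constant and hence useless.
\<close>

definition admits_kernel ::
  "('i \<Rightarrow> tree) \<Rightarrow> 'i set \<Rightarrow> ('i \<Rightarrow> bool) \<Rightarrow> ('i \<Rightarrow> nat) \<Rightarrow> ('i \<Rightarrow> nat) \<Rightarrow> (nat \<Rightarrow> nat) \<Rightarrow> bool" where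
  "admits_kernel enc Inst yes \<kappa> sz g \<longleftrightarrow>
     (\<exists>c (q :: nat poly). \<forall>x\<in>Inst. \<exists>y\<in>Inst.
        computes_within (\<lambda>_. False) c (enc x) (poly q (size (enc x))) (enc y) \<and>
        (yes y \<longleftrightarrow> yes x) \<and> sz y \<le> g (\<kappa> x))"

text \<open>
  The oracle is only known to be right on instances of size at most \<open>g (\<kappa> x)\<close>.  The algorithm
  has to succeed however the oracle answers other queries, so these are of no use to it.
\<close>

definition admits_turing_kernel ::
  "('i \<Rightarrow> tree) \<Rightarrow> 'i set \<Rightarrow> ('i \<Rightarrow> bool) \<Rightarrow> ('i \<Rightarrow> nat) \<Rightarrow> ('i \<Rightarrow> nat) \<Rightarrow> (nat \<Rightarrow> nat) \<Rightarrow> bool" where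
  "admits_turing_kernel enc Inst yes \<kappa> sz g \<longleftrightarrow>
     (\<exists>c (q :: nat poly). \<forall>x\<in>Inst. \<forall>\<Omega>.
        (\<forall>y\<in>Inst. sz y \<le> g (\<kappa> x) \<longrightarrow> (\<Omega> (enc y) \<longleftrightarrow> yes y)) \<longrightarrow>
        computes_within \<Omega> c (enc x) (poly q (size (enc x))) (enc_bool (yes x)))"

end

theory Submission
  imports Defs
begin

text \<open>
  (a) Vertices other than the terminals that lie on no path between them are deleted, and a path
  \<open>p u v q\<close> with \<open>u\<close>, \<open>v\<close> of degree two is contracted to \<open>p u q\<close>; the deletion sets of the contracted
  vertex depend on the direction of travel, which its two edges can encode.  If \<open>k\<close> is the feedback
  edge number, then every vertex set \<open>S\<close> spans at most \<open>|S| + k\<close> edges, and unlike the feedback edge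
  number itself this bound is easily checked to survive each step.  In an irreducible instance vertices of
  degree two are pairwise nonadjacent, so counting edge ends bounds its size.

  (b) In an outerplanar graph at most \<open>2 |S|\<close> vertices outside \<open>S\<close> have two neighbours in \<open>S\<close>, since
  otherwise there would be a theta graph each of whose three paths has an inner vertex, and these
  cannot all lie on the outer face.  With \<open>S\<close> a vertex cover it suffices to delete the vertices of
  degree at most one; the same property bounds the number of edges.

  (c) In a clique, all vertices but the first two of a shortest conforming path are joined to the source
  by edges that the source deletes.  So for each candidate \<open>v\<close> for the second vertex the
  oracle is asked about the at most \<open>\<mu> + 3\<close> vertices consisting of the terminals, \<open>v\<close> and the
  deleted neighbours of the source.
\<close>

section \<open>Polynomial-time programs\<close>

text \<open>After a few closure lemmas no program is written out: algorithms are functions on trees,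
  built by pairing, branching, maps, filters, searches and iteration, and their cost follows from
  their syntax. The delicate closure is iteration, since iterating a polynomial-time map can blow up
  its values. A size bound on the iterates is available only on encoded instances, whose number of
  vertices never grows; this is why the class is relative to a set of inputs. Since an instance
  lives on an initial segment of the naturals, each deletion also renames vertices, and all
  properties must be carried through the renaming. In (a), two adjacent vertices with a common
  further neighbour \<open>p\<close> form a dead end and are not contracted: with
  \<open>p = q\<close> the new edge would coincide with an old one. In (b), the counting uses
  outerplanarity only through the bound on vertices with two neighbours in a set. It is applied
  twice, to a vertex cover and, through a minimisation, to find a vertex of bounded degree; the
  latter makes the number of edges linear.\<close>

lemma poly_nat_mono: "x \<le> y \<Longrightarrow> poly q x \<le> poly q y" for x y :: nat
  by (induction q) (auto intro!: add_mono mult_mono)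

text \<open>\<open>exec\<close> fixes the exact time; an upper bound lets the branches of a
  conditional and the rounds of a loop share one estimate.\<close>

definition runs :: "(tree \<Rightarrow> bool) \<Rightarrow> com \<Rightarrow> store \<Rightarrow> nat \<Rightarrow> store \<Rightarrow> bool" where
  "runs \<Omega> c s T s' \<longleftrightarrow> (\<exists>t\<le>T. exec \<Omega> c s t s')"

lemma runs_mono: "runs \<Omega> c s T s' \<Longrightarrow> T \<le> T' \<Longrightarrow> runs \<Omega> c s T' s'"
  unfolding runs_def by (meson le_trans)

lemma runs_Assign: "runs \<Omega> (Assign x e) s (1 + expr_time e s) (s(x := eval_expr e s))"
  unfolding runs_def by (meson exec.Assign order_refl)

lemma runs_Ask: "runs \<Omega> (Ask x e) s (1 + expr_time e s) (s(x := enc_bool (\<Omega> (eval_expr e s))))"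
  unfolding runs_def by (meson exec.Ask order_refl)

lemma runs_Seq:
  "runs \<Omega> c s T s' \<Longrightarrow> runs \<Omega> d s' T' s'' \<Longrightarrow> runs \<Omega> (Seq c d) s (1 + T + T') s''"
  unfolding runs_def by (metis exec.Seq add_mono order_refl)

lemma runs_Cond:
  assumes "eval_expr e s \<noteq> Leaf \<Longrightarrow> runs \<Omega> c s T s'" "eval_expr e s = Leaf \<Longrightarrow> runs \<Omega> d s T s'"
  shows "runs \<Omega> (Cond e c d) s (1 + expr_time e s + T) s'"
  using assms unfolding runs_def by (metis exec.CondTrue exec.CondFalse add_left_mono)

lemma runs_WhileFalse:
  "eval_expr e s = Leaf \<Longrightarrow> runs \<Omega> (While e c) s (1 + expr_time e s) s"
  unfolding runs_def by (meson exec.WhileFalse order_refl)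

lemma runs_WhileTrue:
  "eval_expr e s \<noteq> Leaf \<Longrightarrow> runs \<Omega> c s T s' \<Longrightarrow> runs \<Omega> (While e c) s' T' s'' \<Longrightarrow>
     runs \<Omega> (While e c) s (1 + expr_time e s + T + T') s''"
  unfolding runs_def by (metis exec.WhileTrue add_mono order_refl)

lemma runs_Call:
  "runs \<Omega> c (init_store (eval_expr e s)) T s' \<Longrightarrow>
     runs \<Omega> (Call x c e) s (1 + expr_time e s + (T + size (s' 0))) (s(x := s' 0))"
  unfolding runs_def
  by (smt (verit) exec.Call add.assoc add_left_mono add_right_mono)

text \<open>The output size is part of the bound because \<open>Call\<close> is charged for it and
  because the caller needs it to bound the next argument. One program and one polynomial serve all
  oracles.\<close>

definition ptime_on :: "tree set \<Rightarrow> ((tree \<Rightarrow> bool) \<Rightarrow> tree \<Rightarrow> tree) \<Rightarrow> bool" where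
  "ptime_on A f \<longleftrightarrow> (\<exists>c (q :: nat poly). \<forall>\<Omega>. \<forall>a\<in>A. \<exists>t s.
     exec \<Omega> c (init_store a) t s \<and> s 0 = f \<Omega> a \<and> t + size (f \<Omega> a) \<le> poly q (size a))"

abbreviation ptime :: "((tree \<Rightarrow> bool) \<Rightarrow> tree \<Rightarrow> tree) \<Rightarrow> bool" where
  "ptime \<equiv> ptime_on UNIV"

definition pdec :: "((tree \<Rightarrow> bool) \<Rightarrow> tree \<Rightarrow> bool) \<Rightarrow> bool" where
  "pdec P \<longleftrightarrow> ptime (\<lambda>\<Omega> a. enc_bool (P \<Omega> a))"

lemma ptime_on_mono: "ptime_on B f \<Longrightarrow> A \<subseteq> B \<Longrightarrow> ptime_on A f"
  unfolding ptime_on_def by (meson subsetD)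

text \<open>A call runs in a store of its own, so for the caller it is a single assignment. The
  closure proofs below use given programs only through this interface.\<close>

lemma ptime_on_call:
  assumes "ptime_on A f"
  obtains c q where "\<And>\<Omega> a x e s. eval_expr e s = a \<Longrightarrow> a \<in> A \<Longrightarrow>
      runs \<Omega> (Call x c e) s (1 + expr_time e s + poly q (size a)) (s(x := f \<Omega> a))"
    "\<And>\<Omega> a. a \<in> A \<Longrightarrow> size (f \<Omega> a) \<le> poly q (size a)"
proof -
  obtain c q where *: "\<And>\<Omega> a. a \<in> A \<Longrightarrow> \<exists>t s.
     exec \<Omega> c (init_store a) t s \<and> s 0 = f \<Omega> a \<and> t + size (f \<Omega> a) \<le> poly q (size a)"
    using assms unfolding ptime_on_def by blast
  have 1: "runs \<Omega> (Call x c e) s (1 + expr_time e s + poly q (size a)) (s(x := f \<Omega> a))"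
    if ea: "eval_expr e s = a" "a \<in> A" for \<Omega> a x e s
  proof -
    obtain t s' where 1: "exec \<Omega> c (init_store a) t s'" "s' 0 = f \<Omega> a"
      "t + size (f \<Omega> a) \<le> poly q (size a)" using *[OF ea(2)] by blast
    have "runs \<Omega> c (init_store (eval_expr e s)) t s'"
      using 1 ea by (auto simp: runs_def)
    then have "runs \<Omega> (Call x c e) s (1 + expr_time e s + (t + size (s' 0))) (s(x := s' 0))"
      by (rule runs_Call)
    then show ?thesis
      unfolding 1(2) by (rule runs_mono) (use 1(3) in simp)
  qed
  have 2: "size (f \<Omega> a) \<le> poly q (size a)" if "a \<in> A" for \<Omega> a
    using *[OF that] by (metis add_leD2)
  show thesis by (rule that[OF 1 2])
qed

lemma ptime_onI:
  assumes "\<And>\<Omega> a. a \<in> A \<Longrightarrow> \<exists>s. runs \<Omega> c (init_store a) (poly q (size a)) s \<and> s 0 = f \<Omega> a"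
    and "\<And>\<Omega> a. a \<in> A \<Longrightarrow> size (f \<Omega> a) \<le> poly r (size a)"
  shows "ptime_on A f"
  unfolding ptime_on_def
proof (rule exI[of _ c], rule exI[of _ "q + r"], intro allI ballI)
  fix \<Omega> a assume "a \<in> A"
  then obtain s t where "exec \<Omega> c (init_store a) t s" "t \<le> poly q (size a)" "s 0 = f \<Omega> a"
    using assms(1) unfolding runs_def by blast
  then show "\<exists>t s. exec \<Omega> c (init_store a) t s \<and> s 0 = f \<Omega> a \<and>
      t + size (f \<Omega> a) \<le> poly (q + r) (size a)"
    using assms(2)[OF \<open>a \<in> A\<close>] by (auto intro!: add_mono)
qed

lemma init_store_simps [simp]: "init_store a 0 = a"
  by (simp add: init_store_def)

lemma size_enc_bool: "size (enc_bool b) \<le> Suc 0"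
  by (cases b) auto

lemma size_left: "size (left a) \<le> size a" and size_right: "size (right a) \<le> size a"
  by (cases a; simp)+

lemma ptime_expr:
  assumes "\<And>a. expr_time e (init_store a) \<le> poly q (size a)"
    and "\<And>a. size (eval_expr e (init_store a)) \<le> poly r (size a)"
  shows "ptime (\<lambda>\<Omega> a. eval_expr e (init_store a))"
proof (rule ptime_onI[where c = "Assign 0 e" and q = "1 + q" and r = r])
  fix \<Omega> a
  show "\<exists>s. runs \<Omega> (Assign 0 e) (init_store a) (poly (1 + q) (size a)) s \<and>
             s 0 = eval_expr e (init_store a)"
    using runs_mono[OF runs_Assign[of \<Omega> 0 e "init_store a"], of "poly (1 + q) (size a)"] assms(1)[of a]
    by (intro exI[of _ "(init_store a)(0 := eval_expr e (init_store a))"]) auto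
qed (use assms in auto)

lemma ptime_id: "ptime (\<lambda>\<Omega> a. a)"
  using ptime_expr[of "Var 0" "[:1,1:]" "[:0,1:]"] by simp

lemma ptime_Leaf: "ptime (\<lambda>\<Omega> a. Leaf)"
  using ptime_expr[of "LeafE" "[:1,1:]" "[:0,1:]"] by simp

lemma ptime_left0: "ptime (\<lambda>\<Omega> a. left a)"
  using ptime_expr[of "Left (Var 0)" "[:2,1:]" "[:0,1:]"] by (simp add: size_left)

lemma ptime_right0: "ptime (\<lambda>\<Omega> a. right a)"
  using ptime_expr[of "Right (Var 0)" "[:2,1:]" "[:0,1:]"] by (simp add: size_right)

lemma pdec_eq0: "pdec (\<lambda>\<Omega> a. left a = right a)"
  unfolding pdec_def
  using ptime_expr[of "EqE (Left (Var 0)) (Right (Var 0))" "[:5,2:]" "[:1:]"]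
  by (simp add: size_enc_bool)

lemma pdec_oracle0: "pdec (\<lambda>\<Omega> a. \<Omega> a)"
  unfolding pdec_def
proof (rule ptime_onI[where c = "Ask 0 (Var 0)" and q = "[:2,1:]" and r = "[:1:]"])
  fix \<Omega> a
  show "\<exists>s. runs \<Omega> (Ask 0 (Var 0)) (init_store a) (poly [:2, 1:] (size a)) s \<and> s 0 = enc_bool (\<Omega> a)"
    by (rule exI, rule conjI, rule runs_mono[OF runs_Ask]) auto
qed (simp add: size_enc_bool)

lemma ptime_on_comp:
  assumes "ptime_on B f" "ptime_on A g" "\<And>\<Omega> a. a \<in> A \<Longrightarrow> g \<Omega> a \<in> B"
  shows "ptime_on A (\<lambda>\<Omega> a. f \<Omega> (g \<Omega> a))"
proof -
  obtain cf qf where f: "\<And>\<Omega> a x e s. eval_expr e s = a \<Longrightarrow> a \<in> B \<Longrightarrow>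
      runs \<Omega> (Call x cf e) s (1 + expr_time e s + poly qf (size a)) (s(x := f \<Omega> a))"
    "\<And>\<Omega> a. a \<in> B \<Longrightarrow> size (f \<Omega> a) \<le> poly qf (size a)" by (rule ptime_on_call[OF assms(1)]) blast
  obtain cg qg where g: "\<And>\<Omega> a x e s. eval_expr e s = a \<Longrightarrow> a \<in> A \<Longrightarrow>
      runs \<Omega> (Call x cg e) s (1 + expr_time e s + poly qg (size a)) (s(x := g \<Omega> a))"
    "\<And>\<Omega> a. a \<in> A \<Longrightarrow> size (g \<Omega> a) \<le> poly qg (size a)" by (rule ptime_on_call[OF assms(2)]) blast
  have fg: "poly qf (size (g \<Omega> a)) \<le> poly (pcompose qf qg) (size a)" if "a \<in> A" for \<Omega> a
    by (simp add: poly_pcompose poly_nat_mono g(2)[OF that])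
  show ?thesis
  proof (rule ptime_onI[where c = "Seq (Call 0 cg (Var 0)) (Call 0 cf (Var 0))"
        and q = "[:5,1:] + qg + qg + pcompose qf qg" and r = "pcompose qf qg"])
    fix \<Omega> a assume a: "a \<in> A"
    let ?s = "(init_store a)(0 := g \<Omega> a)"
    have "runs \<Omega> (Seq (Call 0 cg (Var 0)) (Call 0 cf (Var 0))) (init_store a)
      (1 + (1 + expr_time (Var 0) (init_store a) + poly qg (size a)) +
        (1 + expr_time (Var 0) ?s + poly qf (size (g \<Omega> a)))) (?s(0 := f \<Omega> (g \<Omega> a)))"
      by (rule runs_Seq[OF g(1)[of "Var 0" "init_store a" a] f(1)[of "Var 0" ?s "g \<Omega> a"]]) (use a assms(3) in auto)
    then have "runs \<Omega> (Seq (Call 0 cg (Var 0)) (Call 0 cf (Var 0))) (init_store a)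
      (poly ([:5,1:] + qg + qg + pcompose qf qg) (size a)) (?s(0 := f \<Omega> (g \<Omega> a)))"
      by (rule runs_mono) (use g(2)[OF a, of \<Omega>] fg[OF a, of \<Omega>] in simp)
    then show "\<exists>s. runs \<Omega> (Seq (Call 0 cg (Var 0)) (Call 0 cf (Var 0))) (init_store a)
      (poly ([:5,1:] + qg + qg + pcompose qf qg) (size a)) s \<and> s 0 = f \<Omega> (g \<Omega> a)"
      by auto
  qed (use f(2) fg assms(3) le_trans in blast)
qed

lemma ptime_on_pair:
  assumes "ptime_on A f" "ptime_on A g"
  shows "ptime_on A (\<lambda>\<Omega> a. Node (f \<Omega> a) (g \<Omega> a))"
proof -
  obtain cf qf where f: "\<And>\<Omega> a x e s. eval_expr e s = a \<Longrightarrow> a \<in> A \<Longrightarrow>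
      runs \<Omega> (Call x cf e) s (1 + expr_time e s + poly qf (size a)) (s(x := f \<Omega> a))"
    "\<And>\<Omega> a. a \<in> A \<Longrightarrow> size (f \<Omega> a) \<le> poly qf (size a)" by (rule ptime_on_call[OF assms(1)]) blast
  obtain cg qg where g: "\<And>\<Omega> a x e s. eval_expr e s = a \<Longrightarrow> a \<in> A \<Longrightarrow>
      runs \<Omega> (Call x cg e) s (1 + expr_time e s + poly qg (size a)) (s(x := g \<Omega> a))"
    "\<And>\<Omega> a. a \<in> A \<Longrightarrow> size (g \<Omega> a) \<le> poly qg (size a)" by (rule ptime_on_call[OF assms(2)]) blast
  let ?c = "Seq (Seq (Call 1 cf (Var 0)) (Call 2 cg (Var 0))) (Assign 0 (NodeE (Var 1) (Var 2)))"
  let ?q = "[:11,2:] + qf + qf + qg + qg"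
  show ?thesis
  proof (rule ptime_onI[where c = ?c and q = ?q and r = "1 + qf + qg"])
    fix \<Omega> a assume a: "a \<in> A"
    let ?s = "(init_store a)(1 := f \<Omega> a, 2 := g \<Omega> a)"
    have "runs \<Omega> ?c (init_store a) (poly ?q (size a)) (?s(0 := eval_expr (NodeE (Var 1) (Var 2)) ?s))"
      by (rule runs_mono[OF runs_Seq[OF runs_Seq[OF f(1)[of "Var 0" "init_store a" a]
              g(1)[of "Var 0" "(init_store a)(1 := f \<Omega> a)" a]] runs_Assign]])
        (use a f(2)[OF a, of \<Omega>] g(2)[OF a, of \<Omega>] in auto)
    then show "\<exists>s. runs \<Omega> ?c (init_store a) (poly ?q (size a)) s \<and> s 0 = Node (f \<Omega> a) (g \<Omega> a)"
      by auto
  next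
    fix \<Omega> a assume a: "a \<in> A"
    show "size (Node (f \<Omega> a) (g \<Omega> a)) \<le> poly (1 + qf + qg) (size a)"
      using f(2)[OF a, of \<Omega>] g(2)[OF a, of \<Omega>] by simp
  qed
qed

lemma ptime_if:
  assumes "pdec P" "ptime f" "ptime g"
  shows "ptime (\<lambda>\<Omega> a. if P \<Omega> a then f \<Omega> a else g \<Omega> a)"
proof -
  obtain cb qb where b: "\<And>\<Omega> a x e s. eval_expr e s = a \<Longrightarrow> a \<in> UNIV \<Longrightarrow>
      runs \<Omega> (Call x cb e) s (1 + expr_time e s + poly qb (size a)) (s(x := enc_bool (P \<Omega> a)))"
    by (rule ptime_on_call[OF assms(1)[unfolded pdec_def]]) blast
  obtain cf qf where f: "\<And>\<Omega> a x e s. eval_expr e s = a \<Longrightarrow> a \<in> UNIV \<Longrightarrow>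
      runs \<Omega> (Call x cf e) s (1 + expr_time e s + poly qf (size a)) (s(x := f \<Omega> a))"
    "\<And>\<Omega> a. a \<in> UNIV \<Longrightarrow> size (f \<Omega> a) \<le> poly qf (size a)" by (rule ptime_on_call[OF assms(2)]) blast
  obtain cg qg where g: "\<And>\<Omega> a x e s. eval_expr e s = a \<Longrightarrow> a \<in> UNIV \<Longrightarrow>
      runs \<Omega> (Call x cg e) s (1 + expr_time e s + poly qg (size a)) (s(x := g \<Omega> a))"
    "\<And>\<Omega> a. a \<in> UNIV \<Longrightarrow> size (g \<Omega> a) \<le> poly qg (size a)" by (rule ptime_on_call[OF assms(3)]) blast
  let ?c = "Seq (Call 1 cb (Var 0)) (Cond (Var 1) (Call 0 cf (Var 0)) (Call 0 cg (Var 0)))"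
  let ?q = "[:8,2:] + qb + (qf + qg)"
  show ?thesis
  proof (rule ptime_onI[where c = ?c and q = ?q and r = "qf + qg"])
    fix \<Omega> a
    let ?s = "(init_store a)(1 := enc_bool (P \<Omega> a))"
    let ?r = "if P \<Omega> a then f \<Omega> a else g \<Omega> a"
    have "runs \<Omega> (Call 0 cf (Var 0)) ?s (2 + size a + poly (qf + qg) (size a)) (?s(0 := ?r))"
      if "P \<Omega> a"
      using runs_mono[OF f(1)[of "Var 0" ?s a \<Omega> 0]] that by simp
    moreover have "runs \<Omega> (Call 0 cg (Var 0)) ?s (2 + size a + poly (qf + qg) (size a)) (?s(0 := ?r))"
      if "\<not> P \<Omega> a"
      using runs_mono[OF g(1)[of "Var 0" ?s a \<Omega> 0]] that by simp
    ultimately have "runs \<Omega> (Cond (Var 1) (Call 0 cf (Var 0)) (Call 0 cg (Var 0))) ?s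
       (1 + expr_time (Var 1) ?s + (2 + size a + poly (qf + qg) (size a))) (?s(0 := ?r))"
      by (intro runs_Cond) (cases "P \<Omega> a"; simp)+
    note * = this
    have "runs \<Omega> ?c (init_store a) (poly ?q (size a)) (?s(0 := ?r))"
      by (rule runs_mono[OF runs_Seq[OF b[of "Var 0" "init_store a" a \<Omega> 1] *]]) (use size_enc_bool[of "P \<Omega> a"] in auto)
    then show "\<exists>s. runs \<Omega> ?c (init_store a) (poly ?q (size a)) s \<and> s 0 = ?r"
      by (intro exI[of _ "?s(0 := ?r)"]) simp
  next
    fix \<Omega> a
    show "size (if P \<Omega> a then f \<Omega> a else g \<Omega> a) \<le> poly (qf + qg) (size a)"
      using f(2)[of a \<Omega>] g(2)[of a \<Omega>] by simp
  qed
qed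

text \<open>The right spine read as a list. Every tree is \<open>enc_list\<close> of exactly one
  list, so list programs need no error cases, and the length of the list can drive a loop.\<close>

fun elems :: "tree \<Rightarrow> tree list" where
  "elems Leaf = []"
| "elems (Node a b) = a # elems b"

lemma length_elems: "length (elems a) \<le> size a"
  by (induction a) auto

text \<open>Even a doubling map iterated linearly often produces values of exponential size, so a
  polynomial \<open>p\<close> bounding all iterates has to be supplied. Variable 1 holds the current
  value, variable 2 the counter, which loses one list element per round.\<close>

lemma ptime_on_iterate:
  assumes "ptime_on B g" "ptime_on A x" "ptime_on A k"
    and B: "\<And>\<Omega> a i. a \<in> A \<Longrightarrow> i < length (elems (k \<Omega> a)) \<Longrightarrow> (g \<Omega> ^^ i) (x \<Omega> a) \<in> B"
    and p: "\<And>\<Omega> a i. a \<in> A \<Longrightarrow> i \<le> length (elems (k \<Omega> a)) \<Longrightarrow>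
      size ((g \<Omega> ^^ i) (x \<Omega> a)) \<le> poly p (size a)"
  shows "ptime_on A (\<lambda>\<Omega> a. (g \<Omega> ^^ length (elems (k \<Omega> a))) (x \<Omega> a))"
proof -
  obtain cg qg where g: "\<And>\<Omega> a x e s. eval_expr e s = a \<Longrightarrow> a \<in> B \<Longrightarrow>
      runs \<Omega> (Call x cg e) s (1 + expr_time e s + poly qg (size a)) (s(x := g \<Omega> a))"
    "\<And>\<Omega> a. a \<in> B \<Longrightarrow> size (g \<Omega> a) \<le> poly qg (size a)" by (rule ptime_on_call[OF assms(1)]) blast
  obtain cx qx where x: "\<And>\<Omega> a y e s. eval_expr e s = a \<Longrightarrow> a \<in> A \<Longrightarrow>
      runs \<Omega> (Call y cx e) s (1 + expr_time e s + poly qx (size a)) (s(y := x \<Omega> a))"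
    "\<And>\<Omega> a. a \<in> A \<Longrightarrow> size (x \<Omega> a) \<le> poly qx (size a)" by (rule ptime_on_call[OF assms(2)]) blast
  obtain ck qk where k: "\<And>\<Omega> a y e s. eval_expr e s = a \<Longrightarrow> a \<in> A \<Longrightarrow>
      runs \<Omega> (Call y ck e) s (1 + expr_time e s + poly qk (size a)) (s(y := k \<Omega> a))"
    "\<And>\<Omega> a. a \<in> A \<Longrightarrow> size (k \<Omega> a) \<le> poly qk (size a)" by (rule ptime_on_call[OF assms(3)]) blast
  let ?body = "Seq (Call 1 cg (Var 1)) (Assign 2 (Right (Var 2)))"
  let ?w = "While (Var 2) ?body"
  \<comment> \<open>\<open>N\<close> bounds the counter and \<open>M\<close> all values in advance,
    so each round has the same bound: 2 + N for the test and 6 + M + poly qg M + N for the body. The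
    leading 2 is the final, failing test.\<close>
  have loop: "\<exists>s'. runs \<Omega> ?w s (2 + length (elems (s 2)) * (8 + 2 * N + M + poly qg M)) s' \<and>
      s' 1 = (g \<Omega> ^^ length (elems (s 2))) (s 1)"
    if "size (s 2) \<le> N" "\<And>i. i < length (elems (s 2)) \<Longrightarrow> (g \<Omega> ^^ i) (s 1) \<in> B"
      "\<And>i. i \<le> length (elems (s 2)) \<Longrightarrow> size ((g \<Omega> ^^ i) (s 1)) \<le> M" for \<Omega> s N M
    using that
  proof (induction "length (elems (s 2))" arbitrary: s)
    case 0
    then have "s 2 = Leaf" by (cases "s 2") auto
    then have "runs \<Omega> ?w s 2 s"
      using runs_WhileFalse[of "Var 2" s \<Omega> ?body] by (simp add: numeral_2_eq_2)
    with \<open>s 2 = Leaf\<close> show ?case by fastforce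
  next
    case (Suc l)
    let ?W = "8 + 2 * N + M + poly qg M"
    obtain k1 k2 where s2: "s 2 = Node k1 k2" using Suc.hyps(2) by (cases "s 2") auto
    let ?s = "s(1 := g \<Omega> (s 1), 2 := right (s 2))"
    have l: "length (elems (?s 2)) = l" using Suc.hyps(2) s2 by simp
    have s1: "s 1 \<in> B" "size (s 1) \<le> M"
      using Suc.prems(2)[of 0] Suc.prems(3)[of 0] s2 by auto
    have 1: "runs \<Omega> (Call 1 cg (Var 1)) s (2 + M + poly qg M) (s(1 := g \<Omega> (s 1)))"
      by (rule runs_mono[OF g(1)[of "Var 1" s "s 1" \<Omega> 1]])
        (use s1 poly_nat_mono[OF s1(2), of qg] in simp_all)
    have 2: "runs \<Omega> (Assign 2 (Right (Var 2))) (s(1 := g \<Omega> (s 1))) (3 + N) ?s"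
      using runs_mono[OF runs_Assign[of \<Omega> 2 "Right (Var 2)" "s(1 := g \<Omega> (s 1))"], of "3 + N"]
        Suc.prems(1) by simp
    have body: "runs \<Omega> ?body s (6 + M + poly qg M + N) ?s"
      by (rule runs_mono[OF runs_Seq[OF 1 2]]) linarith
    have "\<exists>s'. runs \<Omega> ?w ?s (2 + length (elems (?s 2)) * ?W) s' \<and>
        s' 1 = (g \<Omega> ^^ length (elems (?s 2))) (?s 1)"
    proof (rule Suc.hyps(1))
      show "size (?s 2) \<le> N" using Suc.prems(1) s2 by simp
      show "(g \<Omega> ^^ i) (?s 1) \<in> B" if "i < length (elems (?s 2))" for i
        using Suc.prems(2)[of "Suc i"] that l Suc.hyps(2)
        by (simp add: funpow_Suc_right del: funpow.simps)
      show "size ((g \<Omega> ^^ i) (?s 1)) \<le> M" if "i \<le> length (elems (?s 2))" for i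
        using Suc.prems(3)[of "Suc i"] that l Suc.hyps(2)
        by (simp add: funpow_Suc_right del: funpow.simps)
    qed (use l in simp)
    then obtain s' where s': "runs \<Omega> ?w ?s (2 + l * ?W) s'" "s' 1 = (g \<Omega> ^^ l) (g \<Omega> (s 1))"
      unfolding l by auto
    have "1 + expr_time (Var 2) s + (6 + M + poly qg M + N) + (2 + l * ?W) \<le> 2 + Suc l * ?W"
      using Suc.prems(1) unfolding mult_Suc expr_time.simps by linarith
    then have "runs \<Omega> ?w s (2 + Suc l * ?W) s'"
      by (rule runs_mono[OF runs_WhileTrue[OF _ body s'(1)], rotated]) (use s2 in simp)
    moreover have "s' 1 = (g \<Omega> ^^ Suc l) (s 1)"
      using s'(2) by (simp add: funpow_swap1)
    ultimately show ?case using Suc.hyps(2) by metis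
  qed
  let ?c = "Seq (Seq (Seq (Call 1 cx (Var 0)) (Call 2 ck (Var 0))) ?w) (Assign 0 (Var 1))"
  let ?q = "[:11,2:] + qx + qk + qk * ([:8:] + 2 * qk + p + pcompose qg p) + p"
  show ?thesis
  proof (rule ptime_onI[where c = ?c and q = ?q and r = p])
    fix \<Omega> a assume a: "a \<in> A"
    let ?s = "(init_store a)(1 := x \<Omega> a, 2 := k \<Omega> a)"
    let ?l = "length (elems (k \<Omega> a))"
    let ?N = "poly qk (size a)" and ?M = "poly p (size a)"
    obtain s' where s': "runs \<Omega> ?w ?s (2 + ?l * (8 + 2 * ?N + ?M + poly qg ?M)) s'"
      "s' 1 = (g \<Omega> ^^ ?l) (x \<Omega> a)"
      using loop[of ?s ?N \<Omega> ?M] k(2)[OF a] B[OF a] p[OF a] by auto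
    have "?l \<le> ?N" using length_elems k(2)[OF a] le_trans by blast
    then have l: "?l * (8 + 2 * ?N + ?M + poly qg ?M) \<le> ?N * (8 + 2 * ?N + ?M + poly qg ?M)"
      by (rule mult_le_mono1)
    have q: "poly ?q (size a) = 11 + 2 * size a + poly qx (size a) + poly qk (size a)
        + ?N * (8 + 2 * ?N + ?M + poly qg ?M) + ?M"
      by (simp only: poly_add poly_mult poly_pcompose poly_pCons poly_0 poly_numeral) simp
    have "size (s' 1) \<le> ?M" using s'(2) p[OF a] by simp
    have 1: "runs \<Omega> (Call 1 cx (Var 0)) (init_store a) (2 + size a + poly qx (size a))
        ((init_store a)(1 := x \<Omega> a))"
      using x(1)[of "Var 0" "init_store a" a \<Omega> 1] a by simp
    have 2: "runs \<Omega> (Call 2 ck (Var 0)) ((init_store a)(1 := x \<Omega> a)) (2 + size a + poly qk (size a)) ?s"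
      using k(1)[of "Var 0" "(init_store a)(1 := x \<Omega> a)" a \<Omega> 2] a by simp
    have 3: "runs \<Omega> (Assign 0 (Var 1)) s' (2 + ?M) (s'(0 := s' 1))"
      using runs_mono[OF runs_Assign[of \<Omega> 0 "Var 1" s'], of "2 + ?M"] \<open>size (s' 1) \<le> ?M\<close> by simp
    have "runs \<Omega> ?c (init_store a) (poly ?q (size a)) (s'(0 := s' 1))"
      unfolding q by (rule runs_mono[OF runs_Seq[OF runs_Seq[OF runs_Seq[OF 1 2] s'(1)] 3]])
        (use l in linarith)
    then show "\<exists>s. runs \<Omega> ?c (init_store a) (poly ?q (size a)) s \<and> s 0 = (g \<Omega> ^^ ?l) (x \<Omega> a)"
      using s'(2) by auto
  qed (use p in auto)
qed

section \<open>Computations on lists\<close>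

lemma ptime_comp: "ptime f \<Longrightarrow> ptime g \<Longrightarrow> ptime (\<lambda>\<Omega> a. f \<Omega> (g \<Omega> a))"
  by (rule ptime_on_comp) auto

text \<open>A binary function is treated as a unary function of a pair. The same form, with
  \<open>left p\<close> and \<open>right p\<close>, is the premise for the bodies of maps, filters
  and quantifiers, where the right component is a list element and the left one the surrounding
  input.\<close>

lemma ptime_comp2:
  assumes "ptime (\<lambda>\<Omega> p. f \<Omega> (left p) (right p))" "ptime g" "ptime h"
  shows "ptime (\<lambda>\<Omega> a. f \<Omega> (g \<Omega> a) (h \<Omega> a))"
  using ptime_comp[OF assms(1) ptime_on_pair[OF assms(2,3)]] by simp

lemma pdec_comp: "pdec P \<Longrightarrow> ptime g \<Longrightarrow> pdec (\<lambda>\<Omega> a. P \<Omega> (g \<Omega> a))"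
  unfolding pdec_def by (rule ptime_comp)

lemma pdec_comp2:
  assumes "pdec (\<lambda>\<Omega> p. P \<Omega> (left p) (right p))" "ptime g" "ptime h"
  shows "pdec (\<lambda>\<Omega> a. P \<Omega> (g \<Omega> a) (h \<Omega> a))"
  using pdec_comp[OF assms(1) ptime_on_pair[OF assms(2,3)]] by simp

lemma ptime_left: "ptime f \<Longrightarrow> ptime (\<lambda>\<Omega> a. left (f \<Omega> a))"
  by (rule ptime_comp[OF ptime_left0])

lemma ptime_right: "ptime f \<Longrightarrow> ptime (\<lambda>\<Omega> a. right (f \<Omega> a))"
  by (rule ptime_comp[OF ptime_right0])

lemma pdec_eq: "ptime f \<Longrightarrow> ptime g \<Longrightarrow> pdec (\<lambda>\<Omega> a. f \<Omega> a = g \<Omega> a)"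
  using pdec_comp2[of "\<lambda>\<Omega> x y. x = y", OF pdec_eq0] .

lemma pdec_oracle: "ptime f \<Longrightarrow> pdec (\<lambda>\<Omega> a. \<Omega> (f \<Omega> a))"
  by (rule pdec_comp[OF pdec_oracle0])

lemma ptime_enc_bool: "pdec P \<Longrightarrow> ptime (\<lambda>\<Omega> a. enc_bool (P \<Omega> a))"
  by (simp add: pdec_def)

lemma pdec_const: "pdec (\<lambda>\<Omega> a. b)"
  unfolding pdec_def by (cases b) (simp_all add: ptime_Leaf ptime_on_pair)

lemma enc_bool_if:
  "enc_bool (\<not> P) = (if P then Leaf else Node Leaf Leaf)"
  "enc_bool (P \<and> Q) = (if P then enc_bool Q else Leaf)"
  "enc_bool (P \<or> Q) = (if P then Node Leaf Leaf else enc_bool Q)"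
  by (cases P; simp)+

lemma pdec_not: "pdec P \<Longrightarrow> pdec (\<lambda>\<Omega> a. \<not> P \<Omega> a)"
  and pdec_conj: "pdec P \<Longrightarrow> pdec Q \<Longrightarrow> pdec (\<lambda>\<Omega> a. P \<Omega> a \<and> Q \<Omega> a)"
  and pdec_disj: "pdec P \<Longrightarrow> pdec Q \<Longrightarrow> pdec (\<lambda>\<Omega> a. P \<Omega> a \<or> Q \<Omega> a)"
  unfolding pdec_def enc_bool_if
  by (intro ptime_if ptime_on_pair ptime_Leaf; simp add: pdec_def)+

lemma pdec_imp: "pdec P \<Longrightarrow> pdec Q \<Longrightarrow> pdec (\<lambda>\<Omega> a. P \<Omega> a \<longrightarrow> Q \<Omega> a)"
  unfolding imp_conv_disj by (intro pdec_disj pdec_not)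

lemma elems_enc_list [simp]: "elems (enc_list xs) = xs"
  by (induction xs) auto

lemma elems_right: "elems (right a) = tl (elems a)"
  by (cases a) auto

lemma left_eq_hd: "elems a \<noteq> [] \<Longrightarrow> left a = hd (elems a)"
  by (cases a) auto

lemma elems_funpow_right: "elems ((right ^^ i) a) = drop i (elems a)"
  by (induction i) (simp_all add: elems_right drop_Suc tl_drop)

lemma left_funpow_right: "i < length (elems a) \<Longrightarrow> left ((right ^^ i) a) = elems a ! i"
  by (simp add: left_eq_hd elems_funpow_right hd_drop_conv_nth)

lemma size_funpow_right: "size ((right ^^ i) a) \<le> size a"
  by (induction i) (auto intro: le_trans[OF size_right])

lemma size_elems: "x \<in> set (elems a) \<Longrightarrow> size x \<le> size a"
  by (induction a) auto

lemma size_enc_list_le: "(\<And>x. x \<in> set xs \<Longrightarrow> size x \<le> m) \<Longrightarrow> size (enc_list xs) \<le> length xs * (m + 1)"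
proof (induction xs)
  case (Cons a xs)
  then have "size (enc_list xs) \<le> length xs * (m + 1)" "size a \<le> m" by auto
  then show ?case by simp
qed simp

text \<open>One pass with a state of three components: the fixed context, the unread rest of the
  list and the result so far. Pushing onto the result reverses the order; a second pass,
  \<open>ptime_rev\<close>, restores it.\<close>

lemma ptime_rev_filter_map:
  assumes l: "ptime l"
    and P: "pdec (\<lambda>\<Omega> p. P \<Omega> (left p) (right p))" and G: "ptime (\<lambda>\<Omega> p. G \<Omega> (left p) (right p))"
  shows "ptime (\<lambda>\<Omega> a. enc_list (rev (map (G \<Omega> a) (filter (P \<Omega> a) (elems (l \<Omega> a))))))"
proof -
  obtain ql where ql: "\<And>\<Omega> a. size (l \<Omega> a) \<le> poly ql (size a)"
    by (rule ptime_on_call[OF l]) blast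
  obtain qG where qG: "\<And>\<Omega> p. size (G \<Omega> (left p) (right p)) \<le> poly qG (size p)"
    by (rule ptime_on_call[OF G]) blast
  define step where "step = (\<lambda>\<Omega> s. let c = left s; r = left (right s); b = right (right s) in
     Node c (Node (right r) (if P \<Omega> c (left r) then Node (G \<Omega> c (left r)) b else b)))"
  have step: "ptime step"
    unfolding step_def Let_def
    by (intro ptime_on_pair ptime_right ptime_left ptime_if pdec_comp2[OF P] ptime_comp2[OF G] ptime_id)
  have iter: "(step \<Omega> ^^ i) (Node a (Node k Leaf)) =
     Node a (Node ((right ^^ i) k) (enc_list (rev (map (G \<Omega> a) (filter (P \<Omega> a) (take i (elems k)))))))"
    if "i \<le> length (elems k)" for \<Omega> i a k
    using that
    by (induction i) (auto simp: step_def Let_def left_funpow_right take_Suc_conv_app_nth)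
  let ?p = "[:2,1:] + ql + ql * (pcompose qG ([:1,1:] + ql) + 1)"
  have sz: "size ((step \<Omega> ^^ i) (Node a (Node (l \<Omega> a) Leaf))) \<le> poly ?p (size a)"
    if i: "i \<le> length (elems (l \<Omega> a))" for \<Omega> i a
  proof -
    let ?xs = "rev (map (G \<Omega> a) (filter (P \<Omega> a) (take i (elems (l \<Omega> a)))))"
    have "size (G \<Omega> a x) \<le> poly (pcompose qG ([:1,1:] + ql)) (size a)" if "x \<in> set (elems (l \<Omega> a))" for x
    proof -
      have "size (G \<Omega> a x) \<le> poly qG (size (Node a x))" using qG[of \<Omega> "Node a x"] by simp
      also have "\<dots> \<le> poly qG (poly ([:1,1:] + ql) (size a))"
        using size_elems[OF that] ql[of \<Omega> a] by (intro poly_nat_mono) simp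
      finally show ?thesis by (simp add: poly_pcompose)
    qed
    then have "size (enc_list ?xs) \<le> length ?xs * (poly (pcompose qG ([:1,1:] + ql)) (size a) + 1)"
      by (intro size_enc_list_le) (auto dest: in_set_takeD)
    moreover have "length ?xs \<le> poly ql (size a)"
    proof -
      have "length ?xs \<le> length (take i (elems (l \<Omega> a)))"
        unfolding length_rev length_map by (rule length_filter_le)
      also have "\<dots> \<le> length (elems (l \<Omega> a))" by simp
      also have "\<dots> \<le> size (l \<Omega> a)" by (rule length_elems)
      finally show ?thesis using ql[of \<Omega> a] by linarith
    qed
    ultimately have "size (enc_list ?xs) \<le> poly ql (size a) * (poly (pcompose qG ([:1,1:] + ql)) (size a) + 1)"
      by (meson le_trans mult_le_mono1)
    moreover have "size ((right ^^ i) (l \<Omega> a)) \<le> poly ql (size a)"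
      using size_funpow_right ql le_trans by blast
    moreover have "poly ?p (size a) = 2 + size a + poly ql (size a) +
        poly ql (size a) * (poly (pcompose qG ([:1,1:] + ql)) (size a) + 1)"
      by (simp only: poly_add poly_mult poly_pCons poly_0 poly_1) simp
    ultimately show ?thesis unfolding iter[OF i] by simp
  qed
  have "ptime (\<lambda>\<Omega> a. (step \<Omega> ^^ length (elems (l \<Omega> a))) (Node a (Node (l \<Omega> a) Leaf)))"
    by (rule ptime_on_iterate[OF step]) (auto intro!: ptime_on_pair ptime_id ptime_Leaf l sz)
  from ptime_right[OF ptime_right[OF this]] show ?thesis
    by (simp add: iter)
qed

definition mapT :: "(tree \<Rightarrow> tree) \<Rightarrow> tree \<Rightarrow> tree" where
  "mapT G a = enc_list (map G (elems a))"

definition filterT :: "(tree \<Rightarrow> bool) \<Rightarrow> tree \<Rightarrow> tree" where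
  "filterT P a = enc_list (filter P (elems a))"

text \<open>Only the length of the index as a list matters. Positions beyond the end give
  \<open>Leaf\<close>, which is also the code of \<open>False\<close>.\<close>

definition nthT :: "tree \<Rightarrow> tree \<Rightarrow> tree" where
  "nthT a k = left ((right ^^ length (elems k)) a)"

definition uptT :: "tree \<Rightarrow> tree" where
  "uptT k = enc_list (map enc_nat [0..<length (elems k)])"

lemma ptime_rev: "ptime l \<Longrightarrow> ptime (\<lambda>\<Omega> a. enc_list (rev (elems (l \<Omega> a))))"
  using ptime_rev_filter_map[of l "\<lambda>_ _ _. True" "\<lambda>_ _ x. x"] by (simp add: pdec_const ptime_right ptime_id)

lemma ptime_mapT:
  assumes "ptime (\<lambda>\<Omega> p. G \<Omega> (left p) (right p))" "ptime l"
  shows "ptime (\<lambda>\<Omega> a. mapT (\<lambda>x. G \<Omega> a x) (l \<Omega> a))"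
  using ptime_rev[OF ptime_rev_filter_map[of l "\<lambda>_ _ _. True" G]] assms
  by (simp add: pdec_const mapT_def)

lemma ptime_filterT:
  assumes "pdec (\<lambda>\<Omega> p. P \<Omega> (left p) (right p))" "ptime l"
  shows "ptime (\<lambda>\<Omega> a. filterT (\<lambda>x. P \<Omega> a x) (l \<Omega> a))"
  using ptime_rev[OF ptime_rev_filter_map[of l P "\<lambda>_ _ x. x"]] assms
  by (simp add: ptime_right ptime_id filterT_def)

lemma filterT_eq_Leaf: "filterT P a = Leaf \<longleftrightarrow> (\<forall>x\<in>set (elems a). \<not> P x)"
  by (metis elems.simps(1) elems_enc_list enc_list.simps(1) filterT_def filter_empty_conv)

lemma pdec_bex:
  assumes "pdec (\<lambda>\<Omega> p. P \<Omega> (left p) (right p))" "ptime l"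
  shows "pdec (\<lambda>\<Omega> a. \<exists>x\<in>set (elems (l \<Omega> a)). P \<Omega> a x)"
proof -
  have "pdec (\<lambda>\<Omega> a. \<not> filterT (\<lambda>x. P \<Omega> a x) (l \<Omega> a) = Leaf)"
    by (intro pdec_not pdec_eq ptime_filterT ptime_Leaf assms)
  then show ?thesis by (simp add: filterT_eq_Leaf)
qed

lemma pdec_ball:
  assumes "pdec (\<lambda>\<Omega> p. P \<Omega> (left p) (right p))" "ptime l"
  shows "pdec (\<lambda>\<Omega> a. \<forall>x\<in>set (elems (l \<Omega> a)). P \<Omega> a x)"
proof -
  have "pdec (\<lambda>\<Omega> a. \<not> (\<exists>x\<in>set (elems (l \<Omega> a)). \<not> P \<Omega> a x))"
    by (intro pdec_not pdec_bex assms)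
  then show ?thesis by simp
qed

lemma ptime_nthT:
  assumes "ptime l" "ptime k"
  shows "ptime (\<lambda>\<Omega> a. nthT (l \<Omega> a) (k \<Omega> a))"
proof -
  obtain ql where ql: "\<And>\<Omega> a. size (l \<Omega> a) \<le> poly ql (size a)"
    by (rule ptime_on_call[OF assms(1)]) blast
  have "ptime (\<lambda>\<Omega> a. ((\<lambda>\<Omega>. right) \<Omega> ^^ length (elems (k \<Omega> a))) (l \<Omega> a))"
    by (rule ptime_on_iterate[OF ptime_right0])
      (auto intro!: assms le_trans[OF size_funpow_right ql])
  then show ?thesis unfolding nthT_def by (rule ptime_left)
qed

lemma elems_enc_nat: "elems (enc_nat n) = replicate n Leaf"
  by (induction n) auto

lemma length_elems_enc_nat [simp]: "length (elems (enc_nat n)) = n"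
  by (simp add: elems_enc_nat)

lemma right_enc_nat: "right (enc_nat n) = enc_nat (n - 1)"
  by (cases n) auto

lemma size_enc_nat [simp]: "size (enc_nat n) = n"
  by (induction n) auto

lemma mapT_Leaf: "mapT (\<lambda>_. Leaf) a = enc_nat (length (elems a))"
  by (induction a) (auto simp: mapT_def)

text \<open>The list is built from its end: the counter is lowered and then pushed. Mapping all
  entries to \<open>Leaf\<close> first turns an arbitrary tree into a unary number of the same
  length.\<close>

lemma ptime_uptT:
  assumes "ptime k"
  shows "ptime (\<lambda>\<Omega> a. uptT (k \<Omega> a))"
proof -
  obtain qk where qk: "\<And>\<Omega> a. size (k \<Omega> a) \<le> poly qk (size a)"
    by (rule ptime_on_call[OF assms]) blast
  define step where "step = (\<lambda>\<Omega> :: tree \<Rightarrow> bool. \<lambda>s. Node (right (left s)) (Node (right (left s)) (right s)))"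
  have step: "ptime step"
    unfolding step_def by (intro ptime_on_pair ptime_right ptime_left ptime_id)
  have iter: "(step \<Omega> ^^ i) (Node (enc_nat n) Leaf) =
     Node (enc_nat (n - i)) (enc_list (map enc_nat [n - i..<n]))"
    if "i \<le> n" for \<Omega> i n
    using that
  proof (induction i)
    case (Suc i)
    then have "[n - Suc i..<n] = (n - Suc i) # [n - i..<n]"
      by (metis Suc_diff_Suc Suc_le_eq diff_less upt_conv_Cons zero_less_Suc order_less_le_trans)
    with Suc show ?case by (simp add: step_def right_enc_nat)
  qed simp
  have sz: "size ((step \<Omega> ^^ i) (Node (mapT (\<lambda>_. Leaf) (k \<Omega> a)) Leaf)) \<le>
      poly ([:1:] + qk + qk * (qk + 1)) (size a)"
    if i: "i \<le> length (elems (k \<Omega> a))" for \<Omega> i a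
  proof -
    let ?n = "length (elems (k \<Omega> a))"
    have n: "?n \<le> poly qk (size a)" using length_elems qk le_trans by blast
    have "size (enc_list (map enc_nat [?n - i..<?n])) \<le> length [?n - i..<?n] * (?n + 1)"
      by (rule order_trans[OF size_enc_list_le[of _ ?n]]) auto
    also have "\<dots> \<le> poly qk (size a) * (poly qk (size a) + 1)"
      by (intro mult_le_mono add_mono n) (use n i in auto)
    finally show ?thesis
      using n unfolding mapT_Leaf iter[OF i] by simp
  qed
  have "ptime (\<lambda>\<Omega> a. (step \<Omega> ^^ length (elems (k \<Omega> a))) (Node (mapT (\<lambda>_. Leaf) (k \<Omega> a)) Leaf))"
    by (rule ptime_on_iterate[OF step])
      (auto intro!: ptime_on_pair ptime_mapT ptime_Leaf assms sz)
  from ptime_right[OF this] show ?thesis by (simp add: mapT_Leaf iter uptT_def)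
qed

text \<open>These rules follow the syntax of a term, so the running time of each later algorithm is
  settled by \<open>intro\<close> on its definition.\<close>

lemmas ptime_intros = ptime_id ptime_Leaf ptime_on_pair ptime_left ptime_right ptime_enc_bool
  ptime_if ptime_mapT ptime_filterT ptime_nthT ptime_uptT
  pdec_const pdec_eq pdec_not pdec_conj pdec_disj pdec_imp pdec_bex pdec_ball

lemma inj_enc_nat [simp]: "enc_nat m = enc_nat n \<longleftrightarrow> m = n"
  by (metis length_elems_enc_nat)

lemma nthT_enc: "i < length xs \<Longrightarrow> nthT (enc_list xs) (enc_nat i) = xs ! i"
  by (simp add: nthT_def left_funpow_right)

lemma enc_bool_eq_Leaf [simp]: "enc_bool b = Leaf \<longleftrightarrow> \<not> b"
  by (cases b) auto

lemma elems_uptT: "elems (uptT (enc_nat n)) = map enc_nat [0..<n]"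
  by (simp add: uptT_def)

section \<open>Programs on encoded instances\<close>

definition adjT :: "tree \<Rightarrow> tree \<Rightarrow> tree \<Rightarrow> bool" where
  "adjT a i j \<longleftrightarrow> nthT (nthT (left (right a)) i) j \<noteq> Leaf"

definition delT :: "tree \<Rightarrow> tree \<Rightarrow> tree \<Rightarrow> tree \<Rightarrow> bool" where
  "delT a z i j \<longleftrightarrow> nthT (nthT (nthT (left (right (right a))) z) i) j \<noteq> Leaf"

definition srcT :: "tree \<Rightarrow> tree" where "srcT a = left (right (right (right a)))"

definition tgtT :: "tree \<Rightarrow> tree" where "tgtT a = left (right (right (right (right a))))"

lemma pdec_adjT: "ptime f \<Longrightarrow> ptime g \<Longrightarrow> ptime h \<Longrightarrow> pdec (\<lambda>\<Omega> a. adjT (f \<Omega> a) (g \<Omega> a) (h \<Omega> a))"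
  unfolding adjT_def by (intro ptime_intros)

lemma pdec_delT: "ptime f \<Longrightarrow> ptime k \<Longrightarrow> ptime g \<Longrightarrow> ptime h \<Longrightarrow>
    pdec (\<lambda>\<Omega> a. delT (f \<Omega> a) (k \<Omega> a) (g \<Omega> a) (h \<Omega> a))"
  unfolding delT_def by (intro ptime_intros)

lemma ptime_srcT: "ptime f \<Longrightarrow> ptime (\<lambda>\<Omega> a. srcT (f \<Omega> a))"
  and ptime_tgtT: "ptime f \<Longrightarrow> ptime (\<lambda>\<Omega> a. tgtT (f \<Omega> a))"
  unfolding srcT_def tgtT_def by (intro ptime_intros; assumption)+

lemmas ptime_access = pdec_adjT pdec_delT ptime_srcT ptime_tgtT

lemma nthT_enc_edges:
  "i < n \<Longrightarrow> j < n \<Longrightarrow> nthT (nthT (enc_edges n F) (enc_nat i)) (enc_nat j) = enc_bool ({i, j} \<in> F)"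
  by (simp add: enc_edges_def nthT_enc)

lemma enc_instance_access [simp]:
  "left (enc_instance X) = enc_nat (num_verts X)"
  "srcT (enc_instance X) = enc_nat (src X)" "tgtT (enc_instance X) = enc_nat (tgt X)"
  by (simp_all add: enc_instance_def Let_def srcT_def tgtT_def)

lemma adjT_enc [simp]:
  "i < num_verts X \<Longrightarrow> j < num_verts X \<Longrightarrow>
    adjT (enc_instance X) (enc_nat i) (enc_nat j) \<longleftrightarrow> {i, j} \<in> edges X"
  by (simp add: enc_instance_def Let_def adjT_def nthT_enc_edges)

lemma delT_enc [simp]:
  "z < num_verts X \<Longrightarrow> i < num_verts X \<Longrightarrow> j < num_verts X \<Longrightarrow>
    delT (enc_instance X) (enc_nat z) (enc_nat i) (enc_nat j) \<longleftrightarrow> {i, j} \<in> dels X z"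
  by (simp add: enc_instance_def Let_def delT_def nthT_enc_edges nthT_enc)

text \<open>Kept vertices are renumbered in increasing order, since the vertex set must again be an
  initial segment. The new name of a kept vertex is the number of kept vertices below it; for
  \<open>src\<close> and \<open>tgt\<close> this is meaningful only if \<open>K\<close> keeps
  them.\<close>

definition induced :: "(nat \<Rightarrow> bool) \<Rightarrow> sd_instance \<Rightarrow> sd_instance" where
  "induced K X = (let L = filter K [0..<num_verts X];
       restr = (\<lambda>F. {{i, j} |i j. i < length L \<and> j < length L \<and> {L ! i, L ! j} \<in> F}) in
     \<lparr>num_verts = length L, edges = restr (edges X), dels = (\<lambda>v. restr (dels X (L ! v))),
      src = length (filter K [0..<src X]), tgt = length (filter K [0..<tgt X])\<rparr>)"

definition inducedT :: "(tree \<Rightarrow> bool) \<Rightarrow> tree \<Rightarrow> tree" where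
  "inducedT K a = (let L = filterT K (uptT (left a)) in
     enc_list [mapT (\<lambda>_. Leaf) L,
       mapT (\<lambda>i. mapT (\<lambda>j. enc_bool (adjT a i j)) L) L,
       mapT (\<lambda>z. mapT (\<lambda>i. mapT (\<lambda>j. enc_bool (delT a z i j)) L) L) L,
       mapT (\<lambda>_. Leaf) (filterT K (uptT (srcT a))),
       mapT (\<lambda>_. Leaf) (filterT K (uptT (tgtT a)))])"

lemma ptime_inducedT:
  assumes K: "pdec (\<lambda>\<Omega> p. K \<Omega> (left p) (right p))" and f: "ptime f"
  shows "ptime (\<lambda>\<Omega> a. inducedT (\<lambda>i. K \<Omega> a i) (f \<Omega> a))"
  unfolding inducedT_def Let_def enc_list.simps
  by (intro ptime_intros ptime_access pdec_comp2[OF K] ptime_comp[OF f])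

lemma map_nth_filter: "map (\<lambda>i. f (L ! i)) [0..<length L] = map f L"
  by (rule nth_equalityI) auto

lemma enc_edges_restr:
  assumes "\<And>i j. i < length L \<Longrightarrow> j < length L \<Longrightarrow> ({i, j} \<in> F \<longleftrightarrow> {L ! i, L ! j} \<in> F')"
  shows "enc_edges (length L) F =
    enc_list (map (\<lambda>i. enc_list (map (\<lambda>j. enc_bool ({i, j} \<in> F')) L)) L)"
proof -
  have "enc_edges (length L) F = enc_list (map (\<lambda>i. enc_list (map (\<lambda>j. enc_bool ({L ! i, L ! j} \<in> F'))
      [0..<length L])) [0..<length L])"
    unfolding enc_edges_def using assms
    by (intro arg_cong[where f = enc_list] map_cong refl arg_cong[where f = enc_bool]) auto
  also have "\<dots> = enc_list (map (\<lambda>i. enc_list (map (\<lambda>j. enc_bool ({i, j} \<in> F')) L)) L)"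
    using map_nth_filter[of "\<lambda>i. enc_list (map (\<lambda>j. enc_bool ({i, j} \<in> F')) L)" L]
    by (simp add: map_nth_filter[of "\<lambda>j. enc_bool ({_, j} \<in> F')"])
  finally show ?thesis .
qed

lemma restr_mem:
  "{i, j} \<in> {{i, j} |i j. i < n \<and> j < n \<and> {f i, f j} \<in> F} \<longleftrightarrow> i < n \<and> j < n \<and> {f i, f j} \<in> F"
  for i j n :: nat
proof
  assume "{i, j} \<in> {{i, j} |i j. i < n \<and> j < n \<and> {f i, f j} \<in> F}"
  then obtain i' j' where "{i, j} = {i', j'}" "i' < n" "j' < n" "{f i', f j'} \<in> F" by blast
  then show "i < n \<and> j < n \<and> {f i, f j} \<in> F"
    by (auto simp: doubleton_eq_iff insert_commute)
qed blast

lemma filterT_upt: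
  assumes "\<And>i. i < n \<Longrightarrow> KT (enc_nat i) = K i"
  shows "filterT KT (uptT (enc_nat n)) = enc_list (map enc_nat (filter K [0..<n]))"
proof -
  have "filter (\<lambda>x. KT (enc_nat x)) [0..<n] = filter K [0..<n]"
    using assms by (intro filter_cong) auto
  then show ?thesis by (simp add: filterT_def elems_uptT filter_map o_def)
qed

lemma inducedT_enc:
  assumes K: "\<And>i. i < num_verts X \<Longrightarrow> KT (enc_nat i) = K i"
    and "src X < num_verts X" "tgt X < num_verts X"
  shows "inducedT KT (enc_instance X) = enc_instance (induced K X)"
proof -
  define L where "L = filter K [0..<num_verts X]"
  let ?R = "\<lambda>F. {{i, j} |i j. i < length L \<and> j < length L \<and> {L ! i, L ! j} \<in> F}"
  have L: "i < num_verts X" if "i \<in> set L" for i using that by (auto simp: L_def)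
  have "filterT KT (uptT (enc_nat m)) = enc_list (map enc_nat (filter K [0..<m]))" if "m \<le> num_verts X" for m
    using K that by (intro filterT_upt) auto
  with assms(2,3) have filt:
    "filterT KT (uptT (enc_nat (num_verts X))) = enc_list (map enc_nat L)"
    "filterT KT (uptT (enc_nat (src X))) = enc_list (map enc_nat (filter K [0..<src X]))"
    "filterT KT (uptT (enc_nat (tgt X))) = enc_list (map enc_nat (filter K [0..<tgt X]))"
    by (simp_all add: L_def)
  have E: "enc_edges (length L) (?R F) =
    enc_list (map (\<lambda>i. enc_list (map (\<lambda>j. enc_bool ({i, j} \<in> F)) L)) L)" for F
    by (rule enc_edges_restr) (simp only: restr_mem simp_thms)
  have "map (\<lambda>v. enc_edges (length L) (?R (dels X (L ! v)))) [0..<length L] =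
    map (\<lambda>z. enc_list (map (\<lambda>i. enc_list (map (\<lambda>j. enc_bool ({i, j} \<in> dels X z)) L)) L)) L"
    unfolding E by (rule map_nth_filter)
  moreover have "mapT (\<lambda>i. mapT (\<lambda>j. enc_bool (adjT (enc_instance X) i j)) (enc_list (map enc_nat L)))
      (enc_list (map enc_nat L)) =
    enc_list (map (\<lambda>i. enc_list (map (\<lambda>j. enc_bool ({i, j} \<in> edges X)) L)) L)"
    using L by (auto simp: mapT_def intro!: arg_cong[where f = enc_list] arg_cong[where f = enc_bool])
  moreover have "mapT (\<lambda>z. mapT (\<lambda>i. mapT (\<lambda>j. enc_bool (delT (enc_instance X) z i j))
      (enc_list (map enc_nat L))) (enc_list (map enc_nat L))) (enc_list (map enc_nat L)) =
    enc_list (map (\<lambda>z. enc_list (map (\<lambda>i. enc_list (map (\<lambda>j. enc_bool ({i, j} \<in> dels X z)) L)) L)) L)"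
    using L by (auto simp: mapT_def intro!: arg_cong[where f = enc_list] arg_cong[where f = enc_bool])
  moreover have "enc_instance (induced K X) = enc_list [enc_nat (length L), enc_edges (length L) (?R (edges X)),
      enc_list (map (\<lambda>v. enc_edges (length L) (?R (dels X (L ! v)))) [0..<length L]),
      enc_nat (length (filter K [0..<src X])), enc_nat (length (filter K [0..<tgt X]))]"
    by (simp add: enc_instance_def induced_def Let_def L_def)
  ultimately show ?thesis
    unfolding inducedT_def filt enc_instance_access Let_def
    by (simp only: E mapT_Leaf elems_enc_list length_map)
qed

text \<open>
  On the path \<open>p u v q\<close> the vertex \<open>u\<close> stands for both \<open>u\<close> and \<open>v\<close>: it deletes \<open>{u, q}\<close> if the old
  path could not be traversed from \<open>p\<close> to \<open>q\<close>, and \<open>{p, u}\<close> if not from \<open>q\<close> to \<open>p\<close>.  The isolated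
  vertex \<open>v\<close> is dropped separately.
\<close>

definition contract :: "nat \<Rightarrow> nat \<Rightarrow> nat \<Rightarrow> nat \<Rightarrow> sd_instance \<Rightarrow> sd_instance" where
  "contract p u v q X = (let f = dels X; P = {{p, u}, {u, v}, {v, q}} in X\<lparr>
     edges := edges X - {{u, v}, {v, q}} \<union> {{u, q}},
     dels := (\<lambda>z. if z = v then {} else
       if z = u then (f u \<union> f v - P)
         \<union> (if {u, v} \<in> f u \<or> {v, q} \<in> f u \<or> {v, q} \<in> f v then {{u, q}} else {})
         \<union> (if {u, v} \<in> f v \<or> {p, u} \<in> f u \<or> {p, u} \<in> f v then {{p, u}} else {})
       else (f z - P) \<union> (if f z \<inter> P \<noteq> {} then {{p, u}, {u, q}} else {}))\<rparr>)"

definition contractT :: "tree \<Rightarrow> tree \<Rightarrow> tree \<Rightarrow> tree \<Rightarrow> tree \<Rightarrow> tree" where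
  "contractT p u v q a = (let V = uptT (left a);
     eq = (\<lambda>i j x y. i = x \<and> j = y \<or> i = y \<and> j = x);
     P = (\<lambda>i j. eq i j p u \<or> eq i j u v \<or> eq i j v q) in
     enc_list [left a,
       mapT (\<lambda>i. mapT (\<lambda>j. enc_bool (
         adjT a i j \<and> \<not> eq i j u v \<and> \<not> eq i j v q \<or> eq i j u q)) V) V,
       mapT (\<lambda>z. mapT (\<lambda>i. mapT (\<lambda>j. enc_bool (\<not> z = v \<and>
         ((z = u \<longrightarrow> (delT a u i j \<or> delT a v i j) \<and> \<not> P i j
            \<or> (delT a u u v \<or> delT a u v q \<or> delT a v v q) \<and> eq i j u q
            \<or> (delT a v u v \<or> delT a u p u \<or> delT a v p u) \<and> eq i j p u) \<and>
          (\<not> z = u \<longrightarrow> delT a z i j \<and> \<not> P i j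
            \<or> (delT a z p u \<or> delT a z u v \<or> delT a z v q) \<and> (eq i j p u \<or> eq i j u q))))) V) V) V,
       srcT a, tgtT a])"

lemma ptime_contractT:
  assumes "ptime p" "ptime u" "ptime v" "ptime q" "ptime f"
  shows "ptime (\<lambda>\<Omega> a. contractT (p \<Omega> a) (u \<Omega> a) (v \<Omega> a) (q \<Omega> a) (f \<Omega> a))"
  unfolding contractT_def Let_def enc_list.simps
  by (intro ptime_intros ptime_access assms[THEN ptime_comp])

lemma contractT_enc:
  assumes X: "X \<in> sd_instances" and n: "p < num_verts X" "u < num_verts X" "v < num_verts X" "q < num_verts X"
    and uv: "u \<noteq> v"
  shows "contractT (enc_nat p) (enc_nat u) (enc_nat v) (enc_nat q) (enc_instance X) =
    enc_instance (contract p u v q X)"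
proof -
  let ?n = "num_verts X" and ?Y = "contract p u v q X"
  define e where "e = (\<lambda>i j x y :: nat. {i, j} = {x, y})"
  have e: "{i, j} = {x, y} \<longleftrightarrow> e i j x y" for i j x y by (simp add: e_def)
  have eq: "enc_nat i = enc_nat x \<and> enc_nat j = enc_nat y \<or> enc_nat i = enc_nat y \<and> enc_nat j = enc_nat x
      \<longleftrightarrow> e i j x y" for i j x y :: nat
    by (auto simp: e_def doubleton_eq_iff)
  have if_mem: "x \<in> (if c then A else {}) \<longleftrightarrow> c \<and> x \<in> A" for x c and A :: "nat set set"
    by simp
  have int: "F \<inter> {{p, u}, {u, v}, {v, q}} \<noteq> {} \<longleftrightarrow> {p, u} \<in> F \<or> {u, v} \<in> F \<or> {v, q} \<in> F" for F
    by blast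
  have map2: "mapT (\<lambda>i. mapT (\<lambda>j. enc_bool (B i j)) (uptT (enc_nat ?n))) (uptT (enc_nat ?n)) = enc_edges ?n F"
    if "\<And>i j. i < ?n \<Longrightarrow> j < ?n \<Longrightarrow> B (enc_nat i) (enc_nat j) \<longleftrightarrow> {i, j} \<in> F" for B F
    using that by (auto simp: mapT_def elems_uptT enc_edges_def
        intro!: arg_cong[where f = enc_list] arg_cong[where f = enc_bool])
  have edges: "edges ?Y = edges X - {{u, v}, {v, q}} \<union> {{u, q}}"
    by (simp add: contract_def Let_def)
  have dels: "dels ?Y z = (if z = v then {} else
       if z = u then (dels X u \<union> dels X v - {{p, u}, {u, v}, {v, q}})
         \<union> (if {u, v} \<in> dels X u \<or> {v, q} \<in> dels X u \<or> {v, q} \<in> dels X v then {{u, q}} else {})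
         \<union> (if {u, v} \<in> dels X v \<or> {p, u} \<in> dels X u \<or> {p, u} \<in> dels X v then {{p, u}} else {})
       else (dels X z - {{p, u}, {u, v}, {v, q}}) \<union>
         (if dels X z \<inter> {{p, u}, {u, v}, {v, q}} \<noteq> {} then {{p, u}, {u, q}} else {}))" for z
    by (simp add: contract_def Let_def)
  have rest: "num_verts ?Y = ?n" "src ?Y = src X" "tgt ?Y = tgt X"
    by (simp_all add: contract_def Let_def)
  have map3: "mapT (\<lambda>z. mapT (\<lambda>i. mapT (\<lambda>j. enc_bool (B z i j)) (uptT (enc_nat ?n))) (uptT (enc_nat ?n)))
      (uptT (enc_nat ?n)) = enc_list (map (\<lambda>z. enc_edges ?n (F z)) [0..<?n])"
    if "\<And>z i j. z < ?n \<Longrightarrow> i < ?n \<Longrightarrow> j < ?n \<Longrightarrow> B (enc_nat z) (enc_nat i) (enc_nat j) \<longleftrightarrow> {i, j} \<in> F z" for B F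
    using that by (auto simp: mapT_def elems_uptT enc_edges_def
        intro!: arg_cong[where f = enc_list] arg_cong[where f = enc_bool])
  show ?thesis
    unfolding contractT_def Let_def enc_instance_access eq
    apply (subst map2[where F = "edges ?Y"])
    subgoal using n by (simp only: adjT_enc eq e edges Un_iff Diff_iff insert_iff empty_iff) blast
    apply (subst map3[where F = "dels ?Y"])
    subgoal for z i j
      unfolding eq using n
      by (cases "z = v"; cases "z = u"; simp only: delT_enc e dels Un_iff Diff_iff insert_iff empty_iff
          if_mem int inj_enc_nat simp_thms disj_assoc if_True if_False uv)
    by (simp add: enc_instance_def Let_def rest)
qed

section \<open>Reduction rules and the search for a place to apply them\<close>

lemma pdec_iff: "pdec P \<Longrightarrow> pdec Q \<Longrightarrow> pdec (\<lambda>\<Omega> a. P \<Omega> a \<longleftrightarrow> Q \<Omega> a)"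
  unfolding iff_conv_conj_imp by (intro pdec_conj pdec_imp)

text \<open>A failed search returns \<open>Leaf\<close>, which is also \<open>enc_nat 0\<close>; the
  result is therefore used only where a matching element is known to exist.\<close>

definition findT :: "(tree \<Rightarrow> bool) \<Rightarrow> tree \<Rightarrow> tree" where
  "findT P a = left (filterT P a)"

lemma ptime_findT:
  assumes "pdec (\<lambda>\<Omega> p. P \<Omega> (left p) (right p))" "ptime l"
  shows "ptime (\<lambda>\<Omega> a. findT (\<lambda>x. P \<Omega> a x) (l \<Omega> a))"
  unfolding findT_def by (intro ptime_left ptime_filterT assms)

lemma findT_props:
  assumes "\<exists>x\<in>set (elems a). P x"
  shows "findT P a \<in> set (elems a)" "P (findT P a)"
proof -
  have "filter P (elems a) \<noteq> []" using assms by (simp add: filter_empty_conv)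
  then have "findT P a \<in> set (filter P (elems a))"
    unfolding findT_def filterT_def using hd_in_set by (subst left_eq_hd) (auto simp del: set_filter)
  then show "findT P a \<in> set (elems a)" "P (findT P a)" by auto
qed

text \<open>The first alternative is a vertex of degree at most one. The second is a dead end: every
  way out of the pair \<open>u\<close>, \<open>v\<close> leads to the same vertex \<open>p\<close>,
  as in a triangle attached at \<open>p\<close>. This is the case in which contracting
  \<open>p u v q\<close> would have \<open>p = q\<close>.\<close>

definition removable :: "'a set \<Rightarrow> 'a set set \<Rightarrow> 'a \<Rightarrow> 'a \<Rightarrow> 'a \<Rightarrow> bool" where
  "removable V E s t u \<longleftrightarrow> u \<noteq> s \<and> u \<noteq> t \<and>
    ((\<exists>p\<in>V. \<forall>x\<in>V. {u, x} \<in> E \<longrightarrow> x = p) \<or>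
     (\<exists>v\<in>V. v \<noteq> s \<and> v \<noteq> t \<and> v \<noteq> u \<and>
       (\<exists>p\<in>V. \<forall>x\<in>V. ({u, x} \<in> E \<longrightarrow> x = v \<or> x = p) \<and> ({v, x} \<in> E \<longrightarrow> x = u \<or> x = p))))"

text \<open>\<open>p \<noteq> v\<close> and \<open>q \<noteq> u\<close> make both degrees exactly
  two, and \<open>p \<noteq> q\<close> ensures that \<open>{u, q}\<close> is not yet an
  edge.\<close>

definition mergeable :: "'a set \<Rightarrow> 'a set set \<Rightarrow> 'a \<Rightarrow> 'a \<Rightarrow> 'a \<Rightarrow> 'a \<Rightarrow> 'a \<Rightarrow> 'a \<Rightarrow> bool" where
  "mergeable V E s t u v p q \<longleftrightarrow> u \<noteq> s \<and> u \<noteq> t \<and> v \<noteq> s \<and> v \<noteq> t \<and> u \<noteq> v \<and> p \<noteq> q \<and> p \<noteq> v \<and> q \<noteq> u \<and>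
    (\<forall>x\<in>V. ({u, x} \<in> E \<longleftrightarrow> x = p \<or> x = v) \<and> ({v, x} \<in> E \<longleftrightarrow> x = u \<or> x = q))"

definition removableT :: "tree \<Rightarrow> tree \<Rightarrow> bool" where
  "removableT a u \<longleftrightarrow> (let V = set (elems (uptT (left a))) in \<not> u = srcT a \<and> \<not> u = tgtT a \<and>
    ((\<exists>p\<in>V. \<forall>x\<in>V. adjT a u x \<longrightarrow> x = p) \<or>
     (\<exists>v\<in>V. \<not> v = srcT a \<and> \<not> v = tgtT a \<and> \<not> v = u \<and>
       (\<exists>p\<in>V. \<forall>x\<in>V. (adjT a u x \<longrightarrow> x = v \<or> x = p) \<and> (adjT a v x \<longrightarrow> x = u \<or> x = p)))))"

definition mergeableT :: "tree \<Rightarrow> tree \<Rightarrow> tree \<Rightarrow> tree \<Rightarrow> tree \<Rightarrow> bool" where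
  "mergeableT a u v p q \<longleftrightarrow> (let V = set (elems (uptT (left a))) in
    \<not> u = srcT a \<and> \<not> u = tgtT a \<and> \<not> v = srcT a \<and> \<not> v = tgtT a \<and> \<not> u = v \<and> \<not> p = q \<and> \<not> p = v \<and> \<not> q = u \<and>
    (\<forall>x\<in>V. (adjT a u x \<longleftrightarrow> x = p \<or> x = v) \<and> (adjT a v x \<longleftrightarrow> x = u \<or> x = q)))"

lemma pdec_removableT: "ptime f \<Longrightarrow> ptime g \<Longrightarrow> pdec (\<lambda>\<Omega> a. removableT (f \<Omega> a) (g \<Omega> a))"
  by (rule pdec_comp2[of "\<lambda>\<Omega>. removableT"]) (unfold removableT_def Let_def, intro ptime_intros ptime_access)

lemma pdec_mergeableT:
  assumes "ptime f" "ptime u" "ptime v" "ptime p" "ptime q"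
  shows "pdec (\<lambda>\<Omega> a. mergeableT (f \<Omega> a) (u \<Omega> a) (v \<Omega> a) (p \<Omega> a) (q \<Omega> a))"
  unfolding mergeableT_def Let_def
  by (intro ptime_intros ptime_access pdec_iff assms[THEN ptime_comp])

lemma verts_T: "set (elems (uptT (left (enc_instance X)))) = enc_nat ` verts X"
  by (simp add: elems_uptT verts_def)

lemma removableT_enc:
  "X \<in> sd_instances \<Longrightarrow> u \<in> verts X \<Longrightarrow>
    removableT (enc_instance X) (enc_nat u) \<longleftrightarrow> removable (verts X) (edges X) (src X) (tgt X) u"
  unfolding removableT_def Let_def verts_T removable_def by (simp add: verts_def)

lemma mergeableT_enc:
  "X \<in> sd_instances \<Longrightarrow> u \<in> verts X \<Longrightarrow> v \<in> verts X \<Longrightarrow>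
    mergeableT (enc_instance X) (enc_nat u) (enc_nat v) (enc_nat p) (enc_nat q) \<longleftrightarrow>
    mergeable (verts X) (edges X) (src X) (tgt X) u v p q"
  unfolding mergeableT_def Let_def verts_T mergeable_def by (simp add: verts_def)

text \<open>The four vertices are found one at a time: each search asks whether the choices made so
  far extend to a full quadruple, so the next search cannot fail.\<close>

definition merge_uT :: "tree \<Rightarrow> tree" where
  "merge_uT a = (let V = uptT (left a) in findT (\<lambda>u. \<exists>v\<in>set (elems V). \<exists>p\<in>set (elems V). \<exists>q\<in>set (elems V).
     mergeableT a u v p q) V)"

definition merge_vT :: "tree \<Rightarrow> tree" where
  "merge_vT a = (let V = uptT (left a) in findT (\<lambda>v. \<exists>p\<in>set (elems V). \<exists>q\<in>set (elems V).
     mergeableT a (merge_uT a) v p q) V)"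

definition merge_pT :: "tree \<Rightarrow> tree" where
  "merge_pT a = (let V = uptT (left a) in findT (\<lambda>p. \<exists>q\<in>set (elems V).
     mergeableT a (merge_uT a) (merge_vT a) p q) V)"

definition merge_qT :: "tree \<Rightarrow> tree" where
  "merge_qT a = findT (\<lambda>q. mergeableT a (merge_uT a) (merge_vT a) (merge_pT a) q) (uptT (left a))"

definition stepT :: "tree \<Rightarrow> tree" where
  "stepT a = (let V = uptT (left a) in
     if \<exists>u\<in>set (elems V). removableT a u then
       inducedT (\<lambda>i. \<not> i = findT (\<lambda>u. removableT a u) V) a
     else if \<exists>u\<in>set (elems V). \<exists>v\<in>set (elems V). \<exists>p\<in>set (elems V). \<exists>q\<in>set (elems V).
       mergeableT a u v p q then
       inducedT (\<lambda>i. \<not> i = merge_vT a) (contractT (merge_pT a) (merge_uT a) (merge_vT a) (merge_qT a) a)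
     else a)"

lemmas ptime_find = ptime_findT pdec_removableT pdec_mergeableT

lemma ptime_merge_uT: "ptime (\<lambda>\<Omega> a. merge_uT a)"
  unfolding merge_uT_def Let_def by (intro ptime_intros ptime_find)

lemma ptime_merge_vT: "ptime (\<lambda>\<Omega> a. merge_vT a)"
  unfolding merge_vT_def Let_def by (intro ptime_intros ptime_find ptime_comp[OF ptime_merge_uT])

lemma ptime_merge_pT: "ptime (\<lambda>\<Omega> a. merge_pT a)"
  unfolding merge_pT_def Let_def
  by (intro ptime_intros ptime_find ptime_comp[OF ptime_merge_uT] ptime_comp[OF ptime_merge_vT])

lemma ptime_merge_qT: "ptime (\<lambda>\<Omega> a. merge_qT a)"
  unfolding merge_qT_def
  by (intro ptime_intros ptime_find ptime_comp[OF ptime_merge_uT] ptime_comp[OF ptime_merge_vT]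
      ptime_comp[OF ptime_merge_pT])

lemma ptime_stepT: "ptime (\<lambda>\<Omega> a. stepT a)"
  unfolding stepT_def Let_def
  by (intro ptime_intros ptime_inducedT ptime_contractT ptime_find ptime_comp[OF ptime_merge_uT]
      ptime_comp[OF ptime_merge_vT] ptime_comp[OF ptime_merge_pT] ptime_comp[OF ptime_merge_qT])

text \<open>A relational view of a step that changes the instance. It forgets which vertices the
  search picks, so correctness of the rules is independent of the search.\<close>

definition reduces :: "sd_instance \<Rightarrow> sd_instance \<Rightarrow> bool" where
  "reduces X Y \<longleftrightarrow>
    (\<exists>u\<in>verts X. removable (verts X) (edges X) (src X) (tgt X) u \<and> Y = induced (\<lambda>i. i \<noteq> u) X) \<or>
    (\<exists>u\<in>verts X. \<exists>v\<in>verts X. \<exists>p\<in>verts X. \<exists>q\<in>verts X.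
       mergeable (verts X) (edges X) (src X) (tgt X) u v p q \<and>
       Y = induced (\<lambda>i. i \<noteq> v) (contract p u v q X))"

definition fully_reduced :: "sd_instance \<Rightarrow> bool" where
  "fully_reduced X \<longleftrightarrow>
    (\<forall>u\<in>verts X. \<not> removable (verts X) (edges X) (src X) (tgt X) u) \<and>
    (\<forall>u\<in>verts X. \<forall>v\<in>verts X. \<forall>p\<in>verts X. \<forall>q\<in>verts X.
       \<not> mergeable (verts X) (edges X) (src X) (tgt X) u v p q)"

lemma stepT_enc:
  assumes X: "X \<in> sd_instances"
  shows "\<exists>Y. stepT (enc_instance X) = enc_instance Y \<and> (reduces X Y \<or> fully_reduced X \<and> Y = X)"
proof -
  let ?a = "enc_instance X"
  define V where "V = uptT (left ?a)"
  have V: "set (elems V) = enc_nat ` verts X" unfolding V_def by (rule verts_T)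
  have n: "src X < num_verts X" "tgt X < num_verts X" using X by (auto simp: sd_instances_def verts_def)
  have bex: "(\<exists>x\<in>set (elems V). Q x) \<longleftrightarrow> (\<exists>x\<in>verts X. Q (enc_nat x))" for Q
    by (simp add: V)
  have find: "\<exists>x\<in>verts X. findT Q V = enc_nat x \<and> Q (enc_nat x)" if "\<exists>x\<in>set (elems V). Q x" for Q
    using findT_props[of V Q] that by (auto simp: V)
  show ?thesis
  proof (cases "\<exists>u\<in>set (elems V). removableT ?a u")
    case True
    from find[OF this] obtain u where u: "u \<in> verts X" "findT (\<lambda>u. removableT ?a u) V = enc_nat u"
      "removableT ?a (enc_nat u)" by blast
    have "stepT ?a = inducedT (\<lambda>i. \<not> i = enc_nat u) ?a"
      using True u(2) unfolding stepT_def V_def Let_def by simp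
    also have "\<dots> = enc_instance (induced (\<lambda>i. i \<noteq> u) X)"
      by (rule inducedT_enc) (use n in auto)
    finally have "stepT ?a = enc_instance (induced (\<lambda>i. i \<noteq> u) X)" .
    moreover have "reduces X (induced (\<lambda>i. i \<noteq> u) X)"
      unfolding reduces_def
      by (intro disjI1 bexI[of _ u] conjI refl) (use u removableT_enc[OF X] in simp_all)
    ultimately show ?thesis by blast
  next
    case nr: False
    let ?c = "\<lambda>u v p q. mergeableT ?a u v p q"
    show ?thesis
    proof (cases "\<exists>u\<in>set (elems V). \<exists>v\<in>set (elems V). \<exists>p\<in>set (elems V). \<exists>q\<in>set (elems V). ?c u v p q")
      case True
      from find[OF this] obtain u where u: "u \<in> verts X"
        "findT (\<lambda>u. \<exists>v\<in>set (elems V). \<exists>p\<in>set (elems V). \<exists>q\<in>set (elems V). ?c u v p q) V = enc_nat u"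
        "\<exists>v\<in>set (elems V). \<exists>p\<in>set (elems V). \<exists>q\<in>set (elems V). ?c (enc_nat u) v p q" by blast
      from find[OF u(3)] obtain v where v: "v \<in> verts X"
        "findT (\<lambda>v. \<exists>p\<in>set (elems V). \<exists>q\<in>set (elems V). ?c (enc_nat u) v p q) V = enc_nat v"
        "\<exists>p\<in>set (elems V). \<exists>q\<in>set (elems V). ?c (enc_nat u) (enc_nat v) p q" by blast
      from find[OF v(3)] obtain p where p: "p \<in> verts X"
        "findT (\<lambda>p. \<exists>q\<in>set (elems V). ?c (enc_nat u) (enc_nat v) p q) V = enc_nat p"
        "\<exists>q\<in>set (elems V). ?c (enc_nat u) (enc_nat v) (enc_nat p) q" by blast
      from find[OF p(3)] obtain q where q: "q \<in> verts X"
        "findT (\<lambda>q. ?c (enc_nat u) (enc_nat v) (enc_nat p) q) V = enc_nat q"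
        "?c (enc_nat u) (enc_nat v) (enc_nat p) (enc_nat q)" by blast
      have "stepT ?a = inducedT (\<lambda>i. \<not> i = enc_nat v)
          (contractT (enc_nat p) (enc_nat u) (enc_nat v) (enc_nat q) ?a)"
        unfolding stepT_def merge_qT_def merge_pT_def merge_vT_def merge_uT_def Let_def V_def[symmetric]
          if_not_P[OF nr] if_P[OF True] u(2) v(2) p(2) q(2) ..
      also have "\<dots> = inducedT (\<lambda>i. \<not> i = enc_nat v) (enc_instance (contract p u v q X))"
        using contractT_enc[OF X] u(1) v(1) p(1) q(1,3) by (simp add: verts_def mergeableT_def Let_def)
      also have "\<dots> = enc_instance (induced (\<lambda>i. i \<noteq> v) (contract p u v q X))"
        by (rule inducedT_enc) (use n in \<open>auto simp: contract_def Let_def\<close>)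
      finally have "stepT ?a = enc_instance (induced (\<lambda>i. i \<noteq> v) (contract p u v q X))" .
      moreover have "reduces X (induced (\<lambda>i. i \<noteq> v) (contract p u v q X))"
        unfolding reduces_def
        by (intro disjI2 bexI[of _ u] bexI[of _ v] bexI[of _ p] bexI[of _ q] conjI refl u(1) v(1) p(1) q(1))
          (use q(3) mergeableT_enc[OF X u(1) v(1)] in simp)
      ultimately show ?thesis by blast
    next
      case False
      have "stepT ?a = ?a"
        unfolding stepT_def Let_def V_def[symmetric] if_not_P[OF nr] if_not_P[OF False] ..
      moreover have "fully_reduced X"
        using nr False unfolding bex fully_reduced_def
        by (simp add: removableT_enc[OF X] mergeableT_enc[OF X])
      ultimately show ?thesis by (intro exI[of _ X]) simp
    qed
  qed
qed

section \<open>Conforming paths and induced instances\<close>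

fun pedges :: "'a list \<Rightarrow> 'a set set" where
  "pedges (x # y # zs) = insert {x, y} (pedges (y # zs))"
| "pedges _ = {}"

lemma pedges_conv: "pedges vs = {{vs ! i, vs ! Suc i} |i. Suc i < length vs}"
proof (induction vs rule: pedges.induct)
  case (1 x y zs)
  have "{{(x # y # zs) ! i, (x # y # zs) ! Suc i} |i. Suc i < length (x # y # zs)} =
    insert {x, y} {{(y # zs) ! i, (y # zs) ! Suc i} |i. Suc i < length (y # zs)}" (is "?A = insert _ ?B")
  proof (intro equalityI subsetI)
    fix e assume "e \<in> ?A"
    then obtain i where "e = {(x # y # zs) ! i, (x # y # zs) ! Suc i}" "Suc i < length (x # y # zs)" by blast
    then show "e \<in> insert {x, y} ?B" by (cases i) auto
  next
    fix e assume "e \<in> insert {x, y} ?B"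
    then show "e \<in> ?A"
    proof
      assume "e = {x, y}" then show ?thesis by (intro CollectI exI[of _ 0]) simp
    next
      assume "e \<in> ?B"
      then obtain i where "e = {(y # zs) ! i, (y # zs) ! Suc i}" "Suc i < length (y # zs)" by blast
      then show ?thesis by (intro CollectI exI[of _ "Suc i"]) simp
    qed
  qed
  then show ?case using 1 by simp
qed auto

lemma graph_path_iff:
  "graph_path V E vs \<longleftrightarrow> vs \<noteq> [] \<and> distinct vs \<and> set vs \<subseteq> V \<and> pedges vs \<subseteq> E"
  unfolding graph_path_def pedges_conv by blast

lemma conforming_Nil: "conforming f []"
  by (simp add: conforming_def)

text \<open>An edge is tested against every vertex up to its first end, so the first vertex tests
  all edges of the path.\<close>

lemma conforming_Cons: "conforming f (x # xs) \<longleftrightarrow> f x \<inter> pedges (x # xs) = {} \<and> conforming f xs"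
proof
  assume c: "conforming f (x # xs)"
  have "f x \<inter> pedges (x # xs) = {}"
    using c unfolding conforming_def pedges_conv by fastforce
  moreover have "conforming f xs"
    unfolding conforming_def
  proof (intro allI impI)
    fix i j assume "Suc i < length xs" "j \<le> i"
    then show "{xs ! i, xs ! Suc i} \<notin> f (xs ! j)"
      using c[unfolded conforming_def, rule_format, of "Suc i" "Suc j"] by simp
  qed
  ultimately show "f x \<inter> pedges (x # xs) = {} \<and> conforming f xs" by blast
next
  assume r: "f x \<inter> pedges (x # xs) = {} \<and> conforming f xs"
  show "conforming f (x # xs)"
    unfolding conforming_def
  proof (intro allI impI)
    fix i j assume ij: "Suc i < length (x # xs)" "j \<le> i"
    show "{(x # xs) ! i, (x # xs) ! Suc i} \<notin> f ((x # xs) ! j)"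
    proof (cases j)
      case 0
      then show ?thesis using r ij unfolding pedges_conv by fastforce
    next
      case (Suc k)
      then obtain i' where "i = Suc i'" using ij by (cases i) auto
      then show ?thesis using r ij Suc unfolding conforming_def by auto
    qed
  qed
qed

lemma pedges_append: "pedges (xs @ y # ys) = pedges (xs @ [y]) \<union> pedges (y # ys)"
proof (induction xs)
  case (Cons x xs)
  then show ?case by (cases xs) auto
qed simp

lemma pedges_append2: "pedges (xs @ x # y # ys) = insert {x, y} (pedges (xs @ [x]) \<union> pedges (y # ys))"
  by (subst pedges_append) simp

lemma pedges_subset: "e \<in> pedges vs \<Longrightarrow> e \<subseteq> set vs"
  by (induction vs rule: pedges.induct) auto

text \<open>Deletions act forward only: vertices of the first part constrain edges of the second but
  not conversely, hence the single cross condition.\<close>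

lemma conforming_append:
  "conforming f (xs @ y # ys) \<longleftrightarrow>
    conforming f (xs @ [y]) \<and> (\<forall>x\<in>set xs. f x \<inter> pedges (y # ys) = {}) \<and> conforming f (y # ys)"
proof (induction xs)
  case Nil
  then show ?case by (simp add: conforming_Cons conforming_Nil)
next
  case (Cons x xs)
  show ?case
    using Cons pedges_append[of "x # xs" y ys] by (auto simp: conforming_Cons)
qed

lemma conforming_cong:
  "(\<And>z e. z \<in> set vs \<Longrightarrow> e \<in> pedges vs \<Longrightarrow> e \<in> f z \<longleftrightarrow> e \<in> g z) \<Longrightarrow> conforming f vs \<longleftrightarrow> conforming g vs"
proof (induction vs)
  case (Cons x vs)
  have "pedges vs \<subseteq> pedges (x # vs)" by (cases vs) auto
  then have "conforming f vs \<longleftrightarrow> conforming g vs" using Cons by auto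
  moreover have "f x \<inter> pedges (x # vs) = g x \<inter> pedges (x # vs)" using Cons.prems[of x] by auto
  ultimately show ?case by (simp add: conforming_Cons)
qed (simp add: conforming_Nil)

lemma path_interior:
  assumes "x \<in> set vs" "x \<noteq> hd vs" "x \<noteq> last vs"
  obtains as a b bs where "vs = as @ a # x # b # bs"
proof -
  obtain xs ys where vs: "vs = xs @ x # ys" using assms(1) by (meson split_list)
  have "xs \<noteq> []" "ys \<noteq> []" using vs assms by (auto simp: hd_append)
  then show thesis using that vs by (metis append_Cons append_Nil append_assoc append_butlast_last_id neq_Nil_conv)
qed

lemma path_interior_nbrs:
  assumes "graph_path V E vs" "x \<in> set vs" "x \<noteq> hd vs" "x \<noteq> last vs"
  obtains as a b bs where "vs = as @ a # x # b # bs" "{x, a} \<in> E" "{x, b} \<in> E" "a \<noteq> b" "a \<in> V" "b \<in> V"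
    "a \<noteq> x" "b \<noteq> x"
proof -
  obtain as a b bs where vs: "vs = as @ a # x # b # bs" using path_interior assms(2-) by metis
  then have "{a, x} \<in> pedges vs" "{x, b} \<in> pedges vs" by (simp_all add: pedges_append2)
  then show thesis using that[OF vs] assms(1) vs by (auto simp: graph_path_iff insert_commute)
qed

definition st_path :: "sd_instance \<Rightarrow> nat list \<Rightarrow> bool" where
  "st_path X vs \<longleftrightarrow> graph_path (verts X) (edges X) vs \<and> conforming (dels X) vs \<and>
     hd vs = src X \<and> last vs = tgt X"

lemma self_deleting_st_path_iff: "self_deleting_st_path X \<longleftrightarrow> (\<exists>vs. st_path X vs)"
  by (simp add: self_deleting_st_path_def st_path_def)

text \<open>An inner vertex of a path has two distinct neighbours on it, which rules out degree at
  most one. In the dead-end case these neighbours are \<open>v\<close> and \<open>p\<close>; as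
  \<open>v\<close> is no terminal, the path continues beyond \<open>v\<close>, but the neighbours
  \<open>u\<close> and \<open>p\<close> of \<open>v\<close> have both been visited.\<close>

lemma removable_not_on_path:
  assumes vs: "graph_path V E vs" "hd vs = s" "last vs = t" and r: "removable V E s t u"
  shows "u \<notin> set vs"
proof
  assume "u \<in> set vs"
  then obtain as a b bs where d: "vs = as @ a # u # b # bs" "{u, a} \<in> E" "{u, b} \<in> E" "a \<noteq> b"
    "a \<in> V" "b \<in> V"
    using path_interior_nbrs[OF vs(1)] vs r unfolding removable_def by metis
  then obtain v p where vp: "v \<noteq> s" "v \<noteq> t" "v \<noteq> u"
     "\<forall>x\<in>V. ({u, x} \<in> E \<longrightarrow> x = v \<or> x = p) \<and> ({v, x} \<in> E \<longrightarrow> x = u \<or> x = p)"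
    using r unfolding removable_def by blast
  have dist: "distinct vs" and sub: "set vs \<subseteq> V" "pedges vs \<subseteq> E" using vs by (auto simp: graph_path_iff)
  from d vp consider "a = p" "b = v" | "a = v" "b = p" by blast
  then show False
  proof cases
    case 1
    with d vs(3) vp(2) obtain c cs where c: "bs = c # cs" by (cases bs) auto
    then have "{v, c} \<in> E" "c \<in> V" using sub d 1 by (auto simp: pedges_append2)
    then show False using vp(4) dist d c 1 by auto
  next
    case 2
    with d vs(2) vp(1) obtain c cs where c: "as = cs @ [c]" by (cases as rule: rev_cases) auto
    then have "vs = cs @ c # v # u # b # bs" using d 2 by simp
    then have "{v, c} \<in> E" "c \<in> V" using sub by (auto simp: pedges_append2 insert_commute)
    then show False using vp(4) dist d c 2 by auto
  qed
qed

lemma induced_sel [simp]: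
  "num_verts (induced K X) = length (filter K [0..<num_verts X])"
  "src (induced K X) = length (filter K [0..<src X])" "tgt (induced K X) = length (filter K [0..<tgt X])"
  by (simp_all add: induced_def Let_def)

text \<open>Sends new names to old ones; for kept vertices \<open>emb_index\<close> gives the
  inverse.\<close>

definition emb :: "(nat \<Rightarrow> bool) \<Rightarrow> sd_instance \<Rightarrow> nat \<Rightarrow> nat" where
  "emb K X i = filter K [0..<num_verts X] ! i"

lemma edges_induced: "edges (induced K X) = {{i, j} |i j. i < num_verts (induced K X) \<and>
     j < num_verts (induced K X) \<and> {emb K X i, emb K X j} \<in> edges X}"
  and dels_induced: "dels (induced K X) v = {{i, j} |i j. i < num_verts (induced K X) \<and>
     j < num_verts (induced K X) \<and> {emb K X i, emb K X j} \<in> dels X (emb K X v)}"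
  by (simp_all add: induced_def Let_def emb_def)

lemma emb_inj: "inj_on (emb K X) (verts (induced K X))"
  by (auto simp: inj_on_def verts_def emb_def nth_eq_iff_index_eq)

lemma emb_image: "emb K X ` verts (induced K X) = {v \<in> verts X. K v}"
proof -
  have "emb K X ` verts (induced K X) = set (filter K [0..<num_verts X])"
    unfolding set_conv_nth by (auto simp: verts_def emb_def)
  then show ?thesis by (auto simp: verts_def)
qed

lemma card_verts_induced: "card (verts (induced K X)) = card {v \<in> verts X. K v}"
  by (metis card_image emb_inj emb_image)

lemma emb_index:
  assumes "K v" "v < num_verts X"
  shows "emb K X (length (filter K [0..<v])) = v" "length (filter K [0..<v]) < num_verts (induced K X)"
proof -
  have "[0..<num_verts X] = [0..<v] @ v # [Suc v..<num_verts X]"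
    using assms(2) upt_add_eq_append[of 0 v "num_verts X - v"] by (simp add: upt_conv_Cons)
  then have "filter K [0..<num_verts X] = filter K [0..<v] @ v # filter K [Suc v..<num_verts X]"
    using assms(1) by simp
  then show "emb K X (length (filter K [0..<v])) = v" "length (filter K [0..<v]) < num_verts (induced K X)"
    by (simp_all add: emb_def)
qed

lemma sd_instancesD:
  assumes "X \<in> sd_instances"
  shows "finite (verts X)" "e \<in> edges X \<Longrightarrow> e \<subseteq> verts X" "e \<in> edges X \<Longrightarrow> card e = 2"
    "v \<in> verts X \<Longrightarrow> dels X v \<subseteq> edges X" "src X \<in> verts X" "tgt X \<in> verts X" "finite (edges X)"
proof -
  show *: "finite (verts X)" "e \<in> edges X \<Longrightarrow> e \<subseteq> verts X" "e \<in> edges X \<Longrightarrow> card e = 2"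
    "v \<in> verts X \<Longrightarrow> dels X v \<subseteq> edges X" "src X \<in> verts X" "tgt X \<in> verts X" for v e
    using assms by (auto simp: sd_instances_def self_deleting_graph_def simple_graph_def)
  then show "finite (edges X)" by (meson PowI finite_Pow_iff finite_subset subsetI)
qed

lemma card_2_subset_iff:
  assumes "\<And>e. e \<in> F \<Longrightarrow> card e = 2" "inj_on g {..<n}"
  shows "{{i, j} |i j. i < n \<and> j < n \<and> {g i, g j} \<in> F} = {e. e \<subseteq> {..<n} \<and> g ` e \<in> F}"
proof (intro equalityI subsetI)
  fix e assume "e \<in> {e. e \<subseteq> {..<n} \<and> g ` e \<in> F}"
  then have e: "e \<subseteq> {..<n}" "g ` e \<in> F" by auto
  then have "card e = 2" using assms card_image inj_on_subset by metis
  then obtain i j where "e = {i, j}" by (auto simp: card_2_iff)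
  with e show "e \<in> {{i, j} |i j. i < n \<and> j < n \<and> {g i, g j} \<in> F}" by auto
qed auto

lemma edges_induced_iff:
  assumes "X \<in> sd_instances"
  shows "edges (induced K X) = {e. e \<subseteq> verts (induced K X) \<and> emb K X ` e \<in> edges X}"
  unfolding edges_induced
  using card_2_subset_iff[of "edges X" "emb K X" "num_verts (induced K X)"] emb_inj[of K X]
    sd_instancesD(3)[OF assms] by (simp add: verts_def atLeast0LessThan)

lemma induced_in_sd_instances:
  assumes X: "X \<in> sd_instances" and K: "K (src X)" "K (tgt X)"
  shows "induced K X \<in> sd_instances"
proof -
  let ?Y = "induced K X"
  have n: "src X < num_verts X" "tgt X < num_verts X" using sd_instancesD[OF X] by (auto simp: verts_def)
  have "card e = 2 \<and> e \<subseteq> verts ?Y" if "e \<in> edges ?Y" for e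
  proof -
    have "e \<subseteq> verts ?Y" "emb K X ` e \<in> edges X" using that by (auto simp: edges_induced_iff[OF X])
    then show ?thesis using sd_instancesD(3)[OF X] card_image inj_on_subset[OF emb_inj] by metis
  qed
  moreover have "dels ?Y v \<subseteq> edges ?Y" if "v \<in> verts ?Y" for v
  proof -
    have "emb K X v \<in> verts X" using emb_image[of K X] that by blast
    then show ?thesis using sd_instancesD(4)[OF X] unfolding dels_induced edges_induced by blast
  qed
  moreover have "src ?Y \<in> verts ?Y" "tgt ?Y \<in> verts ?Y"
    using emb_index(2)[of K _ X] K n by (auto simp: verts_def)
  ultimately show ?thesis
    by (auto simp: sd_instances_def self_deleting_graph_def simple_graph_def) (auto simp: verts_def)
qed

lemma pedges_map: "pedges (map g vs) = (`) g ` pedges vs"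
  by (induction vs rule: pedges.induct) auto

lemma pedges_restr:
  fixes vs :: "nat list"
  assumes "set vs \<subseteq> {..<n}" "e \<in> pedges vs"
  shows "e \<in> {{i, j} |i j. i < n \<and> j < n \<and> {g i, g j} \<in> F} \<longleftrightarrow> g ` e \<in> F"
proof -
  obtain i where i: "e = {vs ! i, vs ! Suc i}" "Suc i < length vs"
    using assms(2) by (auto simp: pedges_conv)
  then have "vs ! i < n" "vs ! Suc i < n" using assms(1) by (auto simp: subset_iff)
  then show ?thesis unfolding i(1) using restr_mem[of "vs ! i" "vs ! Suc i" n g F] by (simp only: image_insert image_empty simp_thms)
qed

lemma st_path_induced:
  assumes X: "X \<in> sd_instances" and K: "K (src X)" "K (tgt X)" and vs: "set vs \<subseteq> verts (induced K X)"
  shows "st_path (induced K X) vs \<longleftrightarrow> st_path X (map (emb K X) vs)"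
proof (cases "vs = []")
  case False
  let ?Y = "induced K X" and ?g = "emb K X"
  have n: "src X < num_verts X" "tgt X < num_verts X" using sd_instancesD[OF X] by (auto simp: verts_def)
  have vs': "set vs \<subseteq> {..<num_verts ?Y}" using vs by (auto simp: verts_def)
  have "pedges vs \<subseteq> edges ?Y \<longleftrightarrow> (\<forall>e\<in>pedges vs. e \<in> edges ?Y)" by blast
  also have "\<dots> \<longleftrightarrow> (\<forall>e\<in>pedges vs. ?g ` e \<in> edges X)"
    unfolding edges_induced by (intro ball_cong refl pedges_restr[OF vs'])
  also have "\<dots> \<longleftrightarrow> pedges (map ?g vs) \<subseteq> edges X"
    by (simp add: pedges_map image_subset_iff)
  finally have "pedges vs \<subseteq> edges ?Y \<longleftrightarrow> pedges (map ?g vs) \<subseteq> edges X" .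
  moreover have "conforming (dels ?Y) vs \<longleftrightarrow> conforming (dels X) (map ?g vs)"
    using vs'
  proof (induction vs)
    case (Cons x vs)
    have "dels ?Y x \<inter> pedges (x # vs) = {} \<longleftrightarrow> (\<forall>e\<in>pedges (x # vs). \<not> e \<in> dels ?Y x)" by blast
    also have "\<dots> \<longleftrightarrow> (\<forall>e\<in>pedges (x # vs). \<not> ?g ` e \<in> dels X (?g x))"
      unfolding dels_induced by (intro ball_cong refl arg_cong[where f = Not] pedges_restr[OF Cons.prems])
    also have "\<dots> \<longleftrightarrow> dels X (?g x) \<inter> pedges (map ?g (x # vs)) = {}"
      unfolding pedges_map by blast
    finally have "dels ?Y x \<inter> pedges (x # vs) = {} \<longleftrightarrow> dels X (?g x) \<inter> pedges (map ?g (x # vs)) = {}" .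
    then show ?case using Cons by (simp add: conforming_Cons)
  qed (simp add: conforming_Nil)
  moreover have "distinct vs \<longleftrightarrow> distinct (map ?g vs)"
    using inj_on_subset[OF emb_inj vs] by (simp add: distinct_map)
  moreover have "set (map ?g vs) \<subseteq> verts X" using emb_image[of K X] vs by auto
  moreover have "x = length (filter K [0..<v]) \<longleftrightarrow> ?g x = v"
    if "x \<in> verts ?Y" "K v" "v < num_verts X" for x v
    using emb_index[of K v X, OF that(2,3)] inj_onD[OF emb_inj, of K X x "length (filter K [0..<v])"] that(1)
    by (auto simp: verts_def)
  then have "hd vs = src ?Y \<longleftrightarrow> ?g (hd vs) = src X" "last vs = tgt ?Y \<longleftrightarrow> ?g (last vs) = tgt X"
    using K n vs False by (auto simp: subset_iff)
  ultimately show ?thesis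
    using False vs by (auto simp: st_path_def graph_path_iff hd_map last_map)
qed (simp add: st_path_def graph_path_iff)

text \<open>Whether a path conforms depends only on its own vertices and edges, so passing to an
  induced instance just restricts the choice of paths. Every deletion rule is thereby reduced to the
  question whether some solution avoids the deleted vertices.\<close>

lemma yes_induced:
  assumes X: "X \<in> sd_instances" and K: "K (src X)" "K (tgt X)"
  shows "self_deleting_st_path (induced K X) \<longleftrightarrow> (\<exists>vs. st_path X vs \<and> (\<forall>v\<in>set vs. K v))"
  unfolding self_deleting_st_path_iff
proof
  have sub: "set vs \<subseteq> verts Z" if "st_path Z vs" for Z vs
    using that by (simp add: st_path_def graph_path_iff)
  {
    assume "\<exists>vs. st_path (induced K X) vs"
    then obtain ws where ws: "st_path (induced K X) ws" by blast
    then have "st_path X (map (emb K X) ws)" using st_path_induced[of X K, OF assms sub[OF ws]] by simp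
    moreover have "\<forall>v\<in>set (map (emb K X) ws). K v" using sub[OF ws] emb_image[of K X] by auto
    ultimately show "\<exists>vs. st_path X vs \<and> (\<forall>v\<in>set vs. K v)" by (intro exI conjI)
  next
    let ?h = "inv_into (verts (induced K X)) (emb K X)"
    assume "\<exists>vs. st_path X vs \<and> (\<forall>v\<in>set vs. K v)"
    then obtain vs where vs: "st_path X vs" "\<forall>v\<in>set vs. K v" by blast
    then have *: "set vs \<subseteq> emb K X ` verts (induced K X)"
      unfolding emb_image using sub[OF vs(1)] by blast
    then have "map (emb K X) (map ?h vs) = vs"
      by (auto intro!: map_idI simp: f_inv_into_f subset_iff)
    moreover have "set (map ?h vs) \<subseteq> verts (induced K X)"
      using * inv_into_into[of _ "emb K X" "verts (induced K X)"] by auto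
    ultimately have "st_path (induced K X) (map ?h vs)"
      using st_path_induced[of X K "map ?h vs", OF assms] vs(1) by simp
    then show "\<exists>vs. st_path (induced K X) vs" by (rule exI)
  }
qed

section \<open>Contracting degree-two vertices\<close>

text \<open>With \<open>x\<close>, \<open>y\<close> as \<open>u\<close>, \<open>v\<close> or as
  \<open>v\<close>, \<open>u\<close>, this covers both directions of travel. A vertex elsewhere on
  the path has all of \<open>a x y b\<close> ahead of it or all of it behind, so \<open>h2\<close>
  speaks only of the segment as a whole. By \<open>h4\<close> only the edge by which the path leaves
  \<open>u\<close> is tested against \<open>u\<close>; the edge by which it enters is free to encode
  the other direction.\<close>

lemma conforming_contract:
  assumes av: "u \<notin> set (as @ a # b # bs)" "v \<notin> set (as @ a # b # bs)"
    and h1: "\<And>z e. z \<in> set (as @ a # b # bs) \<Longrightarrow> u \<notin> e \<Longrightarrow> v \<notin> e \<Longrightarrow> e \<in> f' z \<longleftrightarrow> e \<in> f z"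
    and h2: "\<And>z. z \<in> set (as @ a # b # bs) \<Longrightarrow> {a, u} \<in> f' z \<or> {u, b} \<in> f' z \<longleftrightarrow>
        {a, x} \<in> f z \<or> {x, y} \<in> f z \<or> {y, b} \<in> f z"
    and h3: "\<And>e. u \<notin> e \<Longrightarrow> v \<notin> e \<Longrightarrow> e \<in> f' u \<longleftrightarrow> e \<in> f x \<or> e \<in> f y"
    and h4: "{u, b} \<in> f' u \<longleftrightarrow> {x, y} \<in> f x \<or> {y, b} \<in> f x \<or> {y, b} \<in> f y"
  shows "conforming f (as @ a # x # y # b # bs) \<longleftrightarrow> conforming f' (as @ a # u # b # bs)"
proof -
  have av1: "u \<notin> e" "v \<notin> e" if "e \<in> pedges (as @ [a]) \<or> e \<in> pedges (b # bs)" for e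
    using that av by (auto dest!: pedges_subset)
  have c1: "conforming f (as @ [a]) \<longleftrightarrow> conforming f' (as @ [a])"
    by (rule conforming_cong, rule h1[symmetric]) (use av1 in auto)
  have c2: "conforming f (b # bs) \<longleftrightarrow> conforming f' (b # bs)"
    by (rule conforming_cong, rule h1[symmetric]) (use av1 in auto)
  have d: "f' z \<inter> pedges (b # bs) = {} \<longleftrightarrow> f z \<inter> pedges (b # bs) = {}" if "z \<in> set (as @ a # b # bs)" for z
    using h1[OF that] av1 by blast
  have d': "f' u \<inter> pedges (b # bs) = {} \<longleftrightarrow> f x \<inter> pedges (b # bs) = {} \<and> f y \<inter> pedges (b # bs) = {}"
    using h3 av1 by blast
  have e: "f z \<inter> pedges (a # x # y # b # bs) = {} \<longleftrightarrow> f' z \<inter> pedges (a # u # b # bs) = {}"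
    if "z \<in> set (as @ a # b # bs)" for z
    using h2[OF that] d[OF that] by auto
  have "(\<forall>z\<in>set as. f z \<inter> pedges (a # x # y # b # bs) = {}) \<longleftrightarrow>
      (\<forall>z\<in>set as. f' z \<inter> pedges (a # u # b # bs) = {})"
    using e by simp
  moreover have "conforming f (a # x # y # b # bs) \<longleftrightarrow> conforming f' (a # u # b # bs)"
  proof -
    have "conforming f (a # x # y # b # bs) \<longleftrightarrow> f a \<inter> pedges (a # x # y # b # bs) = {} \<and>
        (f x \<inter> pedges (x # y # b # bs) = {} \<and> f y \<inter> pedges (y # b # bs) = {}) \<and> conforming f (b # bs)"
      by (simp only: conforming_Cons conj_assoc)
    moreover have "conforming f' (a # u # b # bs) \<longleftrightarrow> f' a \<inter> pedges (a # u # b # bs) = {} \<and>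
        f' u \<inter> pedges (u # b # bs) = {} \<and> conforming f' (b # bs)"
      by (simp only: conforming_Cons conj_assoc)
    moreover have "f' u \<inter> pedges (u # b # bs) = {} \<longleftrightarrow>
        f x \<inter> pedges (x # y # b # bs) = {} \<and> f y \<inter> pedges (y # b # bs) = {}"
      using d' h4 by auto
    moreover have "f a \<inter> pedges (a # x # y # b # bs) = {} \<longleftrightarrow> f' a \<inter> pedges (a # u # b # bs) = {}"
      using e[of a] by simp
    ultimately show ?thesis using c2 by (simp only:)
  qed
  ultimately show ?thesis
    using c1 conforming_append[of f as a "x # y # b # bs"] conforming_append[of f' as a "u # b # bs"]
    by (simp only:)
qed

lemma dels_contract: "dels (contract p u v q X) z = (if z = v then {} else
   if z = u then (dels X u \<union> dels X v - {{p, u}, {u, v}, {v, q}})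
     \<union> (if {u, v} \<in> dels X u \<or> {v, q} \<in> dels X u \<or> {v, q} \<in> dels X v then {{u, q}} else {})
     \<union> (if {u, v} \<in> dels X v \<or> {p, u} \<in> dels X u \<or> {p, u} \<in> dels X v then {{p, u}} else {})
   else (dels X z - {{p, u}, {u, v}, {v, q}}) \<union>
     (if dels X z \<inter> {{p, u}, {u, v}, {v, q}} \<noteq> {} then {{p, u}, {u, q}} else {}))"
  by (simp add: contract_def Let_def)

lemma mem_if: "x \<in> (if c then A else {}) \<longleftrightarrow> c \<and> x \<in> A"
  by simp

locale merge =
  fixes X :: sd_instance and u v p q :: nat
  assumes X: "X \<in> sd_instances"
    and inV: "u \<in> verts X" "v \<in> verts X" "p \<in> verts X" "q \<in> verts X"
    and m: "mergeable (verts X) (edges X) (src X) (tgt X) u v p q"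
begin

abbreviation "Y \<equiv> contract p u v q X"

lemma verts_Y: "verts Y = verts X" and src_Y: "src Y = src X" and tgt_Y: "tgt Y = tgt X"
  and edges_Y: "edges Y = edges X - {{u, v}, {v, q}} \<union> {{u, q}}"
  by (simp_all add: contract_def Let_def verts_def)

lemma N: "{u, x} \<in> edges X \<longleftrightarrow> x = p \<or> x = v" "{v, x} \<in> edges X \<longleftrightarrow> x = u \<or> x = q"
proof -
  have "x \<in> verts X" if "{u, x} \<in> edges X \<or> {v, x} \<in> edges X"
    using that sd_instancesD(2)[OF X] by auto
  then show "{u, x} \<in> edges X \<longleftrightarrow> x = p \<or> x = v" "{v, x} \<in> edges X \<longleftrightarrow> x = u \<or> x = q"
    using m inV unfolding mergeable_def by blast+
qed

lemma ne: "u \<noteq> v" "p \<noteq> q" "p \<noteq> v" "q \<noteq> u" "p \<noteq> u" "q \<noteq> v" "u \<noteq> src X" "u \<noteq> tgt X" "v \<noteq> src X" "v \<noteq> tgt X"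
proof -
  show *: "u \<noteq> v" "p \<noteq> q" "p \<noteq> v" "q \<noteq> u" "u \<noteq> src X" "u \<noteq> tgt X" "v \<noteq> src X" "v \<noteq> tgt X"
    using m unfolding mergeable_def by auto
  show "p \<noteq> u" "q \<noteq> v" using N(1)[of u] N(2)[of v] sd_instancesD(3)[OF X, of "{u, u}"]
      sd_instancesD(3)[OF X, of "{v, v}"] by auto
qed

lemma NY: "{u, x} \<in> edges Y \<longleftrightarrow> x = p \<or> x = q" "{v, x} \<notin> edges Y"
  "u \<notin> e \<Longrightarrow> v \<notin> e \<Longrightarrow> e \<in> edges Y \<longleftrightarrow> e \<in> edges X"
  using ne N by (auto simp: edges_Y doubleton_eq_iff)

lemma contract_in_sd_instances: "Y \<in> sd_instances"
proof -
  have "card e = 2 \<and> e \<subseteq> verts X" if "e \<in> edges Y" for e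
    using that sd_instancesD(2,3)[OF X] ne inV by (auto simp: edges_Y)
  moreover have "dels Y z \<subseteq> edges Y" if "z \<in> verts X" for z
  proof
    fix e assume "e \<in> dels Y z"
    then have "e = {u, q} \<or> e = {p, u} \<or> (\<exists>w\<in>verts X. e \<in> dels X w \<and> e \<noteq> {u, v} \<and> e \<noteq> {v, q})"
    proof (cases "z = v")
      case z: False
      assume e: "e \<in> dels Y z"
      show ?thesis
      proof (cases "z = u")
        case True
        have "e \<in> dels X u \<union> dels X v - {{p, u}, {u, v}, {v, q}} \<or> e = {u, q} \<or> e = {p, u}"
          using e True z unfolding dels_contract by (simp only: simp_thms if_True if_False Un_iff mem_if singleton_iff) blast
        then show ?thesis using inV by blast
      next
        case False
        have "e \<in> dels X z - {{p, u}, {u, v}, {v, q}} \<or> e = {u, q} \<or> e = {p, u}"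
          using e False z unfolding dels_contract
          by (simp only: simp_thms if_True if_False Un_iff mem_if insert_iff empty_iff) blast
        then show ?thesis using that by blast
      qed
    qed (simp add: dels_contract)
    then consider "e = {u, q}" | "e = {p, u}" | w where "w \<in> verts X" "e \<in> dels X w" "e \<noteq> {u, v}" "e \<noteq> {v, q}"
      by blast
    then show "e \<in> edges Y"
    proof cases
      case 2
      then show ?thesis using NY(1)[of p] by (simp add: insert_commute)
    next
      case 3
      then show ?thesis using sd_instancesD(4)[OF X] unfolding edges_Y by blast
    qed (simp add: edges_Y)
  qed
  ultimately show ?thesis
    using sd_instancesD(5,6)[OF X]
    by (auto simp: sd_instances_def self_deleting_graph_def simple_graph_def verts_Y src_Y tgt_Y)
      (auto simp: verts_def)
qed

text \<open>A path through \<open>u\<close> from outside uses both new edges, so a deletion anywhere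
  on the old segment may be charged to either of them; only the disjunction matters.\<close>

lemma dels_Y:
  assumes "z \<in> verts X" "z \<noteq> u" "z \<noteq> v"
  shows "u \<notin> e \<Longrightarrow> v \<notin> e \<Longrightarrow> e \<in> dels Y z \<longleftrightarrow> e \<in> dels X z"
    "{p, u} \<in> dels Y z \<or> {u, q} \<in> dels Y z \<longleftrightarrow>
       {p, u} \<in> dels X z \<or> {u, v} \<in> dels X z \<or> {v, q} \<in> dels X z"
proof -
  have d: "dels Y z = (dels X z - {{p, u}, {u, v}, {v, q}}) \<union>
     (if dels X z \<inter> {{p, u}, {u, v}, {v, q}} \<noteq> {} then {{p, u}, {u, q}} else {})"
    using assms by (simp add: dels_contract)
  show "e \<in> dels Y z \<longleftrightarrow> e \<in> dels X z" if "u \<notin> e" "v \<notin> e"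
  proof -
    have "e \<noteq> {p, u}" "e \<noteq> {u, v}" "e \<noteq> {v, q}" "e \<noteq> {u, q}" using that by auto
    then show ?thesis unfolding d by simp
  qed
  \<comment> \<open>The new edge is not an edge of \<open>X\<close>, so no deletion of it is
    inherited.\<close>
  have "{u, q} \<notin> dels X z" using sd_instancesD(4)[OF X assms(1)] N(1)[of q] ne by auto
  then show "{p, u} \<in> dels Y z \<or> {u, q} \<in> dels Y z \<longleftrightarrow>
       {p, u} \<in> dels X z \<or> {u, v} \<in> dels X z \<or> {v, q} \<in> dels X z"
    unfolding d by simp
qed

lemma dels_Y_u:
  shows "u \<notin> e \<Longrightarrow> v \<notin> e \<Longrightarrow> e \<in> dels Y u \<longleftrightarrow> e \<in> dels X u \<or> e \<in> dels X v"
    "{u, q} \<in> dels Y u \<longleftrightarrow> {u, v} \<in> dels X u \<or> {v, q} \<in> dels X u \<or> {v, q} \<in> dels X v"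
    "{u, p} \<in> dels Y u \<longleftrightarrow> {v, u} \<in> dels X v \<or> {u, p} \<in> dels X v \<or> {u, p} \<in> dels X u"
proof -
  have d: "dels Y u = (dels X u \<union> dels X v - {{p, u}, {u, v}, {v, q}})
     \<union> (if {u, v} \<in> dels X u \<or> {v, q} \<in> dels X u \<or> {v, q} \<in> dels X v then {{u, q}} else {})
     \<union> (if {u, v} \<in> dels X v \<or> {p, u} \<in> dels X u \<or> {p, u} \<in> dels X v then {{p, u}} else {})"
    using ne by (simp add: dels_contract)
  show "e \<in> dels Y u \<longleftrightarrow> e \<in> dels X u \<or> e \<in> dels X v" if "u \<notin> e" "v \<notin> e"
  proof -
    have "e \<noteq> {p, u}" "e \<noteq> {u, v}" "e \<noteq> {v, q}" "e \<noteq> {u, q}" using that by auto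
    then show ?thesis unfolding d by simp
  qed
  have "{u, q} \<notin> dels X u" "{u, q} \<notin> dels X v"
    using sd_instancesD(4)[OF X inV(1)] sd_instancesD(4)[OF X inV(2)] N(1)[of q] ne by auto
  moreover have "{u, q} \<noteq> {p, u}" using ne by (auto simp: doubleton_eq_iff)
  ultimately show "{u, q} \<in> dels Y u \<longleftrightarrow> {u, v} \<in> dels X u \<or> {v, q} \<in> dels X u \<or> {v, q} \<in> dels X v"
    unfolding d by simp
  show "{u, p} \<in> dels Y u \<longleftrightarrow> {v, u} \<in> dels X v \<or> {u, p} \<in> dels X v \<or> {u, p} \<in> dels X u"
    using \<open>{u, q} \<noteq> {p, u}\<close> unfolding d insert_commute[of v u] insert_commute[of u p] by auto
qed

lemma st_path_contract:
  assumes ab: "a = p \<and> x = u \<and> y = v \<and> b = q \<or> a = q \<and> x = v \<and> y = u \<and> b = p"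
    and av: "u \<notin> set (as @ a # b # bs)" "v \<notin> set (as @ a # b # bs)"
  shows "st_path X (as @ a # x # y # b # bs) \<longleftrightarrow> st_path Y (as @ a # u # b # bs)"
proof (cases "set (as @ a # b # bs) \<subseteq> verts X")
  case V: True
  have zV: "z \<in> verts X" "z \<noteq> u" "z \<noteq> v" if "z \<in> set (as @ a # b # bs)" for z
    using V av that by auto
  have "conforming (dels X) (as @ a # x # y # b # bs) \<longleftrightarrow> conforming (dels Y) (as @ a # u # b # bs)"
    using av
  proof (rule conforming_contract)
    fix z assume z: "z \<in> set (as @ a # b # bs)"
    show "{a, u} \<in> dels Y z \<or> {u, b} \<in> dels Y z \<longleftrightarrow>
        {a, x} \<in> dels X z \<or> {x, y} \<in> dels X z \<or> {y, b} \<in> dels X z"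
      using ab
    proof (elim disjE conjE)
      assume "a = q" "x = v" "y = u" "b = p"
      then show ?thesis
        using dels_Y(2)[OF zV[OF z]]
        unfolding insert_commute[of p u] insert_commute[of u q] insert_commute[of u v] insert_commute[of v q]
        by blast
    qed (use dels_Y(2)[OF zV[OF z]] in simp)
    show "e \<in> dels Y z \<longleftrightarrow> e \<in> dels X z" if "u \<notin> e" "v \<notin> e" for e
      using dels_Y(1)[OF zV[OF z] that] .
  next
    show "{u, b} \<in> dels Y u \<longleftrightarrow> {x, y} \<in> dels X x \<or> {y, b} \<in> dels X x \<or> {y, b} \<in> dels X y"
      using ab dels_Y_u(2,3) by (elim disjE conjE) simp_all
    show "e \<in> dels Y u \<longleftrightarrow> e \<in> dels X x \<or> e \<in> dels X y" if "u \<notin> e" "v \<notin> e" for e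
      using ab dels_Y_u(1)[OF that] by (elim disjE conjE) (simp_all add: disj_commute)
  qed
  moreover have "pedges (as @ a # x # y # b # bs) \<subseteq> edges X \<longleftrightarrow> pedges (as @ a # u # b # bs) \<subseteq> edges Y"
  proof -
    have av1: "u \<notin> e" "v \<notin> e" if "e \<in> pedges (as @ [a]) \<union> pedges (b # bs)" for e
      using that av by (auto dest!: pedges_subset)
    have "pedges (as @ a # x # y # b # bs) = {{a, x}, {x, y}, {y, b}} \<union> (pedges (as @ [a]) \<union> pedges (b # bs))"
      by (auto simp: pedges_append2)
    moreover have "pedges (as @ a # u # b # bs) = {{a, u}, {u, b}} \<union> (pedges (as @ [a]) \<union> pedges (b # bs))"
      by (auto simp: pedges_append2)
    moreover have "{{a, x}, {x, y}, {y, b}} \<subseteq> edges X" "{{a, u}, {u, b}} \<subseteq> edges Y"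
      using ab N(1)[of p] N(1)[of v] N(2)[of q] N(2)[of u] NY(1)[of p] NY(1)[of q]
        insert_commute[of u p "{}"] insert_commute[of v q "{}"] insert_commute[of u q "{}"]
      by (elim disjE conjE; simp)+
    moreover have "pedges (as @ [a]) \<union> pedges (b # bs) \<subseteq> edges X \<longleftrightarrow>
        pedges (as @ [a]) \<union> pedges (b # bs) \<subseteq> edges Y"
      using NY(3) av1 by blast
    ultimately show ?thesis by (metis Un_subset_iff)
  qed
  moreover have "distinct (as @ a # x # y # b # bs) \<longleftrightarrow> distinct (as @ a # u # b # bs)"
    using ab av ne by auto
  moreover have "set (as @ a # x # y # b # bs) \<subseteq> verts X" "set (as @ a # u # b # bs) \<subseteq> verts X"
    using V ab inV by auto
  moreover have "hd (as @ a # x # y # b # bs) = hd (as @ a # u # b # bs)" by (simp add: hd_append)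
  moreover have "last (as @ a # x # y # b # bs) = last (as @ a # u # b # bs)" by simp
  ultimately show ?thesis
    by (simp only: st_path_def graph_path_iff verts_Y src_Y tgt_Y) simp
qed (auto simp: st_path_def graph_path_iff verts_Y)

lemma st_path_avoiding:
  assumes "u \<notin> set vs" "v \<notin> set vs"
  shows "st_path X vs \<longleftrightarrow> st_path Y vs"
proof (cases "set vs \<subseteq> verts X")
  case True
  have av: "u \<notin> e" "v \<notin> e" if "e \<in> pedges vs" for e
    using that assms by (auto dest!: pedges_subset)
  then have "pedges vs \<subseteq> edges X \<longleftrightarrow> pedges vs \<subseteq> edges Y" using NY(3) by blast
  moreover have "conforming (dels X) vs \<longleftrightarrow> conforming (dels Y) vs"
  proof (rule conforming_cong)
    fix z e assume "z \<in> set vs" "e \<in> pedges vs"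
    then show "e \<in> dels X z \<longleftrightarrow> e \<in> dels Y z" using dels_Y(1)[of z e] av[of e] True assms by auto
  qed
  ultimately show ?thesis by (simp add: st_path_def graph_path_iff verts_Y src_Y tgt_Y)
qed (auto simp: st_path_def graph_path_iff verts_Y)

lemma yes_contract: "self_deleting_st_path X \<longleftrightarrow> (\<exists>vs. st_path Y vs \<and> (\<forall>x\<in>set vs. x \<noteq> v))"
  unfolding self_deleting_st_path_iff
proof
  assume "\<exists>vs. st_path X vs"
  then obtain vs where vs: "st_path X vs" by blast
  then have path: "graph_path (verts X) (edges X) vs" and ends: "hd vs = src X" "last vs = tgt X"
    by (auto simp: st_path_def)
  have dist: "distinct vs" and sub: "pedges vs \<subseteq> edges X" using path by (auto simp: graph_path_iff)
  show "\<exists>vs. st_path Y vs \<and> (\<forall>x\<in>set vs. x \<noteq> v)"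
  proof (cases "u \<in> set vs")
    case False
    \<comment> \<open>As an inner vertex \<open>v\<close> would have two distinct neighbours on the
      path, one of which would be \<open>u\<close>.\<close>
    have "v \<notin> set vs"
    proof
      assume "v \<in> set vs"
      then obtain as a b bs where "vs = as @ a # v # b # bs" "{v, a} \<in> edges X" "{v, b} \<in> edges X" "a \<noteq> b"
        using path_interior_nbrs[OF path] ends ne by metis
      then show False using False N by auto
    qed
    then show ?thesis using st_path_avoiding[OF False] vs by auto
  next
    case True
    then obtain as a b bs where d: "vs = as @ a # u # b # bs" "{u, a} \<in> edges X" "{u, b} \<in> edges X" "a \<noteq> b"
      using path_interior_nbrs[OF path] ends ne by metis
    \<comment> \<open>The path meets both neighbours of \<open>u\<close>. Since \<open>v\<close> is
      no terminal, it must also continue from \<open>v\<close> to its other neighbour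
      \<open>q\<close>, and so traverses the whole of \<open>p u v q\<close> in one of the two
      directions.\<close>
    then consider "a = p" "b = v" | "a = v" "b = p"
      using N(1)[of a] N(1)[of b] by auto
    then show ?thesis
    proof cases
      case 1
      with d ends ne obtain c cs where c: "bs = c # cs" by (cases bs) auto
      then have "{v, c} \<in> edges X" using sub d 1 by (auto simp: pedges_append2)
      then have "c = q" using N dist d c by auto
      then have "vs = as @ p # u # v # q # cs" using d 1 c by simp
      moreover from this have "st_path Y (as @ p # u # q # cs)" using st_path_contract vs dist by auto
      ultimately show ?thesis using dist by (intro exI[of _ "as @ p # u # q # cs"]) auto
    next
      case 2
      with d ends ne obtain c cs where c: "as = cs @ [c]" by (cases as rule: rev_cases) auto
      then have vs': "vs = cs @ c # v # u # b # bs" using d 2 by simp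
      then have "{v, c} \<in> edges X" using sub by (auto simp: pedges_append2 insert_commute)
      then have "c = q" using N dist d c by auto
      then have "vs = cs @ q # v # u # p # bs" using vs' 2 by simp
      moreover from this have "st_path Y (cs @ q # u # p # bs)" using st_path_contract vs dist by auto
      ultimately show ?thesis using dist by (intro exI[of _ "cs @ q # u # p # bs"]) auto
    qed
  qed
next
  assume "\<exists>vs. st_path Y vs \<and> (\<forall>x\<in>set vs. x \<noteq> v)"
  then obtain vs where vs: "st_path Y vs" "v \<notin> set vs" by blast
  then have path: "graph_path (verts Y) (edges Y) vs" and ends: "hd vs = src X" "last vs = tgt X"
    by (auto simp: st_path_def src_Y tgt_Y)
  show "\<exists>vs. st_path X vs"
  proof (cases "u \<in> set vs")
    case False
    then show ?thesis using st_path_avoiding vs by blast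
  next
    case True
    then obtain as a b bs where d: "vs = as @ a # u # b # bs" "{u, a} \<in> edges Y" "{u, b} \<in> edges Y" "a \<noteq> b"
      using path_interior_nbrs[OF path] ends ne by metis
    then have "a = p \<and> b = q \<or> a = q \<and> b = p" using NY(1)[of a] NY(1)[of b] by auto
    moreover have "u \<notin> set (as @ a # b # bs)" "v \<notin> set (as @ a # b # bs)"
      using vs path d by (auto simp: graph_path_iff)
    ultimately show ?thesis using st_path_contract vs(1) d(1) by metis
  qed
qed

end

section \<open>Edge excess of vertex sets under deletion and contraction\<close>

definition edge_excess_le :: "'a set \<Rightarrow> 'a set set \<Rightarrow> nat \<Rightarrow> bool" where
  "edge_excess_le V E k \<longleftrightarrow> (\<forall>S\<subseteq>V. card {e \<in> E. e \<subseteq> S} \<le> card S + k)"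

lemma edge_excess_le_mono: "edge_excess_le V E k \<Longrightarrow> V' \<subseteq> V \<Longrightarrow> edge_excess_le V' E k"
  unfolding edge_excess_le_def by blast

lemma edge_excess_le_induced:
  assumes X: "X \<in> sd_instances" and sp: "edge_excess_le {v \<in> verts X. K v} (edges X) k"
  shows "edge_excess_le (verts (induced K X)) (edges (induced K X)) k"
  unfolding edge_excess_le_def
proof (intro allI impI)
  let ?Y = "induced K X" and ?g = "emb K X"
  fix S assume S: "S \<subseteq> verts ?Y"
  have "card {e \<in> edges ?Y. e \<subseteq> S} = card ((`) ?g ` {e \<in> edges ?Y. e \<subseteq> S})"
    using S by (intro card_image[symmetric] inj_on_subset[OF inj_on_image_Pow[OF emb_inj[of K X]]]) auto
  also have "\<dots> \<le> card {e \<in> edges X. e \<subseteq> ?g ` S}"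
    using sd_instancesD(7)[OF X] by (intro card_mono) (auto simp: edges_induced_iff[OF X])
  also have "\<dots> \<le> card (?g ` S) + k"
  proof -
    have "?g ` S \<subseteq> {v \<in> verts X. K v}" using S emb_image[of K X] by blast
    then show ?thesis using sp unfolding edge_excess_le_def by blast
  qed
  also have "card (?g ` S) = card S" using S by (intro card_image inj_on_subset[OF emb_inj]) auto
  finally show "card {e \<in> edges ?Y. e \<subseteq> S} \<le> card S + k" .
qed

text \<open>For \<open>S\<close> containing \<open>u\<close>, compare with \<open>insert v S\<close>
  in the old graph: replacing \<open>{u, q}\<close> by \<open>{v, q}\<close> maps the new edges
  injectively into the old ones and misses \<open>{u, v}\<close>. The old graph thus has one more
  vertex and at least one more edge, and the excess does not increase.\<close>

lemma (in merge) edge_excess_le_contract: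
  assumes sp: "edge_excess_le (verts X) (edges X) k"
  shows "edge_excess_le (verts X - {v}) (edges Y) k"
  unfolding edge_excess_le_def
proof (intro allI impI)
  fix S assume S: "S \<subseteq> verts X - {v}"
  have fin: "finite S" "finite (edges X)" using S sd_instancesD[OF X] by (auto intro: finite_subset)
  show "card {e \<in> edges Y. e \<subseteq> S} \<le> card S + k"
  proof (cases "u \<in> S")
    case False
    then have "{e \<in> edges Y. e \<subseteq> S} = {e \<in> edges X. e \<subseteq> S}" using NY(3) S by blast
    then show ?thesis using sp S unfolding edge_excess_le_def by auto
  next
    case True
    let ?B = "{e \<in> edges X. e \<subseteq> insert v S}"
    define g where "g e = (if e = {u, q} then {v, q} else e)" for e
    have "inj_on g {e \<in> edges Y. e \<subseteq> S}"
      using NY(2)[of q] by (auto simp: inj_on_def g_def split: if_splits)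
    moreover have "g ` {e \<in> edges Y. e \<subseteq> S} \<subseteq> ?B - {{u, v}}"
      using S N(2)[of q] ne by (auto simp: g_def edges_Y doubleton_eq_iff)
    ultimately have "card {e \<in> edges Y. e \<subseteq> S} \<le> card (?B - {{u, v}})"
      using fin by (intro card_inj_on_le[of g]) auto
    also have "\<dots> = card ?B - 1"
      using True N(1)[of v] by (intro card_Diff_singleton) auto
    also have "\<dots> \<le> card S + k"
    proof -
      have "card ?B \<le> card (insert v S) + k" using sp S inV unfolding edge_excess_le_def by blast
      then show ?thesis using S fin(1) by (auto simp: card_insert_if split: if_splits)
    qed
    finally show ?thesis .
  qed
qed

lemma card_verts: "card (verts X) = num_verts X"
  by (simp add: verts_def)

lemma num_verts_induced_less:
  assumes "u \<in> verts Z"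
  shows "num_verts (induced (\<lambda>i. i \<noteq> u) Z) < num_verts Z"
proof -
  have "{v \<in> verts Z. v \<noteq> u} \<subset> verts Z" using assms by blast
  then have "card {v \<in> verts Z. v \<noteq> u} < card (verts Z)"
    by (rule psubset_card_mono[rotated]) (simp add: verts_def)
  then show ?thesis
    by (metis card_verts card_verts_induced)
qed

lemma reduces_props:
  assumes X: "X \<in> sd_instances" and r: "reduces X Y"
  shows "Y \<in> sd_instances" "num_verts Y < num_verts X"
    "self_deleting_st_path Y \<longleftrightarrow> self_deleting_st_path X"
    "edge_excess_le (verts X) (edges X) k \<Longrightarrow> edge_excess_le (verts Y) (edges Y) k"
proof -
  have "Y \<in> sd_instances \<and> num_verts Y < num_verts X \<and>
    (self_deleting_st_path Y \<longleftrightarrow> self_deleting_st_path X) \<and>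
    (edge_excess_le (verts X) (edges X) k \<longrightarrow> edge_excess_le (verts Y) (edges Y) k)"
    using r unfolding reduces_def
  proof (elim disjE bexE conjE)
    fix u assume u: "u \<in> verts X" "removable (verts X) (edges X) (src X) (tgt X) u" "Y = induced (\<lambda>i. i \<noteq> u) X"
    then have K: "src X \<noteq> u" "tgt X \<noteq> u" by (auto simp: removable_def)
    have "self_deleting_st_path Y \<longleftrightarrow> self_deleting_st_path X"
    proof -
      have "\<forall>v\<in>set vs. v \<noteq> u" if "st_path X vs" for vs
        using that removable_not_on_path[OF _ _ _ u(2), of vs] by (auto simp: st_path_def)
      then have "(\<exists>vs. st_path X vs \<and> (\<forall>v\<in>set vs. v \<noteq> u)) \<longleftrightarrow> self_deleting_st_path X"
        unfolding self_deleting_st_path_iff by (intro ex_cong1) auto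
      then show ?thesis unfolding u(3) yes_induced[of X "\<lambda>i. i \<noteq> u", OF X K] .
    qed
    moreover have "edge_excess_le (verts X) (edges X) k \<longrightarrow> edge_excess_le (verts Y) (edges Y) k"
      unfolding u(3) by (rule impI, rule edge_excess_le_induced[OF X], erule edge_excess_le_mono) auto
    moreover have "Y \<in> sd_instances" "num_verts Y < num_verts X"
      unfolding u(3) by (rule induced_in_sd_instances[of X "\<lambda>i. i \<noteq> u", OF X K], rule num_verts_induced_less[OF u(1)])
    ultimately show ?thesis by blast
  next
    fix u v p q assume V: "u \<in> verts X" "v \<in> verts X" "p \<in> verts X" "q \<in> verts X"
      and m: "mergeable (verts X) (edges X) (src X) (tgt X) u v p q"
      and Y: "Y = induced (\<lambda>i. i \<noteq> v) (contract p u v q X)"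
    interpret merge X u v p q using X V m by unfold_locales
    let ?Z = "contract p u v q X"
    have K: "src ?Z \<noteq> v" "tgt ?Z \<noteq> v" using ne by (auto simp: src_Y tgt_Y)
    note Z = contract_in_sd_instances
    have "edge_excess_le (verts X) (edges X) k \<longrightarrow> edge_excess_le (verts Y) (edges Y) k"
      unfolding Y
      by (rule impI, rule edge_excess_le_induced[OF Z], rule edge_excess_le_mono[OF edge_excess_le_contract])
        (auto simp: verts_Y)
    moreover have "Y \<in> sd_instances"
      unfolding Y by (rule induced_in_sd_instances[of ?Z "\<lambda>i. i \<noteq> v", OF Z K])
    moreover have "num_verts Y < num_verts X"
      using num_verts_induced_less[of v ?Z] V(2) unfolding Y verts_Y by (simp add: contract_def Let_def)
    moreover have "self_deleting_st_path Y \<longleftrightarrow> self_deleting_st_path X"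
      unfolding Y yes_induced[of ?Z "\<lambda>i. i \<noteq> v", OF Z K] yes_contract ..
    ultimately show ?thesis by blast
  qed
  then show "Y \<in> sd_instances" "num_verts Y < num_verts X"
    "self_deleting_st_path Y \<longleftrightarrow> self_deleting_st_path X"
    "edge_excess_le (verts X) (edges X) k \<Longrightarrow> edge_excess_le (verts Y) (edges Y) k" by blast+
qed

section \<open>Feedback edges\<close>

lemma longest_path_exists:
  assumes "finite S" "S \<noteq> {}"
  obtains vs where "graph_path S E vs" "\<And>ws. graph_path S E ws \<Longrightarrow> length ws \<le> length vs"
proof -
  obtain x where "x \<in> S" using assms by blast
  then have "graph_path S E [x]" by (simp add: graph_path_iff)
  moreover have "length ws < Suc (card S)" if "graph_path S E ws" for ws
    using that assms(1) by (metis card_mono distinct_card graph_path_iff less_Suc_eq_le)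
  ultimately show thesis
    using ex_has_greatest_nat[of "graph_path S E" "[x]" length "Suc (card S)"] that by blast
qed

lemma longest_path_nbr:
  assumes "graph_path S E (x # vs)" "\<And>ws. graph_path S E ws \<Longrightarrow> length ws \<le> length (x # vs)"
    and "y \<in> S" "{x, y} \<in> E" "y \<noteq> x"
  shows "y \<in> set vs"
proof (rule ccontr)
  assume "y \<notin> set vs"
  then have "graph_path S E (y # x # vs)" using assms by (auto simp: graph_path_iff insert_commute)
  then show False using assms(2) by fastforce
qed

lemma pedges_take: "pedges (take n vs) \<subseteq> pedges vs"
  by (auto simp: pedges_conv)

text \<open>All neighbours of the first vertex of a longest path lie on that path; if there were
  two, the farther one would close a cycle.\<close>

lemma forest_low_degree:
  assumes "forest V E" "finite S" "S \<noteq> {}" "S \<subseteq> V" and E: "\<And>x. {x} \<notin> E"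
  shows "\<exists>x\<in>S. \<forall>y\<in>S. \<forall>z\<in>S. {x, y} \<in> E \<longrightarrow> {x, z} \<in> E \<longrightarrow> y = z"
proof -
  obtain vs where vs: "graph_path S E vs" "\<And>ws. graph_path S E ws \<Longrightarrow> length ws \<le> length vs"
    using longest_path_exists[OF assms(2,3)] by blast
  then obtain x rest where xr: "vs = x # rest" by (cases vs) (auto simp: graph_path_iff)
  \<comment> \<open>\<open>i < j\<close> gives \<open>j \<ge> 1\<close>, so the closed initial
    segment has at least three vertices.\<close>
  have False if i: "i < j" "j < length rest" "{x, rest ! j} \<in> E" for i j
  proof -
    let ?c = "x # take (Suc j) rest"
    have "graph_path V E ?c"
      using vs(1) assms(4) pedges_take[of "Suc (Suc j)" vs] set_take_subset[of "Suc j" rest] xr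
      by (auto simp: graph_path_iff dest: in_set_takeD)
    moreover have "last ?c = rest ! j" using i by (simp add: take_Suc_conv_app_nth)
    ultimately have "graph_cycle V E ?c" using i by (auto simp: graph_cycle_def insert_commute)
    then show False using assms(1) by (auto simp: forest_def)
  qed
  moreover have "\<exists>i<length rest. y = rest ! i" if "y \<in> S" "{x, y} \<in> E" for y
    using longest_path_nbr[of S E x rest y] vs that E xr by (metis in_set_conv_nth insert_absorb2)
  ultimately have "\<forall>y\<in>S. \<forall>z\<in>S. {x, y} \<in> E \<longrightarrow> {x, z} \<in> E \<longrightarrow> y = z"
    by (metis linorder_neqE_nat)
  moreover have "x \<in> S" using vs(1) xr by (simp add: graph_path_iff)
  ultimately show ?thesis by blast
qed

text \<open>Removing a vertex of degree at most one within \<open>S\<close> loses at most one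
  edge.\<close>

lemma forest_card_edges:
  assumes "forest V E" "finite V" and E: "\<And>e. e \<in> E \<Longrightarrow> card e = 2"
  shows "S \<subseteq> V \<Longrightarrow> card {e \<in> E. e \<subseteq> S} \<le> card S"
proof (induction "card S" arbitrary: S)
  case 0
  then have "S = {}" using assms(2) by (metis card_0_eq finite_subset)
  then have "{e \<in> E. e \<subseteq> S} = {}" using E by fastforce
  then show ?case by (metis card.empty le0)
next
  case (Suc n)
  have fin: "finite S" using Suc assms(2) finite_subset by blast
  have "{x} \<notin> E" for x using E[of "{x}"] by auto
  then obtain x where x: "x \<in> S" "\<forall>y\<in>S. \<forall>z\<in>S. {x, y} \<in> E \<longrightarrow> {x, z} \<in> E \<longrightarrow> y = z"
    using forest_low_degree[OF assms(1) fin _ Suc.prems] Suc.hyps(2) by fastforce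
  let ?A = "{e \<in> E. e \<subseteq> S - {x}}" and ?B = "{e \<in> E. e \<subseteq> S \<and> x \<in> e}"
  have "\<exists>y\<in>S. e = {x, y}" if "e \<in> ?B" for e
    using that E[of e] by (auto simp: card_2_iff doubleton_eq_iff)
  then have "e = e'" if "e \<in> ?B" "e' \<in> ?B" for e e'
    using that x(2) by (metis (no_types, lifting) mem_Collect_eq)
  then have "card ?B \<le> 1" using fin by (intro card_le_Suc0_iff_eq[THEN iffD2, folded One_nat_def]) auto
  moreover have "card ?A \<le> card (S - {x})" using Suc x(1) fin by (intro Suc.hyps(1)) auto
  moreover have "card {e \<in> E. e \<subseteq> S} \<le> card ?A + card ?B"
    using fin by (intro order_trans[OF card_mono card_Un_le]) auto
  moreover have "card S = Suc (card (S - {x}))" using card.remove[OF fin x(1)] .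
  ultimately show ?case by linarith
qed

lemma edge_excess_le_fen:
  assumes X: "X \<in> sd_instances"
  shows "edge_excess_le (verts X) (edges X) (fen X)"
proof -
  let ?V = "verts X" and ?E = "edges X"
  \<comment> \<open>The set of all edges is a feedback edge set, so the \<open>LEAST\<close> is
    attained.\<close>
  have "forest ?V (?E - ?E)"
    by (auto simp: forest_def graph_cycle_def)
  then have "\<exists>k. \<exists>F\<subseteq>?E. card F = k \<and> forest ?V (?E - F)" by blast
  then have "\<exists>F\<subseteq>?E. card F = fen X \<and> forest ?V (?E - F)"
    unfolding fen_def feedback_edge_number_def by (rule LeastI_ex)
  then obtain F where F: "F \<subseteq> ?E" "card F = fen X" "forest ?V (?E - F)" by blast
  note fin = sd_instancesD(7)[OF X]
  show ?thesis
    unfolding edge_excess_le_def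
  proof (intro allI impI)
    fix S assume S: "S \<subseteq> ?V"
    have "card {e \<in> ?E. e \<subseteq> S} \<le> card {e \<in> ?E - F. e \<subseteq> S} + card F"
      using fin F(1) finite_subset by (intro order_trans[OF card_mono card_Un_le]) auto
    also have "card {e \<in> ?E - F. e \<subseteq> S} \<le> card S"
      using forest_card_edges[OF F(3)] sd_instancesD[OF X] S by auto
    finally show "card {e \<in> ?E. e \<subseteq> S} \<le> card S + fen X" using F(2) by simp
  qed
qed

lemma card_incident:
  assumes "\<And>e. e \<in> E \<Longrightarrow> card e = 2 \<and> e \<subseteq> V"
  shows "card {e \<in> E. x \<in> e} = card {y \<in> V. {x, y} \<in> E}"
proof (rule bij_betw_same_card[of "\<lambda>y. {x, y}", symmetric], rule bij_betw_imageI)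
  show "inj_on (\<lambda>y. {x, y}) {y \<in> V. {x, y} \<in> E}" by (auto simp: inj_on_def doubleton_eq_iff)
  show "(\<lambda>y. {x, y}) ` {y \<in> V. {x, y} \<in> E} = {e \<in> E. x \<in> e}"
  proof (intro equalityI subsetI)
    fix e assume e: "e \<in> {e \<in> E. x \<in> e}"
    then obtain y where "e = {x, y}" using assms[of e] by (auto simp: card_2_iff doubleton_eq_iff)
    with e show "e \<in> (\<lambda>y. {x, y}) ` {y \<in> V. {x, y} \<in> E}" using assms[of e] by auto
  qed auto
qed

text \<open>Here \<open>n2\<close> and \<open>n3\<close> count the nonterminals of degree two and of
  degree at least three. The degree sum alone leaves \<open>n2\<close> unbounded, as a long cycle
  shows; \<open>2 * n2 \<le> m\<close> holds because degree-two vertices are independent, so no edge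
  is counted at two of them. Eliminating \<open>n3\<close> and \<open>n2\<close> gives 6 n \<le> 5 m
  + 12, hence n \<le> 5 k + 12 and m \<le> 6 k + 12.\<close>

lemma reduced_size_arith:
  fixes n n2 n3 m k :: nat
  assumes "n \<le> n2 + n3 + 2" "2 * n2 + 3 * n3 \<le> 2 * m" "2 * n2 \<le> m" "m \<le> n + k"
  shows "n + m \<le> 11 * k + 24"
  using assms by linarith

lemma fully_reduced_size:
  assumes X: "X \<in> sd_instances" and red: "fully_reduced X"
    and ex: "edge_excess_le (verts X) (edges X) k"
  shows "graph_size X \<le> 11 * k + 24"
proof -
  let ?V = "verts X" and ?E = "edges X"
  define N where "N x = {y \<in> ?V. {x, y} \<in> ?E}" for x
  define W where "W = ?V - {src X, tgt X}"
  define N2 where "N2 = {x \<in> W. card (N x) = 2}"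
  define N3 where "N3 = {x \<in> W. card (N x) \<noteq> 2}"
  note fin = sd_instancesD(1,7)[OF X]
  have E2: "card e = 2 \<and> e \<subseteq> ?V" if "e \<in> ?E" for e using sd_instancesD(2,3)[OF X that] by blast
  have finN: "finite (N x)" for x unfolding N_def using fin by simp
  have inc: "card {e \<in> ?E. x \<in> e} = card (N x)" for x
    unfolding N_def by (rule card_incident[OF E2])
  have loop: "{x} \<notin> ?E" for x using E2[of "{x}"] by auto
  have deg2: "card (N x) \<ge> 2" if x: "x \<in> W" for x
  proof (rule ccontr)
    assume "\<not> card (N x) \<ge> 2"
    then have "card (N x) \<le> Suc 0" by simp
    then have "\<forall>y\<in>N x. \<forall>z\<in>N x. y = z" using card_le_Suc0_iff_eq[OF finN] by blast
    then have "\<exists>p\<in>?V. \<forall>y\<in>?V. {x, y} \<in> ?E \<longrightarrow> y = p"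
      using x unfolding N_def W_def by (cases "N x = {}") (auto simp: N_def)
    then have "removable ?V ?E (src X) (tgt X) x" using x by (auto simp: removable_def W_def)
    then show False using red x by (auto simp: fully_reduced_def W_def)
  qed
  \<comment> \<open>For adjacent vertices of degree two the remaining neighbours \<open>p\<close>,
    \<open>q\<close> either coincide, which is a removable dead end, or differ, which allows a
    contraction.\<close>
  have indep: "{u, v} \<notin> ?E" if u: "u \<in> N2" and v: "v \<in> N2" for u v
  proof
    assume e: "{u, v} \<in> ?E"
    have uv: "u \<in> ?V" "v \<in> ?V" "u \<noteq> src X" "u \<noteq> tgt X" "v \<noteq> src X" "v \<noteq> tgt X"
      using u v by (auto simp: N2_def W_def)
    have ne: "u \<noteq> v" using e loop by auto
    have mem: "v \<in> N u" "u \<in> N v" using e uv by (auto simp: N_def insert_commute)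
    have pick: "\<exists>p. N u = {p, v} \<and> p \<noteq> v" if "card (N u) = 2" "v \<in> N u" for u v
      using that by (auto simp: card_2_iff)
    have "card (N u) = 2" "card (N v) = 2" using u v by (auto simp: N2_def)
    then obtain p q where p: "N u = {p, v}" "p \<noteq> v" and q: "N v = {q, u}" "q \<noteq> u"
      using pick[of u v] pick[of v u] mem by metis
    then have pq: "p \<in> ?V" "q \<in> ?V" unfolding N_def by blast+
    have nb: "{u, x} \<in> ?E \<longleftrightarrow> x = p \<or> x = v" "{v, x} \<in> ?E \<longleftrightarrow> x = u \<or> x = q" if "x \<in> ?V" for x
    proof -
      have "{u, x} \<in> ?E \<longleftrightarrow> x \<in> N u" "{v, x} \<in> ?E \<longleftrightarrow> x \<in> N v" using that by (auto simp: N_def)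
      then show "{u, x} \<in> ?E \<longleftrightarrow> x = p \<or> x = v" "{v, x} \<in> ?E \<longleftrightarrow> x = u \<or> x = q"
        unfolding p(1) q(1) by auto
    qed
    show False
    proof (cases "p = q")
      case True
      then have "\<forall>x\<in>?V. ({u, x} \<in> ?E \<longrightarrow> x = v \<or> x = p) \<and> ({v, x} \<in> ?E \<longrightarrow> x = u \<or> x = p)"
        using nb by auto
      then have "removable ?V ?E (src X) (tgt X) u"
        unfolding removable_def using uv ne pq by metis
      then show False using red uv by (auto simp: fully_reduced_def)
    next
      case False
      then have "mergeable ?V ?E (src X) (tgt X) u v p q"
        unfolding mergeable_def using uv ne p(2) q(2) nb by auto
      then show False using red uv pq by (auto simp: fully_reduced_def)
    qed
  qed
  have W: "W = N2 \<union> N3" "N2 \<inter> N3 = {}" "finite W" "finite N2" "finite N3"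
    using fin by (auto simp: N2_def N3_def W_def)
  have "card ?V \<le> card (W \<union> {src X, tgt X})" using fin by (intro card_mono) (auto simp: W_def)
  also have "\<dots> \<le> card W + 2" by (rule order_trans[OF card_Un_le]) (simp add: card_insert_if)
  also have "card W = card N2 + card N3" using W by (simp add: card_Un_disjoint)
  finally have 1: "card ?V \<le> card N2 + card N3 + 2" by simp
  have "2 * card N2 + 3 * card N3 = (\<Sum>x\<in>N2. 2) + (\<Sum>x\<in>N3. 3)" by simp
  also have "\<dots> \<le> (\<Sum>x\<in>N2. card (N x)) + (\<Sum>x\<in>N3. card (N x))"
    using deg2 by (intro add_mono sum_mono) (force simp: N2_def N3_def)+
  also have "\<dots> = (\<Sum>x\<in>W. card (N x))" using W by (simp add: sum.union_disjoint)
  also have "\<dots> \<le> (\<Sum>x\<in>?V. card (N x))" using fin by (intro sum_mono2) (auto simp: W_def)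
  also have "\<dots> = (\<Sum>x\<in>?V. card {e \<in> ?E. x \<in> e})" using inc by simp
  also have "\<dots> = (\<Sum>e\<in>?E. 2)"
  proof (rule sum_multicount_gen[OF fin])
    show "\<forall>e\<in>?E. card {x \<in> ?V. x \<in> e} = 2"
    proof
      fix e assume "e \<in> ?E"
      then have "{x \<in> ?V. x \<in> e} = e" "card e = 2" using E2[of e] by auto
      then show "card {x \<in> ?V. x \<in> e} = 2" by simp
    qed
  qed
  finally have 2: "2 * card N2 + 3 * card N3 \<le> 2 * card ?E" by simp
  have "2 * card N2 = (\<Sum>x\<in>N2. card (N x))" by (simp add: N2_def)
  also have "\<dots> = (\<Sum>x\<in>N2. card {e \<in> ?E. x \<in> e})" using inc by simp
  also have "\<dots> = (\<Sum>e\<in>?E. card {x \<in> N2. x \<in> e})"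
    by (rule sum_multicount_gen) (use W fin in auto)
  also have "\<dots> \<le> (\<Sum>e\<in>?E. 1)"
  proof (rule sum_mono)
    fix e assume e: "e \<in> ?E"
    have "x = y" if "x \<in> N2" "y \<in> N2" "x \<in> e" "y \<in> e" for x y
    proof (rule ccontr)
      assume "x \<noteq> y"
      then have "e = {x, y}" using that E2[OF e] by (auto simp: card_2_iff)
      then show False using indep that e by auto
    qed
    then show "card {x \<in> N2. x \<in> e} \<le> 1"
      using W by (intro card_le_Suc0_iff_eq[THEN iffD2, folded One_nat_def]) auto
  qed
  finally have 3: "2 * card N2 \<le> card ?E" by simp
  have "{e \<in> ?E. e \<subseteq> ?V} = ?E" using E2 by auto
  then have "card ?E \<le> card ?V + k" using ex unfolding edge_excess_le_def by (metis order_refl)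
  from reduced_size_arith[OF 1 2 3 this] show ?thesis unfolding graph_size_def .
qed

section \<open>Outerplanar graphs\<close>

lemma Jordan_two_arcs:
  fixes g h :: "real \<Rightarrow> complex"
  assumes "arc g" "arc h" "pathstart g = a" "pathfinish g = b" "pathstart h = a" "pathfinish h = b"
    and "path_image g \<inter> path_image h = {a, b}"
  defines "S \<equiv> path_image g \<union> path_image h"
  shows "inside S \<noteq> {}" "open (inside S)" "connected (inside S)" "open (outside S)" "frontier (inside S) = S"
proof -
  let ?c = "g +++ reversepath h"
  have "simple_path ?c"
    by (rule simple_path_join_loop) (use assms in \<open>auto simp: arc_reversepath\<close>)
  moreover have "pathfinish ?c = pathstart ?c" using assms by simp
  moreover have "path_image ?c = S" unfolding S_def using assms by (simp add: path_image_join)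
  ultimately show "inside S \<noteq> {}" "open (inside S)" "connected (inside S)" "open (outside S)"
    "frontier (inside S) = S"
    using Jordan_inside_outside[of ?c] by auto
qed

lemma connected_subset_side:
  assumes "connected C" "C \<inter> S = {}" "open (inside S)" "open (outside S)"
  shows "x \<in> C \<Longrightarrow> x \<in> inside S \<Longrightarrow> C \<subseteq> inside S" "x \<in> C \<Longrightarrow> x \<in> outside S \<Longrightarrow> C \<subseteq> outside S"
proof -
  have sub: "C \<subseteq> inside S \<union> outside S" using assms(2) by auto
  have "inside S \<inter> C = {} \<or> outside S \<inter> C = {}"
    using connectedD[OF assms(1,3,4) _ sub] by (simp add: Int_assoc[symmetric])
  then show "x \<in> C \<Longrightarrow> x \<in> inside S \<Longrightarrow> C \<subseteq> inside S" "x \<in> C \<Longrightarrow> x \<in> outside S \<Longrightarrow> C \<subseteq> outside S"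
    using sub by blast+
qed

text \<open>
  If each arc of a theta graph has an inner point on the outer face, then a point inside the cycle
  of the first two arcs is outside both other cycles; by Janiszewski's theorem the three arcs
  together do not separate it from infinity, although already the first two do.
\<close>

lemma theta_not_outer:
  fixes c1 c2 c3 :: "real \<Rightarrow> complex"
  assumes arcs: "arc c1" "arc c2" "arc c3"
    and start: "pathstart c1 = a" "pathstart c2 = a" "pathstart c3 = a"
    and finish: "pathfinish c1 = b" "pathfinish c2 = b" "pathfinish c3 = b"
    and int12: "path_image c1 \<inter> path_image c2 = {a, b}"
    and int13: "path_image c1 \<inter> path_image c3 = {a, b}"
    and int23: "path_image c2 \<inter> path_image c3 = {a, b}"
    and D: "path_image c1 \<union> path_image c2 \<union> path_image c3 \<subseteq> D"
    and m1: "m1 \<in> path_image c1 - {a, b}" "m1 \<in> closure (outside D)"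
    and m2: "m2 \<in> path_image c2 - {a, b}" "m2 \<in> closure (outside D)"
    and m3: "m3 \<in> path_image c3 - {a, b}" "m3 \<in> closure (outside D)"
  shows False
proof -
  \<comment> \<open>The inside of the cycle of \<open>g\<close> and \<open>h\<close> is open and
    disjoint from \<open>outside D\<close>, so the limit point \<open>m\<close> of
    \<open>outside D\<close> is not inside. Being connected and disjoint from the cycle, the open
    arc follows \<open>m\<close> to the outside.\<close>
  have outer: "path_image c - {a, b} \<subseteq> outside (path_image g \<union> path_image h)"
    if c: "arc c" "pathstart c = a" "pathfinish c = b"
      and "arc g" "arc h" "pathstart g = a" "pathfinish g = b" "pathstart h = a" "pathfinish h = b"
      and "path_image g \<inter> path_image h = {a, b}"
      and int: "path_image c \<inter> path_image g = {a, b}" "path_image c \<inter> path_image h = {a, b}"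
      and sub: "path_image g \<union> path_image h \<subseteq> D"
      and m: "m \<in> path_image c - {a, b}" "m \<in> closure (outside D)" for c g h m
  proof -
    let ?S = "path_image g \<union> path_image h"
    note J = Jordan_two_arcs[OF that(4-10)]
    have con: "connected (path_image c - {a, b})"
      using connected_simple_path_endless[OF arc_imp_simple_path[OF c(1)]] c by simp
    have disj: "(path_image c - {a, b}) \<inter> ?S = {}" using int by blast
    have "inside ?S \<inter> outside D = {}" using outside_mono[OF sub] inside_Int_outside[of ?S] by blast
    then have "inside ?S \<inter> closure (outside D) = {}" using J(2) open_Int_closure_eq_empty by blast
    then have "m \<in> outside ?S" using m disj inside_Un_outside[of ?S] by blast
    then show ?thesis using connected_subset_side(2)[OF con disj J(2,4) m(1)] by blast
  qed
  let ?S12 = "path_image c1 \<union> path_image c2" and ?S13 = "path_image c1 \<union> path_image c3"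
    and ?S23 = "path_image c2 \<union> path_image c3"
  have o3: "path_image c3 - {a, b} \<subseteq> outside ?S12"
    by (rule outer[where m = m3]) (use assms in \<open>auto simp: Int_commute\<close>)
  have o2: "path_image c2 - {a, b} \<subseteq> outside ?S13"
    by (rule outer[where m = m2]) (use assms in \<open>auto simp: Int_commute\<close>)
  have o1: "path_image c1 - {a, b} \<subseteq> outside ?S23"
    by (rule outer[where m = m1]) (use assms in \<open>auto simp: Int_commute\<close>)
  note J12 = Jordan_two_arcs[OF arcs(1,2) start(1) finish(1) start(2) finish(2) int12]
  note J13 = Jordan_two_arcs[OF arcs(1,3) start(1) finish(1) start(3) finish(3) int13]
  note J23 = Jordan_two_arcs[OF arcs(2,3) start(2) finish(2) start(3) finish(3) int23]
  obtain x where x: "x \<in> inside ?S12" using J12(1) by blast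
  \<comment> \<open>Otherwise the inside of \<open>S\<close>, which does not meet the first cycle,
    would lie inside that cycle; but its boundary contains \<open>m3\<close>, which is
    outside.\<close>
  have not_inside: "x \<notin> inside S" if S: "connected (inside S)" "frontier (inside S) = S"
    "S \<inter> inside S = {}" "inside S \<inter> ?S12 = {}" "m3 \<in> S" for S
  proof
    assume "x \<in> inside S"
    then have "inside S \<subseteq> inside ?S12" using connected_subset_side(1)[OF S(1,4) J12(2,4) _ x] by blast
    then have "closure (inside S) \<subseteq> closure (inside ?S12)" by (rule closure_mono)
    moreover have "m3 \<in> closure (inside S)" using S(2,5) by (auto simp: frontier_def)
    moreover have "closure (inside ?S12) = inside ?S12 \<union> ?S12"
      using J12(5) closure_Un_frontier by metis
    moreover have "m3 \<in> outside ?S12" using o3 m3 by blast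
    ultimately show False using inside_Un_outside[of ?S12] inside_Int_outside[of ?S12] by blast
  qed
  have e: "a \<in> path_image c1" "b \<in> path_image c1" "a \<in> path_image c2" "b \<in> path_image c2"
     "a \<in> path_image c3" "b \<in> path_image c3" using int12 int13 by auto
  have no: "S \<inter> inside S = {}" "outside S \<inter> inside S = {}" for S :: "complex set"
    using inside_no_overlap[of S] inside_Int_outside[of S] by blast+
  have "inside ?S13 \<inter> ?S12 = {}" using o2 no[of ?S13] e by blast
  then have "x \<notin> inside ?S13" using not_inside[OF J13(3,5) no(1)] m3 by blast
  moreover have "inside ?S23 \<inter> ?S12 = {}" using o1 no[of ?S23] e by blast
  then have "x \<notin> inside ?S23" using not_inside[OF J23(3,5) no(1)] m3 by blast
  moreover have "x \<notin> ?S12" using x inside_no_overlap[of ?S12] by blast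
  moreover have "x \<notin> path_image c3" using x o3 e \<open>x \<notin> ?S12\<close> inside_Int_outside[of ?S12] by blast
  ultimately have x13: "x \<in> outside ?S13" and x23: "x \<in> outside ?S23"
    using inside_Un_outside[of ?S13] inside_Un_outside[of ?S23] by blast+
  have comp: "compact (path_image c1)" "compact (path_image c2)" "compact (path_image c3)"
    using arcs by (simp_all add: compact_arc_image)
  have "bounded (?S12 \<union> path_image c3)" using comp by (simp add: compact_imp_bounded)
  then obtain y where y: "y \<in> outside (?S12 \<union> path_image c3)" using outside_bounded_nonempty by blast
  have y': "y \<in> outside ?S12" "y \<in> outside ?S13" "y \<in> outside ?S23"
    by (rule subsetD[OF outside_mono y]; blast)+
  have bd: "bounded ?S13" "bounded ?S23" using comp by (simp_all add: compact_imp_bounded)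
  have "connected_component (- S) x y" if "bounded S" "x \<in> outside S" "y \<in> outside S" for S
  proof -
    have "connected (outside S)" using connected_outside[OF that(1)] by simp
    moreover have "outside S \<subseteq> - S" using outside_no_overlap[of S] by blast
    ultimately show ?thesis using that(2,3) unfolding connected_component_def by blast
  qed
  from this[OF bd(1) x13 y'(2)] this[OF bd(2) x23 y'(3)]
  have "connected_component (- (?S13 \<union> ?S23)) x y"
  proof (rule Janiszewski[rotated 3])
    show "compact ?S13" "closed ?S23" using comp by (simp_all add: compact_Un compact_imp_closed)
    \<comment> \<open>The connected intersection required by Janiszewski's theorem is the third
      arc.\<close>
    have "?S13 \<inter> ?S23 = path_image c1 \<inter> path_image c2 \<union> path_image c3" by blast
    then have "?S13 \<inter> ?S23 = path_image c3" using int12 e by auto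
    then show "connected (?S13 \<inter> ?S23)" using arcs(3) by (simp add: connected_arc_image)
  qed
  then obtain C where "connected C" "C \<subseteq> - (?S13 \<union> ?S23)" "x \<in> C" "y \<in> C"
    unfolding connected_component_def by blast
  then have "C \<subseteq> inside ?S12"
    using connected_subset_side(1)[of C ?S12 x] J12(2,4) x by blast
  then show False using \<open>y \<in> C\<close> y'(1) inside_Int_outside[of ?S12] by blast
qed

text \<open>A path of a multigraph with vertices \<open>as\<close> and edges \<open>bs\<close>. The
  edges are listed too because parallel edges share the same \<open>ends\<close>.\<close>

fun chain :: "('a \<Rightarrow> 'a set) \<Rightarrow> 'a list \<Rightarrow> 'a list \<Rightarrow> bool" where
  "chain ends [x] [] \<longleftrightarrow> True"
| "chain ends (x # y # as) (b # bs) \<longleftrightarrow> ends b = {x, y} \<and> x \<notin> set (y # as) \<and> chain ends (y # as) bs"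
| "chain ends _ _ \<longleftrightarrow> False"

lemma chain_ends: "chain ends as bs \<Longrightarrow> bs \<noteq> [] \<Longrightarrow> \<Union> (ends ` set bs) = set as"
proof (induction ends as bs rule: chain.induct)
  case (2 ends x y as b bs)
  then show ?case by (cases bs; cases as) auto
qed auto

lemma chain_ends_subset: "chain ends as bs \<Longrightarrow> b \<in> set bs \<Longrightarrow> ends b \<subseteq> set as"
  using chain_ends[of ends as bs] by (cases bs) auto

lemma chain_exists:
  assumes "as \<noteq> []" "distinct as" "pedges as \<subseteq> ends ` B"
  shows "\<exists>bs. chain ends as bs \<and> set bs \<subseteq> B"
  using assms
proof (induction as)
  case (Cons x as)
  show ?case
  proof (cases as)
    case Nil
    then show ?thesis by (intro exI[of _ "[]"]) simp
  next
    case c: (Cons y zs)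
    with Cons obtain bs where "chain ends as bs" "set bs \<subseteq> B" by auto
    moreover obtain b where "b \<in> B" "ends b = {x, y}" using Cons.prems(3) c by auto
    ultimately show ?thesis using Cons.prems c by (intro exI[of _ "b # bs"]) auto
  qed
qed simp

lemma pedges_suffix: "pedges ys \<subseteq> pedges (xs @ ys)"
proof (induction xs)
  case (Cons x xs)
  have "pedges (xs @ ys) \<subseteq> pedges (x # xs @ ys)" by (cases "xs @ ys") auto
  with Cons show ?case by auto
qed simp

lemma pedges_prefix: "pedges xs \<subseteq> pedges (xs @ ys)"
  using pedges_take[of "length xs" "xs @ ys"] by simp

lemma pedges_rev: "pedges (rev vs) = pedges vs"
proof (induction vs rule: pedges.induct)
  case (1 x y zs)
  have "pedges (rev (x # y # zs)) = insert {y, x} (pedges (rev zs @ [y]) \<union> pedges [x])"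
    using pedges_append2[of "rev zs" y x "[]"] by simp
  with 1 show ?case by (simp add: insert_commute)
qed auto

text \<open>
  A vertex \<open>b \<in> B\<close> is the midpoint of a multigraph edge between the two vertices in \<open>ends b\<close>, drawn
  along the edges of \<open>E\<close>; so every multigraph edge passes through a vertex.
\<close>

locale drawn_multigraph =
  fixes V :: "'a set" and E :: "'a set set" and p :: "'a \<Rightarrow> complex" and \<gamma> :: "'a set \<Rightarrow> real \<Rightarrow> complex"
    and A B :: "'a set" and ends :: "'a \<Rightarrow> 'a set"
  assumes drawing: "plane_drawing V E p \<gamma>"
    and AB: "A \<subseteq> V" "B \<subseteq> V" "A \<inter> B = {}"
    and ends: "\<And>b. b \<in> B \<Longrightarrow> ends b \<subseteq> A" "\<And>b. b \<in> B \<Longrightarrow> card (ends b) = 2"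
    and ends_E: "\<And>b x. b \<in> B \<Longrightarrow> x \<in> ends b \<Longrightarrow> {x, b} \<in> E"
begin

definition seg :: "'a \<Rightarrow> complex set" where
  "seg b = (\<Union>x\<in>ends b. path_image (\<gamma> {x, b}))"

lemma inj_p: "inj_on p V"
  using drawing by (simp add: plane_drawing_def)

lemma edge_image_Int:
  "e \<in> E \<Longrightarrow> e' \<in> E \<Longrightarrow> e \<noteq> e' \<Longrightarrow> path_image (\<gamma> e) \<inter> path_image (\<gamma> e') = p ` (e \<inter> e')"
  using drawing by (simp add: plane_drawing_def)

lemma edge_arc:
  assumes "{x, y} \<in> E" "x \<noteq> y"
  obtains g where "arc g" "pathstart g = p x" "pathfinish g = p y" "path_image g = path_image (\<gamma> {x, y})"
proof -
  have g: "arc (\<gamma> {x, y})" "{pathstart (\<gamma> {x, y}), pathfinish (\<gamma> {x, y})} = {p x, p y}"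
    using drawing assms(1) by (auto simp: plane_drawing_def)
  then consider "pathstart (\<gamma> {x, y}) = p x" "pathfinish (\<gamma> {x, y}) = p y"
    | "pathstart (\<gamma> {x, y}) = p y" "pathfinish (\<gamma> {x, y}) = p x"
    by (auto simp: doubleton_eq_iff)
  then show thesis
  proof cases
    case 1
    then show ?thesis using that g(1) by blast
  next
    case 2
    then show ?thesis using that[of "reversepath (\<gamma> {x, y})"] g(1) by (simp add: arc_reversepath)
  qed
qed

text \<open>The two drawn edges at the midpoint \<open>b\<close> share no further point because
  their other ends differ, so they join to an arc.\<close>

lemma seg_arc:
  assumes b: "b \<in> B" "ends b = {x, y}" "x \<noteq> y"
  obtains g where "arc g" "pathstart g = p x" "pathfinish g = p y" "path_image g = seg b"
proof -
  have ne: "x \<noteq> b" "y \<noteq> b" using ends(1)[OF b(1)] b AB by auto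
  have E: "{x, b} \<in> E" "{b, y} \<in> E" using ends_E[OF b(1), of x] ends_E[OF b(1), of y] b(2) insert_commute[of y b "{}"] by auto
  obtain g where g: "arc g" "pathstart g = p x" "pathfinish g = p b" "path_image g = path_image (\<gamma> {x, b})"
    using edge_arc[OF E(1) ne(1)] by blast
  obtain h where h: "arc h" "pathstart h = p b" "pathfinish h = p y" "path_image h = path_image (\<gamma> {b, y})"
    using edge_arc[OF E(2)] ne(2) by metis
  have "{x, b} \<noteq> {b, y}" using b(3) by (auto simp: doubleton_eq_iff)
  then have int: "path_image g \<inter> path_image h = p ` ({x, b} \<inter> {b, y})"
    unfolding g(4) h(4) by (rule edge_image_Int[OF E])
  have "{x, b} \<inter> {b, y} = {b}" using b(3) ne by auto
  then have "arc (g +++ h)" using g h int by (intro arc_join) auto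
  moreover have "path_image (g +++ h) = seg b"
    unfolding seg_def b(2) using g h by (simp add: path_image_join insert_commute)
  ultimately show thesis using that[of "g +++ h"] g h by simp
qed

lemma seg_Int:
  assumes "b \<in> B" "b' \<in> B" "b \<noteq> b'"
  shows "seg b \<inter> seg b' = p ` (ends b \<inter> ends b')"
proof -
  have "path_image (\<gamma> {x, b}) \<inter> path_image (\<gamma> {x', b'}) = p ` ({x} \<inter> {x'})"
    if x: "x \<in> ends b" "x' \<in> ends b'" for x x'
  proof -
    have ne: "x \<noteq> b'" "x' \<noteq> b" using ends(1) assms x AB by blast+
    then have "{x, b} \<noteq> {x', b'}" using assms(3) by (auto simp: doubleton_eq_iff)
    moreover have "{x, b} \<inter> {x', b'} = {x} \<inter> {x'}" using ne assms(3) by auto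
    ultimately show ?thesis using edge_image_Int[OF ends_E ends_E, OF assms(1) x(1) assms(2) x(2)] by simp
  qed
  then show ?thesis unfolding seg_def by fastforce
qed

lemma vertex_in_seg:
  assumes "b \<in> B"
  shows "p b \<in> seg b" "ends b \<noteq> {}"
proof -
  show "ends b \<noteq> {}" using ends(2)[OF assms] by auto
  then obtain x where x: "x \<in> ends b" by blast
  have "path_image (\<gamma> {x, b}) \<inter> p ` V = p ` {x, b}"
    using drawing ends_E[OF assms x] by (auto simp: plane_drawing_def)
  then show "p b \<in> seg b" unfolding seg_def using x by blast
qed

lemma Union_seg_Int:
  assumes "Q \<subseteq> B" "Q' \<subseteq> B" "Q \<inter> Q' = {}"
  shows "\<Union> (seg ` Q) \<inter> \<Union> (seg ` Q') = p ` (\<Union> (ends ` Q) \<inter> \<Union> (ends ` Q'))"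
proof -
  have "\<Union> (seg ` Q) \<inter> \<Union> (seg ` Q') = (\<Union>b\<in>Q. \<Union>b'\<in>Q'. seg b \<inter> seg b')" by blast
  also have "\<dots> = (\<Union>b\<in>Q. \<Union>b'\<in>Q'. p ` (ends b \<inter> ends b'))"
    using assms seg_Int by (intro SUP_cong refl) blast
  also have "\<dots> = p ` (\<Union> (ends ` Q) \<inter> \<Union> (ends ` Q'))" by blast
  finally show ?thesis .
qed

text \<open>The first edge ends in a vertex that the rest of the chain avoids, so by
  \<open>Union_seg_Int\<close> it meets the remaining arc only at their common end.\<close>

lemma chain_arc:
  assumes "chain ends as bs" "set bs \<subseteq> B" "bs \<noteq> []"
  shows "\<exists>g. arc g \<and> pathstart g = p (hd as) \<and> pathfinish g = p (last as) \<and>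
    path_image g = \<Union> (seg ` set bs)"
  using assms
proof (induction bs arbitrary: as)
  case (Cons b bs)
  from Cons.prems(1) obtain x y as' where as: "as = x # y # as'"
    by (cases "(ends, as, b # bs)" rule: chain.cases) auto
  with Cons.prems have b: "b \<in> B" "ends b = {x, y}" "x \<notin> set (y # as')" "chain ends (y # as') bs" "set bs \<subseteq> B"
    by auto
  obtain g where g: "arc g" "pathstart g = p x" "pathfinish g = p y" "path_image g = seg b"
    by (rule seg_arc[OF b(1,2)]) (use b(3) in auto)
  show ?case
  proof (cases "bs = []")
    case True
    then have "as' = []" using b(4) by (cases as') auto
    then show ?thesis using g as True by auto
  next
    case False
    then obtain h where h: "arc h" "pathstart h = p y" "pathfinish h = p (last (y # as'))"
      "path_image h = \<Union> (seg ` set bs)" using Cons.IH[OF b(4,5)] by auto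
    have "b \<notin> set bs" using chain_ends_subset[OF b(4), of b] b(2,3) by auto
    then have "path_image g \<inter> path_image h = p ` (ends b \<inter> set (y # as'))"
      using Union_seg_Int[of "{b}" "set bs"] b(1,5) chain_ends[OF b(4) False] g(4) h(4) by auto
    also have "ends b \<inter> set (y # as') = {y}" using b(2,3) by auto
    finally have "arc (g +++ h)" using g h by (intro arc_join) auto
    moreover have "path_image (g +++ h) = \<Union> (seg ` set (b # bs))"
      using g h by (simp add: path_image_join)
    ultimately show ?thesis using g h as by (intro exI[of _ "g +++ h"]) auto
  qed
qed simp

text \<open>Each chain has at least one edge, and the midpoint of that edge is a drawn vertex on the
  outer face; it serves as the inner point that the topological lemma asks for.\<close>

lemma not_outer_theta:
  assumes outer: "\<And>b. b \<in> B \<Longrightarrow> p b \<in> closure (outside D)"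
    and D: "\<And>b. b \<in> B \<Longrightarrow> seg b \<subseteq> D"
    and chains: "chain ends as1 bs1" "chain ends as2 bs2" "chain ends as3 bs3"
    and bs: "set bs1 \<subseteq> B" "set bs2 \<subseteq> B" "set bs3 \<subseteq> B" "bs1 \<noteq> []" "bs2 \<noteq> []" "bs3 \<noteq> []"
    and disj: "set bs1 \<inter> set bs2 = {}" "set bs1 \<inter> set bs3 = {}" "set bs2 \<inter> set bs3 = {}"
    and hd: "hd as1 = a" "hd as2 = a" "hd as3 = a" and last: "last as1 = c" "last as2 = c" "last as3 = c"
    and int: "set as1 \<inter> set as2 = {a, c}" "set as1 \<inter> set as3 = {a, c}" "set as2 \<inter> set as3 = {a, c}"
  shows False
proof -
  obtain g1 where g1: "arc g1" "pathstart g1 = p a" "pathfinish g1 = p c" "path_image g1 = \<Union> (seg ` set bs1)"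
    using chain_arc[OF chains(1) bs(1,4)] hd last by auto
  obtain g2 where g2: "arc g2" "pathstart g2 = p a" "pathfinish g2 = p c" "path_image g2 = \<Union> (seg ` set bs2)"
    using chain_arc[OF chains(2) bs(2,5)] hd last by auto
  obtain g3 where g3: "arc g3" "pathstart g3 = p a" "pathfinish g3 = p c" "path_image g3 = \<Union> (seg ` set bs3)"
    using chain_arc[OF chains(3) bs(3,6)] hd last by auto
  have ac: "a \<in> A" "c \<in> A"
  proof -
    have "set as1 \<subseteq> A" using chain_ends[OF chains(1) bs(4)] ends(1) bs(1) by blast
    then show "a \<in> A" "c \<in> A" using int(1) by blast+
  qed
  have mid: "p b \<in> \<Union> (seg ` set bs) - {p a, p c}" "p b \<in> closure (outside D)"
    if "b \<in> set bs" "set bs \<subseteq> B" for b bs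
  proof -
    have b: "b \<in> B" "b \<in> V" "a \<in> V" "c \<in> V" "b \<noteq> a" "b \<noteq> c" using that ac AB by auto
    have "p b \<noteq> p a" "p b \<noteq> p c"
      using inj_onD[OF inj_p, of b a] inj_onD[OF inj_p, of b c] b by auto
    then show "p b \<in> \<Union> (seg ` set bs) - {p a, p c}" using vertex_in_seg(1)[OF b(1)] that(1) by blast
    show "p b \<in> closure (outside D)" using outer b(1) .
  qed
  obtain b1 b2 b3 where b: "b1 \<in> set bs1" "b2 \<in> set bs2" "b3 \<in> set bs3"
    using bs(4-6) by (meson list.set_sel(1))
  have img: "path_image g1 \<inter> path_image g2 = {p a, p c}" "path_image g1 \<inter> path_image g3 = {p a, p c}"
    "path_image g2 \<inter> path_image g3 = {p a, p c}"
    unfolding g1(4) g2(4) g3(4)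
    using Union_seg_Int[OF bs(1,2) disj(1)] Union_seg_Int[OF bs(1,3) disj(2)] Union_seg_Int[OF bs(2,3) disj(3)]
      chain_ends[OF chains(1) bs(4)] chain_ends[OF chains(2) bs(5)] chain_ends[OF chains(3) bs(6)] int
    by simp_all
  have sub: "path_image g1 \<union> path_image g2 \<union> path_image g3 \<subseteq> D"
    unfolding g1(4) g2(4) g3(4) using D bs(1-3) by blast
  show False
    by (rule theta_not_outer[OF g1(1) g2(1) g3(1) g1(2) g2(2) g3(2) g1(3) g2(3) g3(3) img sub,
          of "p b1" "p b2" "p b3"])
      (use mid[OF b(1) bs(1)] mid[OF b(2) bs(2)] mid[OF b(3) bs(3)] g1(4) g2(4) g3(4) in simp_all)
qed

text \<open>
  A longest path in a multigraph of minimum degree three contains all neighbours of its first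
  vertex, so together with two further edges at that vertex it contains a theta graph.
\<close>

lemma low_degree:
  assumes outer: "\<And>b. b \<in> B \<Longrightarrow> p b \<in> closure (outside D)"
    and D: "\<And>b. b \<in> B \<Longrightarrow> seg b \<subseteq> D"
    and fin: "finite A" "finite B" "A \<noteq> {}"
  shows "\<exists>a\<in>A. card {b \<in> B. a \<in> ends b} \<le> 2"
proof (rule ccontr)
  assume "\<not> ?thesis"
  then have deg: "card {b \<in> B. a \<in> ends b} \<ge> 3" if "a \<in> A" for a using that by force
  obtain vs where vs: "graph_path A (ends ` B) vs"
    "\<And>ws. graph_path A (ends ` B) ws \<Longrightarrow> length ws \<le> length vs"
    using longest_path_exists[OF fin(1,3)] by blast
  then obtain a rest where ar: "vs = a # rest" by (cases vs) (auto simp: graph_path_iff)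
  have path: "a \<in> A" "a \<notin> set rest" "distinct rest" "set rest \<subseteq> A" "pedges (a # rest) \<subseteq> ends ` B"
    using vs(1) ar by (auto simp: graph_path_iff)
  have other: "\<exists>y\<in>set rest. ends b = {a, y}" if b: "b \<in> B" "a \<in> ends b" for b
  proof -
    obtain y where y: "ends b = {a, y}" "y \<noteq> a"
      using ends(2)[OF b(1)] b(2) by (auto simp: card_2_iff doubleton_eq_iff)
    have "y \<in> A" using ends(1)[OF b(1)] y(1) by blast
    then have "y \<in> set rest"
      using longest_path_nbr[of A "ends ` B" a rest y] vs ar y b(1) by blast
    then show ?thesis using y(1) by blast
  qed
  have "{b \<in> B. a \<in> ends b} \<noteq> {}" using deg[OF path(1)] by (metis card.empty not_numeral_le_zero)
  then have "rest \<noteq> []" using other by fastforce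
  then obtain z zs where rest: "rest = z # zs" by (cases rest) auto
  then obtain b1 where b1: "b1 \<in> B" "ends b1 = {a, z}" using path(5) by auto
  \<comment> \<open>\<open>b1\<close> is the edge by which the path leaves \<open>a\<close>. The two
    further edges may be parallel to it or to each other.\<close>
  have "card ({b \<in> B. a \<in> ends b} - {b1}) \<ge> 2"
    using deg[OF path(1)] b1 fin(2) by (simp add: card_Diff_singleton)
  then have "\<not> card ({b \<in> B. a \<in> ends b} - {b1}) \<le> Suc 0" by simp
  then have "\<not> (\<forall>x\<in>{b \<in> B. a \<in> ends b} - {b1}. \<forall>y\<in>{b \<in> B. a \<in> ends b} - {b1}. x = y)"
    using card_le_Suc0_iff_eq[of "{b \<in> B. a \<in> ends b} - {b1}"] fin(2) by simp
  then obtain b2 b3 where b23: "b2 \<in> B" "b3 \<in> B" "a \<in> ends b2" "a \<in> ends b3" "b2 \<noteq> b3" "b2 \<noteq> b1" "b3 \<noteq> b1"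
    by blast
  obtain y2 y3 where y: "y2 \<in> set rest" "ends b2 = {a, y2}" "y3 \<in> set rest" "ends b3 = {a, y3}"
    using other b23 by metis
  \<comment> \<open>The theta graph branches at \<open>a\<close> and \<open>c\<close>, where
    \<open>d\<close> is equal to \<open>c\<close> or comes later on the path. Its three chains run
    from \<open>a\<close> along the path to \<open>c\<close>, directly from \<open>a\<close> to
    \<open>c\<close> by \<open>b\<close>, and from \<open>a\<close> by \<open>b'\<close> to
    \<open>d\<close> and back along the path to \<open>c\<close>.\<close>
  have False if c: "rest = xs @ c # ys" "d \<in> set (c # ys)" "b \<in> B" "b' \<in> B" "ends b = {a, c}" "ends b' = {a, d}"
    "b \<noteq> b'" "b \<noteq> b1" "b' \<noteq> b1" for xs c ys d b b'
  proof -
    obtain us ws where d: "c # ys = us @ d # ws" using c(2) by (meson split_list)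
    have c_us: "hd (us @ [d]) = c" using d by (cases us) auto
    have rest_us: "rest = xs @ us @ d # ws" using c(1) d by simp
    let ?as1 = "a # xs @ [c]" and ?as3 = "a # rev (us @ [d])"
    have sub: "pedges l \<subseteq> ends ` B" if "rest = l1 @ l @ l2" for l l1 l2
    proof -
      have "pedges l \<subseteq> pedges (l1 @ l @ l2)"
        using pedges_prefix[of l l2] pedges_suffix[of "l @ l2" l1] by blast
      also have "\<dots> \<subseteq> pedges (a # rest)" using pedges_suffix[of rest "[a]"] that by simp
      finally show ?thesis using path(5) by blast
    qed
    have "pedges (xs @ [c]) \<subseteq> ends ` B" using sub[of "[]" "xs @ [c]" ys] c(1) by simp
    then obtain cs1 where cs1: "chain ends (xs @ [c]) cs1" "set cs1 \<subseteq> B"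
      using chain_exists[of "xs @ [c]" ends B] path(3) c(1) by auto
    have "pedges (rev (us @ [d])) \<subseteq> ends ` B"
      unfolding pedges_rev using sub[of xs "us @ [d]" ws] rest_us by simp
    then obtain cs3 where cs3: "chain ends (rev (us @ [d])) cs3" "set cs3 \<subseteq> B"
      using chain_exists[of "rev (us @ [d])" ends B] path(3) rest_us by auto
    have in_rest: "set (xs @ [c]) \<subseteq> set rest" unfolding c(1) by auto
    have in_rest': "set (us @ [d]) \<subseteq> set rest" unfolding rest_us by auto
    have a_ne: "a \<notin> set (xs @ [c])" "a \<notin> set (us @ [d])" using path(2) in_rest in_rest' by blast+
    obtain t where t: "xs @ [c] = z # t" using c(1) rest by (cases xs) auto
    have chains: "chain ends ?as1 (b1 # cs1)" "chain ends [a, c] [b]" "chain ends ?as3 (b' # cs3)"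
    proof -
      show "chain ends ?as1 (b1 # cs1)"
        unfolding t using cs1(1)[unfolded t] a_ne(1)[unfolded t] b1(2) by simp
      show "chain ends [a, c] [b]" using a_ne(1) c(5) by simp
      show "chain ends ?as3 (b' # cs3)"
        unfolding rev_append rev.simps append.simps
        using cs3(1)[unfolded rev_append rev.simps append.simps] a_ne(2) c(6) by simp
    qed
    have seg13: "set (xs @ [c]) \<inter> set (us @ [d]) = {c}"
    proof -
      have "c \<in> set (us @ [d])" using c_us by (metis hd_in_set snoc_eq_iff_butlast)
      moreover have "set xs \<inter> set (us @ [d]) = {}" using path(3) unfolding rest_us by auto
      ultimately show ?thesis by auto
    qed
    have a_notin: "a \<notin> ends e" if "e \<in> set cs1 \<union> set cs3" for e
    proof -
      have "ends e \<subseteq> set (xs @ [c]) \<union> set (us @ [d])"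
        using that chain_ends_subset[OF cs1(1)] chain_ends_subset[OF cs3(1)] by auto
      then show ?thesis using a_ne by blast
    qed
    have "set cs1 \<inter> set cs3 = {}"
    proof (rule ccontr)
      assume "set cs1 \<inter> set cs3 \<noteq> {}"
      then obtain e where e: "e \<in> set cs1" "e \<in> set cs3" by blast
      then have "ends e \<subseteq> {c}"
        using chain_ends_subset[OF cs1(1) e(1)] chain_ends_subset[OF cs3(1), of e] seg13
        unfolding set_rev by blast
      then have "card (ends e) \<le> 1" using card_mono[of "{c}" "ends e"] by simp
      then show False using ends(2)[of e] e cs1(2) by auto
    qed
    moreover have "b1 \<notin> set cs3" "b \<notin> set cs1" "b \<notin> set cs3" "b' \<notin> set cs1"
      using a_notin b1(2) c(5,6) by auto
    ultimately have disj: "set (b1 # cs1) \<inter> set [b] = {}" "set (b1 # cs1) \<inter> set (b' # cs3) = {}"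
      "set [b] \<inter> set (b' # cs3) = {}"
      using c(7-9) by auto
    have c_in: "c \<in> set (us @ [d])" using seg13 by blast
    have int: "set ?as1 \<inter> set [a, c] = {a, c}" "set ?as1 \<inter> set ?as3 = {a, c}" "set [a, c] \<inter> set ?as3 = {a, c}"
    proof -
      have "set ?as1 = insert a (set (xs @ [c]))" "set ?as3 = insert a (set (us @ [d]))" by simp_all
      then show "set ?as1 \<inter> set [a, c] = {a, c}" "set ?as1 \<inter> set ?as3 = {a, c}" "set [a, c] \<inter> set ?as3 = {a, c}"
        using seg13 a_ne c_in by (simp_all only: list.set) auto
    qed
    have last: "last ?as1 = c" "last [a, c] = c" "last ?as3 = c"
      using c_us by (cases us; simp add: last_rev)+
    show False
      by (rule not_outer_theta[OF outer D chains _ _ _ _ _ _ disj _ _ _ last int])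
        (use cs1(2) cs3(2) b1(1) c(3,4) in auto)
  qed
  note no_pair = this
  obtain xs ys where rest': "rest = xs @ y2 # ys" using y(1) by (meson split_list)
  show False
  proof (cases "y3 \<in> set (y2 # ys)")
    case True
    show ?thesis by (rule no_pair[OF rest' True b23(1,2) y(2,4) b23(5-7)])
  next
    case False
    then have "y3 \<in> set xs" using y(3) rest' by auto
    then obtain xs1 xs2 where "xs = xs1 @ y3 # xs2" by (meson split_list)
    then have "rest = xs1 @ y3 # (xs2 @ y2 # ys)" using rest' by simp
    then show ?thesis by (rule no_pair[OF _ _ b23(2,1) y(4,2) b23(5)[symmetric] b23(7,6)]) simp
  qed
qed

end

text \<open>Submultigraphs inherit the drawing, so vertices can be deleted one after the other, each
  with at most two remaining edges.\<close>

lemma multigraph_card_le: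
  assumes "finite V" and outer: "\<And>v. v \<in> V \<Longrightarrow> p v \<in> closure (outside (p ` V \<union> (\<Union>e\<in>E. path_image (\<gamma> e))))"
    and "drawn_multigraph V E p \<gamma> A B ends"
  shows "card B \<le> 2 * card A"
  using assms(3)
proof (induction "card A" arbitrary: A B)
  case 0
  interpret drawn_multigraph V E p \<gamma> A B ends by fact
  have "A = {}" using 0 AB(1) assms(1) by (metis card_0_eq finite_subset)
  then have "B = {}" using ends by fastforce
  then show ?case by simp
next
  case (Suc n)
  interpret drawn_multigraph V E p \<gamma> A B ends by fact
  have fin: "finite A" "finite B" using AB assms(1) finite_subset by blast+
  have "\<exists>a\<in>A. card {b \<in> B. a \<in> ends b} \<le> 2"
  proof (rule low_degree[OF _ _ fin])
    show "A \<noteq> {}" using Suc.hyps(2) by auto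
    show "p b \<in> closure (outside (p ` V \<union> (\<Union>e\<in>E. path_image (\<gamma> e))))" if "b \<in> B" for b
      using outer AB(2) that by blast
    show "seg b \<subseteq> p ` V \<union> (\<Union>e\<in>E. path_image (\<gamma> e))" if "b \<in> B" for b
      using ends_E[OF that] unfolding seg_def by blast
  qed
  then obtain a where a: "a \<in> A" "card {b \<in> B. a \<in> ends b} \<le> 2" by blast
  let ?B = "{b \<in> B. a \<notin> ends b}"
  have "drawn_multigraph V E p \<gamma> (A - {a}) ?B ends"
    using drawing AB ends ends_E by unfold_locales blast+
  then have "card ?B \<le> 2 * card (A - {a})"
    using Suc.hyps(1)[of "A - {a}" ?B] Suc.hyps(2) a(1) fin by simp
  moreover have "card B = card {b \<in> B. a \<in> ends b} + card ?B"
    using fin(2) by (subst card_Un_disjoint[symmetric]) (auto intro!: arg_cong[where f = card])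
  moreover have "card A = Suc (card (A - {a}))" using card.remove[OF fin(1) a(1)] .
  ultimately show ?case using a(2) by linarith
qed

section \<open>Vertices with two neighbours in a set, and the number of edges\<close>

definition two_nbrs :: "'a set \<Rightarrow> 'a set set \<Rightarrow> 'a set \<Rightarrow> 'a set" where
  "two_nbrs V E A = {b \<in> V - A. \<exists>x\<in>A. \<exists>y\<in>A. x \<noteq> y \<and> {x, b} \<in> E \<and> {y, b} \<in> E}"

text \<open>Choosing two neighbours in \<open>A\<close> makes each such vertex the midpoint of a
  multigraph edge on \<open>A\<close>.\<close>

lemma outerplanar_two_nbrs:
  assumes "outerplanar V E" "finite V" "A \<subseteq> V"
  shows "card (two_nbrs V E A) \<le> 2 * card A"
proof -
  let ?D = "\<lambda>p \<gamma>. p ` V \<union> (\<Union>e\<in>E. path_image (\<gamma> e))"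
  obtain p :: "'a \<Rightarrow> complex" and \<gamma> where d: "plane_drawing V E p \<gamma>"
    and f: "\<And>v. v \<in> V \<Longrightarrow> p v \<in> frontier (outside (?D p \<gamma>))"
    using assms(1) unfolding outerplanar_def Let_def by blast
  have "\<forall>b\<in>two_nbrs V E A. \<exists>e. e \<subseteq> A \<and> card e = 2 \<and> (\<forall>x\<in>e. {x, b} \<in> E)"
  proof
    fix b assume "b \<in> two_nbrs V E A"
    then obtain x y where "x \<in> A" "y \<in> A" "x \<noteq> y" "{x, b} \<in> E" "{y, b} \<in> E"
      unfolding two_nbrs_def by blast
    then show "\<exists>e. e \<subseteq> A \<and> card e = 2 \<and> (\<forall>x\<in>e. {x, b} \<in> E)"
      by (intro exI[of _ "{x, y}"]) auto
  qed
  then obtain ends where "\<forall>b\<in>two_nbrs V E A. ends b \<subseteq> A \<and> card (ends b) = 2 \<and> (\<forall>x\<in>ends b. {x, b} \<in> E)"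
    by (rule bchoice[THEN exE])
  then have "drawn_multigraph V E p \<gamma> A (two_nbrs V E A) ends"
    using d assms(3) by unfold_locales (auto simp: two_nbrs_def)
  moreover have "p v \<in> closure (outside (?D p \<gamma>))" if "v \<in> V" for v
    using f[OF that] by (simp add: frontier_def)
  ultimately show ?thesis using multigraph_card_le[OF assms(2)] by blast
qed

text \<open>
  A set \<open>A\<close> minimising \<open>8 |A| + (\<Sum>v. max 0 (2 - |N v \<inter> A|))\<close> is small, and if all degrees are large,
  then almost every vertex outside has two neighbours in it.
\<close>

lemma low_degree_vertex:
  assumes fin: "finite V" "V \<noteq> {}" and two: "\<And>A. A \<subseteq> V \<Longrightarrow> card (two_nbrs V E A) \<le> 2 * card A"
  shows "\<exists>v\<in>V. card {x \<in> V. {v, x} \<in> E} \<le> 33"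
proof (rule ccontr)
  assume "\<not> ?thesis"
  then have deg: "card {x \<in> V. {v, x} \<in> E} \<ge> 34" if "v \<in> V" for v using that by force
  define cov where "cov A v = card {x \<in> A. {v, x} \<in> E}" for A v
  \<comment> \<open>Subtraction is truncated, so the sum counts the neighbours in \<open>A\<close>
    that are still missing from two. The weight 8 balances two bounds: |A| \<le> |V| / 4 from
    comparison with the empty set, and |U| \<le> (8 / 33) |V| from \<open>nb\<close>. As 3/4 + 8/33
    < 1, this contradicts |V| \<le> 3 |A| + |U|.\<close>
  define \<Psi> where "\<Psi> A = 8 * card A + (\<Sum>v\<in>V. 2 - cov A v)" for A
  obtain A where A: "A \<subseteq> V" "\<And>B. B \<subseteq> V \<Longrightarrow> \<Psi> A \<le> \<Psi> B"
    using ex_has_least_nat[of "\<lambda>A. A \<subseteq> V" "{}" \<Psi>] by blast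
  have finA: "finite A" using A(1) fin(1) finite_subset by blast
  define U where "U = {v \<in> V. cov A v < 2}"
  have finU: "finite U" using fin(1) by (simp add: U_def)
  have "\<Psi> A \<le> 2 * card V" using A(2)[of "{}"] by (simp add: \<Psi>_def cov_def)
  then have 1: "8 * card A \<le> 2 * card V" by (simp add: \<Psi>_def)
  \<comment> \<open>Adding \<open>x\<close> to \<open>A\<close> costs 8 and saves one for each
    neighbour of \<open>x\<close> in \<open>U\<close>; minimality of \<open>A\<close> forbids a
    gain.\<close>
  have nb: "card {v \<in> U. {v, x} \<in> E} \<le> 8" if x: "x \<in> V - A" for x
  proof -
    have "cov (insert x A) v = cov A v + (if {v, x} \<in> E then 1 else 0)" for v
    proof -
      have "{y \<in> insert x A. {v, y} \<in> E} = (if {v, x} \<in> E then insert x {y \<in> A. {v, y} \<in> E} else {y \<in> A. {v, y} \<in> E})"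
        by auto
      then show ?thesis using x finA by (simp add: cov_def)
    qed
    then have "(\<Sum>v\<in>V. 2 - cov A v) =
       (\<Sum>v\<in>V. (2 - cov (insert x A) v) + (if v \<in> U \<and> {v, x} \<in> E then 1 else 0))"
      by (intro sum.cong) (auto simp: U_def)
    also have "\<dots> = (\<Sum>v\<in>V. 2 - cov (insert x A) v) + (\<Sum>v\<in>V. if v \<in> U \<and> {v, x} \<in> E then 1 else 0)"
      by (rule sum.distrib)
    also have "(\<Sum>v\<in>V. if v \<in> U \<and> {v, x} \<in> E then 1 else 0) = card {v \<in> U. {v, x} \<in> E}"
    proof -
      have "{v \<in> V. v \<in> U \<and> {v, x} \<in> E} = {v \<in> U. {v, x} \<in> E}" by (auto simp: U_def)
      then show ?thesis using fin(1) by (simp add: sum.If_cases Int_def)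
    qed
    finally have "\<Psi> A + 8 = \<Psi> (insert x A) + card {v \<in> U. {v, x} \<in> E}"
      using x finA by (simp add: \<Psi>_def)
    moreover have "\<Psi> A \<le> \<Psi> (insert x A)" using A x by auto
    ultimately show ?thesis by linarith
  qed
  \<comment> \<open>A vertex of \<open>U\<close> has at least 34 neighbours, at most one of them in
    \<open>A\<close>. The edges from \<open>U\<close> to \<open>V - A\<close> are counted from both
    sides.\<close>
  have "33 * card U = (\<Sum>v\<in>U. 33)" by simp
  also have "\<dots> \<le> (\<Sum>v\<in>U. card {x \<in> V - A. {v, x} \<in> E})"
  proof (rule sum_mono)
    fix v assume v: "v \<in> U"
    have "{x \<in> V. {v, x} \<in> E} = {x \<in> V - A. {v, x} \<in> E} \<union> {x \<in> A. {v, x} \<in> E}" using A(1) by blast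
    then have "card {x \<in> V. {v, x} \<in> E} \<le> card {x \<in> V - A. {v, x} \<in> E} + cov A v"
      unfolding cov_def using card_Un_le[of "{x \<in> V - A. {v, x} \<in> E}" "{x \<in> A. {v, x} \<in> E}"] by simp
    then show "33 \<le> card {x \<in> V - A. {v, x} \<in> E}" using deg[of v] v by (simp add: U_def)
  qed
  also have "\<dots> = (\<Sum>x\<in>V - A. card {v \<in> U. {v, x} \<in> E})"
    by (rule sum_multicount_gen) (use fin finU in auto)
  also have "\<dots> \<le> (\<Sum>x\<in>V - A. 8)" by (rule sum_mono) (rule nb)
  also have "\<dots> \<le> 8 * card V" using fin(1) by (simp add: card_mono)
  finally have 2: "33 * card U \<le> 8 * card V" .
  have "V \<subseteq> A \<union> U \<union> two_nbrs V E A"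
  proof
    fix v assume v: "v \<in> V"
    show "v \<in> A \<union> U \<union> two_nbrs V E A"
    proof (rule ccontr)
      assume n: "v \<notin> A \<union> U \<union> two_nbrs V E A"
      then have "\<not> card {x \<in> A. {v, x} \<in> E} \<le> Suc 0" using v by (auto simp: U_def cov_def)
      then obtain x y where "x \<in> A" "y \<in> A" "{v, x} \<in> E" "{v, y} \<in> E" "x \<noteq> y"
        using card_le_Suc0_iff_eq[of "{x \<in> A. {v, x} \<in> E}"] finA by auto
      moreover from this have "{x, v} \<in> E" "{y, v} \<in> E"
        by (simp_all add: insert_commute[of _ v])
      ultimately have "v \<in> two_nbrs V E A" using n v unfolding two_nbrs_def by blast
      then show False using n by blast
    qed
  qed
  then have "card V \<le> card (A \<union> U \<union> two_nbrs V E A)"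
    using finA finU fin(1) by (intro card_mono) (auto simp: two_nbrs_def)
  also have "\<dots> \<le> card A + card U + card (two_nbrs V E A)"
    using card_Un_le[of "A \<union> U" "two_nbrs V E A"] card_Un_le[of A U] by linarith
  also have "\<dots> \<le> 3 * card A + card U" using two[OF A(1)] by simp
  finally have "card V \<le> 3 * card A + card U" .
  moreover have "card V > 0" using fin by (simp add: card_gt_0_iff)
  ultimately show False using 1 2 by linarith
qed

text \<open>The assumption on \<open>two_nbrs\<close> passes to subgraphs, so a vertex of degree at
  most 33 can be removed repeatedly.\<close>

lemma card_edges_le:
  assumes "finite V" "\<And>e. e \<in> E \<Longrightarrow> card e = 2 \<and> e \<subseteq> V"
    and "\<And>A. A \<subseteq> V \<Longrightarrow> card (two_nbrs V E A) \<le> 2 * card A"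
  shows "card E \<le> 33 * card V"
  using assms
proof (induction "card V" arbitrary: V E)
  case 0
  then have "E = {}" by fastforce
  then show ?case by simp
next
  case (Suc n)
  have finE: "finite E" using Suc.prems(1,2) by (meson PowI finite_Pow_iff finite_subset subsetI)
  obtain v where v: "v \<in> V" "card {x \<in> V. {v, x} \<in> E} \<le> 33"
    using low_degree_vertex[OF Suc.prems(1) _ Suc.prems(3)] Suc.hyps(2) by fastforce
  let ?E = "{e \<in> E. v \<notin> e}"
  have "card ?E \<le> 33 * card (V - {v})"
  proof (rule Suc.hyps(1))
    show "n = card (V - {v})" using Suc.hyps(2) v(1) Suc.prems(1) by simp
    show "finite (V - {v})" using Suc.prems(1) by simp
    show "card e = 2 \<and> e \<subseteq> V - {v}" if "e \<in> ?E" for e using that Suc.prems(2)[of e] by auto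
    show "card (two_nbrs (V - {v}) ?E A) \<le> 2 * card A" if "A \<subseteq> V - {v}" for A
    proof -
      have "two_nbrs (V - {v}) ?E A \<subseteq> two_nbrs V E A" unfolding two_nbrs_def by blast
      moreover have "finite (two_nbrs V E A)" using Suc.prems(1) by (simp add: two_nbrs_def)
      ultimately have "card (two_nbrs (V - {v}) ?E A) \<le> card (two_nbrs V E A)" by (simp add: card_mono)
      moreover have "A \<subseteq> V" using that by blast
      ultimately show ?thesis using Suc.prems(3)[of A] by linarith
    qed
  qed
  moreover have "card {e \<in> E. v \<in> e} \<le> 33" using card_incident[OF Suc.prems(2)] v(2) by simp
  moreover have "card E \<le> card ?E + card {e \<in> E. v \<in> e}"
    using finE by (intro order_trans[OF card_mono card_Un_le]) auto
  moreover have "card V = Suc (card (V - {v}))" using card.remove[OF Suc.prems(1) v(1)] .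
  ultimately show ?case by linarith
qed

text \<open>The drawing is restricted. A smaller drawing has a larger outside, so the kept vertices
  stay in its closure, and lying on the drawing they are not interior to it.\<close>

lemma outerplanar_induced:
  assumes X: "X \<in> sd_instances" and "outerplanar (verts X) (edges X)"
  shows "outerplanar (verts (induced K X)) (edges (induced K X))"
proof -
  let ?Y = "induced K X" and ?g = "emb K X"
  let ?D = "\<lambda>V E p \<gamma>. p ` V \<union> (\<Union>e\<in>E. path_image (\<gamma> e))"
  obtain p :: "nat \<Rightarrow> complex" and \<gamma> where d: "plane_drawing (verts X) (edges X) p \<gamma>"
    and f: "\<And>v. v \<in> verts X \<Longrightarrow> p v \<in> frontier (outside (?D (verts X) (edges X) p \<gamma>))"
    using assms(2) unfolding outerplanar_def Let_def by blast
  define p' where "p' = p \<circ> ?g"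
  define \<gamma>' where "\<gamma>' = \<gamma> \<circ> (`) ?g"
  have V: "?g ` verts ?Y \<subseteq> verts X" unfolding emb_image by blast
  have E: "?g ` e \<in> edges X" "e \<subseteq> verts ?Y" if "e \<in> edges ?Y" for e
    using that by (auto simp: edges_induced_iff[OF X])
  have "plane_drawing (verts ?Y) (edges ?Y) p' \<gamma>'"
    unfolding plane_drawing_def
  proof (intro conjI ballI impI)
    show "inj_on p' (verts ?Y)"
      unfolding p'_def using d V by (intro comp_inj_on[OF emb_inj]) (auto simp: plane_drawing_def intro: inj_on_subset)
  next
    fix e assume e: "e \<in> edges ?Y"
    note dE = d[unfolded plane_drawing_def, THEN conjunct2, THEN conjunct1, rule_format, OF E(1)[OF e]]
    show "arc (\<gamma>' e)" "{pathstart (\<gamma>' e), pathfinish (\<gamma>' e)} = p' ` e"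
      using dE unfolding \<gamma>'_def p'_def by (auto simp: image_comp)
    have "p ` ?g ` e \<subseteq> p ` ?g ` verts ?Y" using E(2)[OF e] by blast
    moreover have "p ` ?g ` verts ?Y \<subseteq> p ` verts X" using V by blast
    ultimately show "path_image (\<gamma>' e) \<inter> p' ` verts ?Y = p' ` e"
      using dE unfolding \<gamma>'_def p'_def image_comp[symmetric] comp_apply by blast
  next
    fix e e' assume e: "e \<in> edges ?Y" "e' \<in> edges ?Y" "e \<noteq> e'"
    have "?g ` e \<noteq> ?g ` e'"
      using e(3) inj_on_image_eq_iff[OF emb_inj E(2)[OF e(1)] E(2)[OF e(2)]] by blast
    then have "path_image (\<gamma> (?g ` e)) \<inter> path_image (\<gamma> (?g ` e')) = p ` (?g ` e \<inter> ?g ` e')"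
      by (rule d[unfolded plane_drawing_def, THEN conjunct2, THEN conjunct2, rule_format,
            OF E(1)[OF e(1)] E(1)[OF e(2)]])
    also have "?g ` e \<inter> ?g ` e' = ?g ` (e \<inter> e')"
      using inj_on_image_Int[OF emb_inj E(2)[OF e(1)] E(2)[OF e(2)]] by simp
    finally show "path_image (\<gamma>' e) \<inter> path_image (\<gamma>' e') = p' ` (e \<inter> e')"
      by (simp add: \<gamma>'_def p'_def image_comp)
  qed
  moreover have "p' v \<in> frontier (outside (?D (verts ?Y) (edges ?Y) p' \<gamma>'))" if v: "v \<in> verts ?Y" for v
  proof -
    let ?D' = "?D (verts ?Y) (edges ?Y) p' \<gamma>'"
    have "?D' \<subseteq> ?D (verts X) (edges X) p \<gamma>" using V E(1) by (auto simp: p'_def \<gamma>'_def)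
    then have "closure (outside (?D (verts X) (edges X) p \<gamma>)) \<subseteq> closure (outside ?D')"
      by (intro closure_mono outside_mono)
    moreover have "p' v \<in> closure (outside (?D (verts X) (edges X) p \<gamma>))"
      using f[of "?g v"] v V by (auto simp: p'_def frontier_def)
    moreover have "p' v \<notin> interior (outside ?D')"
      using v outside_no_overlap[of ?D'] interior_subset by blast
    ultimately show ?thesis by (auto simp: frontier_def)
  qed
  ultimately show ?thesis unfolding outerplanar_def Let_def by blast
qed

section \<open>Kernels\<close>

lemma ptime_on_computes:
  assumes "ptime_on A f"
  shows "\<exists>c (q :: nat poly). \<forall>\<Omega>. \<forall>a\<in>A. computes_within \<Omega> c a (poly q (size a)) (f \<Omega> a)"
  using assms unfolding ptime_on_def computes_within_def by (meson add_leD1)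

lemma linear_bigo: "(\<lambda>k. real (a * k + b)) \<in> O(\<lambda>k. real k)"
proof (rule bigoI)
  show "\<forall>\<^sub>F k in sequentially. norm (real (a * k + b)) \<le> (real a + real b) * norm (real k)"
    unfolding eventually_sequentially
  proof (intro exI[of _ 1] allI impI)
    fix k :: nat assume "1 \<le> k"
    then have "real b * 1 \<le> real b * real k" by (intro mult_left_mono) auto
    then show "norm (real (a * k + b)) \<le> (real a + real b) * norm (real k)"
      by (simp add: algebra_simps)
  qed
qed

section \<open>Encoding sizes and the kernel for the feedback edge number\<close>

lemma size_enc_edges: "size (enc_edges n F) \<le> n * (n * 2 + 1)"
proof -
  have "size (enc_list (map (\<lambda>v. enc_bool ({u, v} \<in> F)) [0..<n])) \<le> n * 2" for u
    by (rule order_trans[OF size_enc_list_le[of _ 1]]) (use size_enc_bool in auto)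
  then show ?thesis
    unfolding enc_edges_def by (intro order_trans[OF size_enc_list_le[of _ "n * 2"]]) auto
qed

text \<open>The cubic term comes from the deletion sets, one square matrix for each vertex.\<close>

definition enc_poly :: "nat poly" where
  "enc_poly = [:5, 5, 3, 2:]"

lemma size_enc_instance:
  assumes "X \<in> sd_instances"
  shows "size (enc_instance X) \<le> poly enc_poly (num_verts X)"
proof -
  let ?n = "num_verts X"
  have "src X < ?n" "tgt X < ?n" using sd_instancesD(5,6)[OF assms] by (auto simp: verts_def)
  moreover have "size (enc_list (map (\<lambda>v. enc_edges ?n (dels X v)) [0..<?n])) \<le> ?n * (?n * (?n * 2 + 1) + 1)"
    by (rule order_trans[OF size_enc_list_le[of _ "?n * (?n * 2 + 1)"]]) (use size_enc_edges in auto)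
  moreover note size_enc_edges[of ?n "edges X"]
  ultimately have "size (enc_instance X) \<le>
      5 + ?n + ?n * (?n * 2 + 1) + ?n * (?n * (?n * 2 + 1) + 1) + ?n + ?n"
    by (simp add: enc_instance_def Let_def)
  also have "\<dots> \<le> poly enc_poly ?n" by (simp add: enc_poly_def algebra_simps)
  finally show ?thesis .
qed

lemma num_verts_le_size: "num_verts X \<le> size (enc_instance X)"
  by (simp add: enc_instance_def Let_def)

text \<open>A step either removes a vertex or finds the instance fully reduced and leaves it
  unchanged. The parameter in the excess bound is that of the original \<open>X\<close>, so the
  feedback edge numbers of the intermediate instances never enter.\<close>

lemma iterate_stepT:
  assumes X: "X \<in> sd_instances"
  shows "\<exists>Y\<in>sd_instances. (stepT ^^ i) (enc_instance X) = enc_instance Y \<and>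
    (self_deleting_st_path Y \<longleftrightarrow> self_deleting_st_path X) \<and>
    edge_excess_le (verts Y) (edges Y) (fen X) \<and> num_verts Y \<le> num_verts X \<and>
    (fully_reduced Y \<or> num_verts Y + i \<le> num_verts X)"
proof (induction i)
  case 0
  then show ?case using X edge_excess_le_fen[OF X] by auto
next
  case (Suc i)
  then obtain Y where Y: "Y \<in> sd_instances" "(stepT ^^ i) (enc_instance X) = enc_instance Y"
    "self_deleting_st_path Y \<longleftrightarrow> self_deleting_st_path X"
    "edge_excess_le (verts Y) (edges Y) (fen X)" "num_verts Y \<le> num_verts X"
    "fully_reduced Y \<or> num_verts Y + i \<le> num_verts X" by blast
  obtain Z where Z: "stepT (enc_instance Y) = enc_instance Z" "reduces Y Z \<or> fully_reduced Y \<and> Z = Y"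
    using stepT_enc[OF Y(1)] by blast
  have step: "(stepT ^^ Suc i) (enc_instance X) = enc_instance Z" using Y(2) Z(1) by simp
  show ?case
  proof (cases "fully_reduced Y \<and> Z = Y")
    case True
    then show ?thesis using Y step by auto
  next
    case False
    then have r: "reduces Y Z" using Z(2) by blast
    then have "\<not> fully_reduced Y" unfolding reduces_def fully_reduced_def by blast
    then have "num_verts Y + i \<le> num_verts X" using Y(6) by blast
    then show ?thesis
      using reduces_props[OF Y(1) r] Y(3-5) step by (intro bexI[of _ Z]) auto
  qed
qed

lemma kernel_fen: "admits_kernel enc_instance sd_instances self_deleting_st_path fen graph_size (\<lambda>k. 11 * k + 24)"
proof -
  let ?A = "enc_instance ` sd_instances"
  let ?f = "\<lambda>a. (stepT ^^ length (elems (left a))) a"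
  have "ptime_on ?A (\<lambda>\<Omega> a. ((\<lambda>\<Omega>. stepT) \<Omega> ^^ length (elems (left a))) a)"
  proof (rule ptime_on_iterate[where B = UNIV])
    show "ptime (\<lambda>\<Omega>. stepT)" by (rule ptime_stepT)
    show "ptime_on ?A (\<lambda>\<Omega> a. a)" by (rule ptime_on_mono[OF ptime_id]) simp
    show "ptime_on ?A (\<lambda>\<Omega> a. left a)" by (rule ptime_on_mono[OF ptime_left0]) simp
    \<comment> \<open>Iterates of an encoded instance encode instances with no more vertices, which
      bounds their size.\<close>
    fix a i assume "a \<in> ?A"
    then obtain X where X: "X \<in> sd_instances" "a = enc_instance X" by blast
    obtain Y where Y: "Y \<in> sd_instances" "(stepT ^^ i) a = enc_instance Y" "num_verts Y \<le> num_verts X"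
      using iterate_stepT[OF X(1)] X(2) by blast
    have "size (enc_instance Y) \<le> poly enc_poly (num_verts Y)" by (rule size_enc_instance[OF Y(1)])
    also have "\<dots> \<le> poly enc_poly (size a)"
      using Y(3) num_verts_le_size[of X] X(2) by (intro poly_nat_mono) simp
    finally show "size ((stepT ^^ i) a) \<le> poly enc_poly (size a)" using Y(2) by simp
  qed simp
  then obtain c q where cq: "\<And>\<Omega> X. X \<in> sd_instances \<Longrightarrow>
      computes_within \<Omega> c (enc_instance X) (poly q (size (enc_instance X))) (?f (enc_instance X))"
    using ptime_on_computes by blast
  show ?thesis
    unfolding admits_kernel_def
  proof (intro exI ballI)
    fix X assume X: "X \<in> sd_instances"
    obtain Y where Y: "Y \<in> sd_instances" "?f (enc_instance X) = enc_instance Y"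
      "self_deleting_st_path Y \<longleftrightarrow> self_deleting_st_path X"
      "edge_excess_le (verts Y) (edges Y) (fen X)"
      "fully_reduced Y \<or> num_verts Y + num_verts X \<le> num_verts X"
      using iterate_stepT[OF X, of "num_verts X"] by auto
    \<comment> \<open>After as many steps as there are vertices, an instance that is not fully
      reduced would be empty, but it contains its source.\<close>
    have "num_verts Y \<noteq> 0" using sd_instancesD(5)[OF Y(1)] by (auto simp: verts_def)
    then have "graph_size Y \<le> 11 * fen X + 24" using fully_reduced_size[OF Y(1) _ Y(4)] Y(5) by simp
    then show "\<exists>y\<in>sd_instances. computes_within (\<lambda>_. False) c (enc_instance X)
        (poly q (size (enc_instance X))) (enc_instance y) \<and>
        self_deleting_st_path y = self_deleting_st_path X \<and> graph_size y \<le> 11 * fen X + 24"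
      using cq[OF X, of "\<lambda>_. False"] Y by auto
  qed
qed

section \<open>The kernel for the vertex cover number on outerplanar graphs\<close>

definition kernel_vertexT :: "tree \<Rightarrow> tree \<Rightarrow> bool" where
  "kernel_vertexT a v \<longleftrightarrow> (let V = set (elems (uptT (left a))) in v = srcT a \<or> v = tgtT a \<or>
     (\<exists>x\<in>V. \<exists>y\<in>V. \<not> x = y \<and> adjT a v x \<and> adjT a v y))"

lemma pdec_kernel_vertexT: "pdec (\<lambda>\<Omega> p. kernel_vertexT (left p) (right p))"
  unfolding kernel_vertexT_def Let_def by (intro ptime_intros ptime_access)

text \<open>One round of deletions suffices because degrees are counted in \<open>X\<close>: a kept
  nonterminal outside the cover \<open>S\<close> has two neighbours in \<open>X\<close>, and these
  lie in \<open>S\<close>. Hence at most 3 vc + 2 vertices and 33 times as many edges remain, and 34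
  (3 vc + 2) = 102 vc + 68.\<close>

lemma kernel_outerplanar:
  "admits_kernel enc_instance outerplanar_instances self_deleting_st_path vc graph_size (\<lambda>k. 102 * k + 68)"
proof -
  have "ptime (\<lambda>\<Omega> a. inducedT (\<lambda>v. kernel_vertexT a v) a)"
    by (intro ptime_inducedT pdec_kernel_vertexT ptime_id)
  then obtain c q where cq: "\<And>\<Omega> a. computes_within \<Omega> c a (poly q (size a)) (inducedT (kernel_vertexT a) a)"
    using ptime_on_computes by blast
  show ?thesis
    unfolding admits_kernel_def
  proof (intro exI ballI)
    fix X assume "X \<in> outerplanar_instances"
    then have X: "X \<in> sd_instances" and op: "outerplanar (verts X) (edges X)"
      by (auto simp: outerplanar_instances_def)
    let ?V = "verts X" and ?E = "edges X"
    define K where "K v \<longleftrightarrow> v = src X \<or> v = tgt X \<or>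
      (\<exists>x\<in>?V. \<exists>y\<in>?V. x \<noteq> y \<and> {v, x} \<in> ?E \<and> {v, y} \<in> ?E)" for v
    define Y where "Y = induced K X"
    have K: "K (src X)" "K (tgt X)" by (auto simp: K_def)
    have "kernel_vertexT (enc_instance X) (enc_nat v) = K v" if "v < num_verts X" for v
      using that unfolding kernel_vertexT_def Let_def verts_T K_def by (simp add: verts_def)
    then have enc: "inducedT (kernel_vertexT (enc_instance X)) (enc_instance X) = enc_instance Y"
      unfolding Y_def using sd_instancesD(5,6)[OF X] by (intro inducedT_enc) (auto simp: verts_def)
    have Y: "Y \<in> sd_instances" unfolding Y_def by (rule induced_in_sd_instances[OF X K])
    have opY: "outerplanar (verts Y) (edges Y)" unfolding Y_def by (rule outerplanar_induced[OF X op])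
    have "K v" if "st_path X vs" "v \<in> set vs" for vs v
    proof (rule ccontr)
      assume nK: "\<not> K v"
      have v: "v \<in> ?V" using that by (auto simp: st_path_def graph_path_iff)
      have "\<forall>x\<in>?V. \<forall>y\<in>?V. {v, x} \<in> ?E \<longrightarrow> {v, y} \<in> ?E \<longrightarrow> x = y" using nK by (auto simp: K_def)
      then have "\<exists>p\<in>?V. \<forall>x\<in>?V. {v, x} \<in> ?E \<longrightarrow> x = p" using v by metis
      then have "removable ?V ?E (src X) (tgt X) v" using nK by (auto simp: removable_def K_def)
      then show False using removable_not_on_path that by (metis st_path_def)
    qed
    then have "(\<exists>vs. st_path X vs \<and> (\<forall>v\<in>set vs. K v)) \<longleftrightarrow> self_deleting_st_path X"
      unfolding self_deleting_st_path_iff by (intro ex_cong1) auto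
    then have yes: "self_deleting_st_path Y \<longleftrightarrow> self_deleting_st_path X"
      unfolding Y_def yes_induced[of X K, OF X K] .
    have "{e \<in> ?E. e \<subseteq> ?V - ?V} = {}" using sd_instancesD(3)[OF X] by fastforce
    then have "\<exists>k. \<exists>S\<subseteq>?V. card S = k \<and> {e \<in> ?E. e \<subseteq> ?V - S} = {}" by blast
    then have "\<exists>S\<subseteq>?V. card S = vc X \<and> {e \<in> ?E. e \<subseteq> ?V - S} = {}"
      unfolding vc_def vertex_cover_number_def by (rule LeastI_ex)
    then obtain S where S: "S \<subseteq> ?V" "card S = vc X" "{e \<in> ?E. e \<subseteq> ?V - S} = {}" by blast
    have "{v \<in> ?V. K v} \<subseteq> S \<union> two_nbrs ?V ?E S \<union> {src X, tgt X}"
    proof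
      fix v assume v: "v \<in> {v \<in> ?V. K v}"
      show "v \<in> S \<union> two_nbrs ?V ?E S \<union> {src X, tgt X}"
      proof (rule ccontr)
        assume n: "v \<notin> S \<union> two_nbrs ?V ?E S \<union> {src X, tgt X}"
        then obtain x y where xy: "x \<in> ?V" "y \<in> ?V" "x \<noteq> y" "{v, x} \<in> ?E" "{v, y} \<in> ?E"
          using v by (auto simp: K_def)
        have "z \<in> S" if "z \<in> ?V" "{v, z} \<in> ?E" for z
          using S(3) n v that by blast
        then have "x \<in> S" "y \<in> S" using xy by blast+
        moreover have "{x, v} \<in> ?E" "{y, v} \<in> ?E" using xy by (simp_all add: insert_commute[of _ v])
        ultimately have "v \<in> two_nbrs ?V ?E S" using n v xy(3) unfolding two_nbrs_def by blast
        then show False using n by blast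
      qed
    qed
    moreover have "finite (S \<union> two_nbrs ?V ?E S \<union> {src X, tgt X})"
      using sd_instancesD(1)[OF X] S(1) finite_subset by (auto simp: two_nbrs_def)
    ultimately have "card (verts Y) \<le> card (S \<union> two_nbrs ?V ?E S \<union> {src X, tgt X})"
      unfolding Y_def card_verts_induced by (rule card_mono[rotated])
    also have "\<dots> \<le> card S + card (two_nbrs ?V ?E S) + card {src X, tgt X}"
      using card_Un_le[of "S \<union> two_nbrs ?V ?E S" "{src X, tgt X}"] card_Un_le[of S "two_nbrs ?V ?E S"]
      by linarith
    also have "card {src X, tgt X} \<le> 2" by (simp add: card_insert_if)
    also have "card (two_nbrs ?V ?E S) \<le> 2 * card S"
      by (rule outerplanar_two_nbrs[OF op sd_instancesD(1)[OF X] S(1)])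
    finally have "card (verts Y) \<le> 3 * vc X + 2" using S(2) by simp
    moreover have "card (edges Y) \<le> 33 * card (verts Y)"
      using sd_instancesD[OF Y] outerplanar_two_nbrs[OF opY] by (intro card_edges_le) auto
    ultimately have "graph_size Y \<le> 102 * vc X + 68" by (simp add: graph_size_def)
    then show "\<exists>y\<in>outerplanar_instances. computes_within (\<lambda>_. False) c (enc_instance X)
        (poly q (size (enc_instance X))) (enc_instance y) \<and>
        self_deleting_st_path y = self_deleting_st_path X \<and> graph_size y \<le> 102 * vc X + 68"
      using cq[of "\<lambda>_. False" "enc_instance X"] enc Y opY yes
      by (intro bexI[of _ Y]) (auto simp: outerplanar_instances_def)
  qed
qed

section \<open>Shortest conforming paths in cliques and the Turing kernel\<close>

lemma clique_short_path:
  assumes X: "X \<in> clique_instances" and yes: "self_deleting_st_path X"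
  obtains vs v where "st_path X vs" "v \<in> verts X"
    "set vs \<subseteq> {src X, v} \<union> {x. {src X, x} \<in> dels X (src X)}"
proof -
  let ?s = "src X"
  have sd: "X \<in> sd_instances" and comp: "edges X = {e. e \<subseteq> verts X \<and> card e = 2}"
    using X by (auto simp: clique_instances_def complete_graph_def)
  obtain vs where vs: "st_path X vs" "\<And>ws. st_path X ws \<Longrightarrow> length vs \<le> length ws"
    using ex_has_least_nat[of "st_path X" _ length] yes unfolding self_deleting_st_path_iff by blast
  then have hd: "vs \<noteq> []" "hd vs = ?s" by (auto simp: st_path_def graph_path_iff)
  then obtain rest where r: "vs = ?s # rest" by (cases vs) auto
  show thesis
  proof (cases rest)
    case Nil
    \<comment> \<open>A path of one vertex has no second vertex; the source itself takes its
      place.\<close>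
    then show thesis using that[OF vs(1), of ?s] r sd_instancesD(5)[OF sd] by simp
  next
    case (Cons v ys)
    have path: "distinct (?s # v # ys)" "set (?s # v # ys) \<subseteq> verts X" "pedges (?s # v # ys) \<subseteq> edges X"
      "conforming (dels X) (?s # v # ys)" "last (?s # v # ys) = tgt X"
      using vs(1) r Cons by (auto simp: st_path_def graph_path_iff)
    \<comment> \<open>Otherwise the source could go to \<open>x\<close> at once, the edge being
      present in a clique. The shortcut conforms: its tail is a suffix of the old path, whose edges
      the source does not delete, and skipping vertices only drops constraints. It is shorter
      because it omits \<open>v\<close>.\<close>
    have "{?s, x} \<in> dels X ?s" if "x \<in> set ys" for x
    proof (rule ccontr)
      assume n: "{?s, x} \<notin> dels X ?s"
      obtain as bs where ys: "ys = as @ x # bs" using \<open>x \<in> set ys\<close> by (meson split_list)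
      have sub: "pedges (x # bs) \<subseteq> pedges (?s # v # ys)"
        using pedges_suffix[of "x # bs" "?s # v # as"] ys by simp
      have "{?s, x} \<in> edges X" using path(1,2) ys unfolding comp by auto
      then have "graph_path (verts X) (edges X) (?s # x # bs)"
        using path sub ys by (auto simp: graph_path_iff)
      moreover have "conforming (dels X) (x # bs)"
        using path(4) conforming_append[of "dels X" "?s # v # as" x bs] ys by simp
      then have "conforming (dels X) (?s # x # bs)"
        using n sub path(4) by (auto simp: conforming_Cons[of _ ?s])
      moreover have "last (?s # x # bs) = tgt X" using path(5) ys by simp
      ultimately have "st_path X (?s # x # bs)" by (simp add: st_path_def)
      from vs(2)[OF this] show False using r Cons ys by simp
    qed
    then show thesis using that[OF vs(1), of v] path(2) r Cons by auto
  qed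
qed

definition candidateT :: "tree \<Rightarrow> tree \<Rightarrow> tree \<Rightarrow> bool" where
  "candidateT a v i \<longleftrightarrow> i = srcT a \<or> i = tgtT a \<or> i = v \<or> delT a (srcT a) (srcT a) i"

lemma pdec_candidateT:
  "ptime f \<Longrightarrow> ptime g \<Longrightarrow> ptime h \<Longrightarrow> pdec (\<lambda>\<Omega> a. candidateT (f \<Omega> a) (g \<Omega> a) (h \<Omega> a))"
  unfolding candidateT_def by (intro ptime_intros ptime_access)

text \<open>Every query is an induced subclique within the size bound, so the oracle can be trusted
  on it. Its paths are paths of \<open>X\<close>, so any positive answer is sound, and
  \<open>clique_short_path\<close> provides a candidate for which a solvable instance gets one. The
  bound is written \<open>1 * k + 3\<close> to fit \<open>linear_bigo\<close>.\<close>

lemma turing_kernel_clique: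
  "admits_turing_kernel enc_instance clique_instances self_deleting_st_path mu num_verts (\<lambda>k. 1 * k + 3)"
proof -
  let ?f = "\<lambda>\<Omega> a. \<exists>v\<in>set (elems (uptT (left a))). \<Omega> (inducedT (\<lambda>i. candidateT a v i) a)"
  have "ptime (\<lambda>\<Omega> a. enc_bool (?f \<Omega> a))"
    by (intro ptime_intros pdec_oracle ptime_inducedT pdec_candidateT)
  then obtain c q where cq: "\<And>\<Omega> a. computes_within \<Omega> c a (poly q (size a)) (enc_bool (?f \<Omega> a))"
    using ptime_on_computes by blast
  show ?thesis
    unfolding admits_turing_kernel_def
  proof (intro exI ballI allI impI)
    fix X \<Omega>
    assume XC: "X \<in> clique_instances"
      and orc: "\<forall>y\<in>clique_instances. num_verts y \<le> 1 * mu X + 3 \<longrightarrow> \<Omega> (enc_instance y) = self_deleting_st_path y"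
    have X: "X \<in> sd_instances" and comp: "edges X = {e. e \<subseteq> verts X \<and> card e = 2}"
      using XC by (auto simp: clique_instances_def complete_graph_def)
    let ?s = "src X" and ?V = "verts X"
    let ?D = "{x. {?s, x} \<in> dels X ?s}"
    define K where "K v i \<longleftrightarrow> i = ?s \<or> i = tgt X \<or> i = v \<or> {?s, i} \<in> dels X ?s" for v i
    have K: "K v ?s" "K v (tgt X)" for v by (auto simp: K_def)
    have n: "?s < num_verts X" "tgt X < num_verts X" using sd_instancesD(5,6)[OF X] by (auto simp: verts_def)
    have enc: "inducedT (candidateT (enc_instance X) (enc_nat v)) (enc_instance X) = enc_instance (induced (K v) X)" for v
      by (rule inducedT_enc) (use n in \<open>auto simp: candidateT_def K_def\<close>)
    have fins: "finite (dels X ?s)"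
      using sd_instancesD(4,5,7)[OF X] finite_subset by blast
    have cardD: "card ?D \<le> mu X" "finite ?D"
    proof -
      have inj: "inj_on (\<lambda>x. {?s, x}) ?D" by (auto simp: inj_on_def doubleton_eq_iff)
      have img: "(\<lambda>x. {?s, x}) ` ?D \<subseteq> dels X ?s" by blast
      show "finite ?D" using inj img fins by (meson finite_imageD finite_subset)
      have "card ?D \<le> card (dels X ?s)" by (rule card_inj_on_le[OF inj img fins])
      also have "\<dots> \<le> mu X"
        unfolding mu_def max_deletion_def using sd_instancesD(1,5)[OF X] by (intro Max_ge) auto
      finally show "card ?D \<le> mu X" .
    qed
    have query: "\<Omega> (enc_instance (induced (K v) X)) \<longleftrightarrow> self_deleting_st_path (induced (K v) X)" for v
    proof -
      let ?Y = "induced (K v) X"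
      have Y: "?Y \<in> sd_instances" by (rule induced_in_sd_instances[OF X K])
      have "e \<in> edges ?Y" if "e \<subseteq> verts ?Y" "card e = 2" for e
      proof -
        have "card (emb (K v) X ` e) = 2" using that card_image[OF inj_on_subset[OF emb_inj]] by metis
        moreover have "emb (K v) X ` e \<subseteq> ?V" using that(1) emb_image[of "K v" X] by blast
        ultimately show ?thesis using that(1) unfolding edges_induced_iff[OF X] comp by blast
      qed
      then have "complete_graph (verts ?Y) (edges ?Y)"
        using sd_instancesD(1-3)[OF Y] unfolding complete_graph_def by blast
      then have "?Y \<in> clique_instances" using Y by (simp add: clique_instances_def)
      moreover have "num_verts ?Y \<le> 1 * mu X + 3"
      proof -
        have "num_verts ?Y = card {i \<in> ?V. K v i}" using card_verts card_verts_induced by metis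
        also have "\<dots> \<le> card ({?s, tgt X, v} \<union> ?D)"
          using cardD(2) by (intro card_mono) (auto simp: K_def)
        also have "\<dots> \<le> card {?s, tgt X, v} + card ?D" by (rule card_Un_le)
        also have "card {?s, tgt X, v} \<le> 3" by (simp add: card_insert_if)
        finally show ?thesis using cardD(1) by simp
      qed
      ultimately show ?thesis using orc by blast
    qed
    have "?f \<Omega> (enc_instance X) \<longleftrightarrow> (\<exists>v\<in>?V. self_deleting_st_path (induced (K v) X))"
      unfolding verts_T using enc query by simp
    also have "\<dots> \<longleftrightarrow> self_deleting_st_path X"
    proof
      assume "\<exists>v\<in>?V. self_deleting_st_path (induced (K v) X)"
      then obtain v where "self_deleting_st_path (induced (K v) X)" by blast
      then obtain vs where "st_path X vs" unfolding yes_induced[of X "K v", OF X K] by blast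
      then show "self_deleting_st_path X" unfolding self_deleting_st_path_iff by blast
    next
      assume "self_deleting_st_path X"
      then obtain vs v where "st_path X vs" "v \<in> ?V" "set vs \<subseteq> {?s, v} \<union> ?D"
        using clique_short_path[OF XC] by blast
      then have "self_deleting_st_path (induced (K v) X)"
        unfolding yes_induced[of X "K v", OF X K] by (intro exI[of _ vs]) (auto simp: K_def)
      then show "\<exists>v\<in>?V. self_deleting_st_path (induced (K v) X)" using \<open>v \<in> ?V\<close> by blast
    qed
    finally show "computes_within \<Omega> c (enc_instance X) (poly q (size (enc_instance X)))
        (enc_bool (self_deleting_st_path X))"
      using cq[of \<Omega> "enc_instance X"] by simp
  qed
qed

theorem theorem35:
  "(\<exists>g :: nat \<Rightarrow> nat. (\<lambda>k. real (g k)) \<in> O(\<lambda>k. real k) \<and>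
      admits_kernel enc_instance sd_instances self_deleting_st_path fen graph_size g) \<and>
   (\<exists>g :: nat \<Rightarrow> nat. (\<lambda>k. real (g k)) \<in> O(\<lambda>k. real k) \<and>
      admits_kernel enc_instance outerplanar_instances self_deleting_st_path vc graph_size g) \<and>
   (\<exists>g :: nat \<Rightarrow> nat. (\<lambda>k. real (g k)) \<in> O(\<lambda>k. real k) \<and>
      admits_turing_kernel enc_instance clique_instances self_deleting_st_path mu num_verts g)"
  by (intro conjI)
    (rule exI, rule conjI[OF linear_bigo], rule kernel_fen kernel_outerplanar turing_kernel_clique)+

end
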